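(* Let $b,\sigma$ satisfy the conditions (a), (b) listed in the context. Let $\hat\rho_t$ be the density of the time-continuous interpolation $X^h_t$ of the Euler scheme started from $X_0^h\sim\rho_0$, and let $R,R_2$ be as defined in the context. Then for $p\ge1$ and $t>0$, $$\int_{\mathbb{R}^d}|\nabla\log\hat\rho_t(x)|^p\hat\rho_t(x)\,dx\le C\left(\int_{\mathbb{R}^d}|\nabla\log\rho_0(y)|^p\rho_0(y)\,dy+\mathbb{E}\big[|R(t,X^h_t;0,X^h_0)|^p\big]\right),$$ where $C$ depends only on $p$ and the expectation is taken over the joint law of $(X_0^h,X_t^h)$. Similarly, $$\int_{\mathbb{R}^d}|\nabla^2\log\hat\rho_t(x)|^p\hat\rho_t(x)\,dx\le C\Big(\int_{\mathbb{R}^d}|\nabla^2\log\rho_0(y)|^p\rho_0(y)\,dy+\mathbb{E}\big[|R_2(t,X^h_t;0,X^h_0)|^p\big]+\int_{\mathbb{R}^d}|\nabla\log\rho_0(y)|^{2p}\rho_0(y)\,dy+\mathbb{E}\big[|R(t,X^h_t;0,X^h_0)|^{2p}\big]\Big),$$ where the expectation has the same meaning.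
   Context: Setting. $W$ is a standard $m$-dimensional Brownian motion, $b:\mathbb{R}_+\times\mathbb{R}^d\to\mathbb{R}^d$, $\sigma:\mathbb{R}_+\times\mathbb{R}^d\to\mathbb{R}^{d\times m}$, $\Lambda(t,x)=\sigma(t,x)\sigma(t,x)^T$. Conditions on the coefficients: there are constants $L,C>0$, $q\ge0$, $\kappa>0$ such that (a) $b\in C^3(\mathbb{R}_+\times\mathbb{R}^d;\mathbb{R}^d)$; $|b(t,x_1)-b(t,x_2)|\le L|x_1-x_2|$ for all $t\ge0$; $|b(t_1,x)-b(t_2,x)|\le L|t_2-t_1|(1+|x|^q)$; $\sup_{t\ge0}|\partial_x^\alpha b(t,x)|\le C(1+|x|^q)$ for $2\le|\alpha|\le3$. (b) $\sigma\in C^3(\mathbb{R}_+\times\mathbb{R}^d;\mathbb{R}^{d\times m})$; $|\sigma(t,x_1)-\sigma(t,x_2)|\le L|x_1-x_2|$ for all $t\ge0$; $\sup_{t\ge0}|\partial_x^\alpha\sigma(t,x)|<C(1+|x|^q)$ for $2\le|\alpha|\le3$; $\Lambda(t,x)-\kappa I$ is positive semidefinite for all $(t,x)$; and $|\Lambda(t_1,x)-\Lambda(t_2,x)|+|\nabla_x\cdot\Lambda(t_1,x)-\nabla_x\cdot\Lambda(t_2,x)|\le L|t_2-t_1|(1+|x|^q)$. Interpolated Euler scheme: with time step $h>0$, $t_k=kh$, for $t\in[t_k,t_{k+1}]$, $$X^h_t=X^h_{t_k}+\int_{t_k}^t b(t_k,X^h_{t_k})\,ds+\int_{t_k}^t\sigma(t_k,X^h_{t_k})\,dW_s,\qquad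 X^h_0\sim\rho_0,$$ with $X_0^h$ independent of $W$. The initial law has a density, also denoted $\rho_0$, positive and twice differentiable so that $\nabla\log\rho_0$ and $\nabla^2\log\rho_0$ are defined. $\hat\rho_t$ is the density of $X^h_t$. For $t>0$, $p(t,x;0,y)$ is the density at $x$ of $X^h_t$ conditioned on $X^h_0=y$; $R(t,x;0,y):=(\nabla_x+\nabla_y)\log p(t,x;0,y)\in\mathbb{R}^d$ and $R_2(t,x;0,y):=(\nabla_x+\nabla_y)^2\log p(t,x;0,y)\in\mathbb{R}^{d\times d}$, i.e. $(R_2)_{\ell k}=(\partial_{x_\ell}+\partial_{y_\ell})(\partial_{x_k}+\partial_{y_k})\log p$. $|\cdot|$ is the Euclidean norm for vectors and the spectral norm for matrices. Right-hand sides may be $+\infty$. *)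

theory Defs
  imports "HOL-Probability.Probability"
begin

section \<open>Differential operators\<close>

definition pderiv_x :: "'n::finite \<Rightarrow> (real^'n \<Rightarrow> 'b::real_normed_vector) \<Rightarrow> real^'n \<Rightarrow> 'b" where
  "pderiv_x i f x = vector_derivative (\<lambda>s. f (x + s *\<^sub>R axis i 1)) (at 0)"

definition grad :: "(real^'n::finite \<Rightarrow> real) \<Rightarrow> real^'n \<Rightarrow> real^'n" where
  "grad f x = (\<chi> i. pderiv_x i f x)"

definition hess :: "(real^'n::finite \<Rightarrow> real) \<Rightarrow> real^'n \<Rightarrow> real^'n^'n" where
  "hess f x = (\<chi> i j. pderiv_x i (pderiv_x j f) x)"

definition twice_differentiable :: "(real^'n::finite \<Rightarrow> real) \<Rightarrow> bool" where
  "twice_differentiable f \<longleftrightarrow>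
     (\<forall>x. f differentiable (at x)) \<and> (\<forall>x. grad f differentiable (at x))"

text \<open>A multi-index of order \<open>n\<close> is written as the list of the \<open>n\<close> coordinates in
  which one differentiates.  It is only applied to functions of class C3 and lists of length at
  most 3, so that the order of the coordinates is irrelevant.\<close>

definition pderivs :: "'n::finite list \<Rightarrow> (real^'n \<Rightarrow> 'b::real_normed_vector) \<Rightarrow> real^'n \<Rightarrow> 'b" where
  "pderivs is f = foldr pderiv_x is f"

text \<open>Class \<open>C\<^sup>k\<close> on a set.  Derivatives are taken relative to \<open>S\<close>, hence are one-sided in time
  at \<open>t = 0\<close> when \<open>S = {0..} \<times> UNIV\<close>; there the relative derivative is unique.\<close>

primrec Ck_on :: "nat \<Rightarrow> 'a::euclidean_space set \<Rightarrow> ('a \<Rightarrow> 'b::real_normed_vector) \<Rightarrow> bool" where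
  "Ck_on 0 S f \<longleftrightarrow> continuous_on S f"
| "Ck_on (Suc k) S f \<longleftrightarrow>
     (\<exists>f'. (\<forall>x\<in>S. (f has_derivative f' x) (at x within S)) \<and> (\<forall>v. Ck_on k S (\<lambda>x. f' x v)))"

definition matrix_div :: "(real^'n::finite \<Rightarrow> real^'n^'n) \<Rightarrow> real^'n \<Rightarrow> real^'n" where
  "matrix_div A x = (\<chi> i. \<Sum>j\<in>UNIV. pderiv_x j (\<lambda>z. A z $ i $ j) x)"

text \<open>The operators \<open>\<partial>\<^sub>x\<^sub>l + \<partial>\<^sub>y\<^sub>l\<close> and the quantities \<open>R\<close> and \<open>R\<^sub>2\<close> of a
  transition density, \<open>p x y\<close> being the density at \<open>x\<close> given the initial point \<open>y\<close>.\<close>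

definition pderiv_xy :: "'n::finite \<Rightarrow> (real^'n \<Rightarrow> real^'n \<Rightarrow> real) \<Rightarrow> real^'n \<Rightarrow> real^'n \<Rightarrow> real" where
  "pderiv_xy l F x y = pderiv_x l (\<lambda>x'. F x' y) x + pderiv_x l (\<lambda>y'. F x y') y"

definition R_score :: "(real^'n::finite \<Rightarrow> real^'n \<Rightarrow> real) \<Rightarrow> real^'n \<Rightarrow> real^'n \<Rightarrow> real^'n" where
  "R_score p x y = (\<chi> l. pderiv_xy l (\<lambda>x y. ln (p x y)) x y)"

definition R2_score :: "(real^'n::finite \<Rightarrow> real^'n \<Rightarrow> real) \<Rightarrow> real^'n \<Rightarrow> real^'n \<Rightarrow> real^'n^'n" where
  "R2_score p x y = (\<chi> l k. pderiv_xy l (pderiv_xy k (\<lambda>x y. ln (p x y))) x y)"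


section \<open>Conditions on the coefficients\<close>

definition spec_norm :: "real^'n::finite^'k::finite \<Rightarrow> real" where
  "spec_norm A = onorm ((*v) A)"

definition pos_semidef :: "real^'n::finite^'n \<Rightarrow> bool" where
  "pos_semidef A \<longleftrightarrow> transpose A = A \<and> (\<forall>v. 0 \<le> v \<bullet> (A *v v))"

text \<open>\<open>1 + |x|\<^sup>q\<close>.  The case distinction restores \<open>|0|\<^sup>0 = 1\<close>, as \<open>0 powr 0 = 0\<close>.\<close>

definition growth :: "real \<Rightarrow> real^'n::finite \<Rightarrow> real" where
  "growth q x = 1 + (if q = 0 then 1 else norm x powr q)"

definition diff_matrix ::
  "(real \<Rightarrow> real^'d::finite \<Rightarrow> real^'m::finite^'d) \<Rightarrow> real \<Rightarrow> real^'d \<Rightarrow> real^'d^'d" where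
  "diff_matrix \<sigma> t x = \<sigma> t x ** transpose (\<sigma> t x)"

definition drift_conditions ::
  "real \<Rightarrow> real \<Rightarrow> real \<Rightarrow> (real \<Rightarrow> real^'d::finite \<Rightarrow> real^'d) \<Rightarrow> bool" where
  "drift_conditions L C q b \<longleftrightarrow>
     Ck_on 3 ({0..} \<times> UNIV) (\<lambda>(t, x). b t x) \<and>
     (\<forall>t\<ge>0. \<forall>x1 x2. norm (b t x1 - b t x2) \<le> L * norm (x1 - x2)) \<and>
     (\<forall>t1\<ge>0. \<forall>t2\<ge>0. \<forall>x. norm (b t1 x - b t2 x) \<le> L * \<bar>t2 - t1\<bar> * growth q x) \<and>
     (\<forall>\<alpha> x. 2 \<le> length \<alpha> \<and> length \<alpha> \<le> 3 \<longrightarrow>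
        (SUP t\<in>{0..}. ereal (norm (pderivs \<alpha> (b t) x))) \<le> ereal (C * growth q x))"

definition diffusion_conditions ::
  "real \<Rightarrow> real \<Rightarrow> real \<Rightarrow> real \<Rightarrow> (real \<Rightarrow> real^'d::finite \<Rightarrow> real^'m::finite^'d) \<Rightarrow> bool" where
  "diffusion_conditions L C q \<kappa> \<sigma> \<longleftrightarrow>
     Ck_on 3 ({0..} \<times> UNIV) (\<lambda>(t, x). \<sigma> t x) \<and>
     (\<forall>t\<ge>0. \<forall>x1 x2. spec_norm (\<sigma> t x1 - \<sigma> t x2) \<le> L * norm (x1 - x2)) \<and>
     (\<forall>\<alpha> x. 2 \<le> length \<alpha> \<and> length \<alpha> \<le> 3 \<longrightarrow>
        (SUP t\<in>{0..}. ereal (spec_norm (pderivs \<alpha> (\<sigma> t) x))) < ereal (C * growth q x)) \<and>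
     (\<forall>t\<ge>0. \<forall>x. pos_semidef (diff_matrix \<sigma> t x - mat \<kappa>)) \<and>
     (\<forall>t1\<ge>0. \<forall>t2\<ge>0. \<forall>x.
        spec_norm (diff_matrix \<sigma> t1 x - diff_matrix \<sigma> t2 x)
        + norm (matrix_div (diff_matrix \<sigma> t1) x - matrix_div (diff_matrix \<sigma> t2) x)
        \<le> L * \<bar>t2 - t1\<bar> * growth q x)"


section \<open>Brownian motion and the interpolated Euler scheme\<close>

definition std_brownian_motion :: "'w measure \<Rightarrow> (real \<Rightarrow> 'w \<Rightarrow> real^'m::finite) \<Rightarrow> bool" where
  "std_brownian_motion M W \<longleftrightarrow>
     prob_space M \<and>
     (\<forall>t\<ge>0. W t \<in> borel_measurable M) \<and>
     (AE \<omega> in M. W 0 \<omega> = 0) \<and>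
     (AE \<omega> in M. continuous_on {0..} (\<lambda>t. W t \<omega>)) \<and>
     (\<forall>\<tau> n. mono \<tau> \<and> 0 \<le> \<tau> 0 \<longrightarrow>
        prob_space.indep_vars M (\<lambda>_. borel) (\<lambda>k \<omega>. W (\<tau> (Suc k)) \<omega> - W (\<tau> k) \<omega>) {..<n::nat}) \<and>
     (\<forall>s t. 0 \<le> s \<and> s < t \<longrightarrow>
        prob_space.indep_vars M (\<lambda>_. borel) (\<lambda>i \<omega>. (W t \<omega> - W s \<omega>) $ i) UNIV \<and>
        (\<forall>i. distributed M lborel (\<lambda>\<omega>. (W t \<omega> - W s \<omega>) $ i) (normal_density 0 (sqrt (t - s)))))"

text \<open>The Ito integral over \<open>[s, t]\<close> of the elementary integrand that is constant in time with
  the value \<open>H\<close>, a random matrix known at time \<open>s\<close>.\<close>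

definition elem_ito_integral ::
  "(real \<Rightarrow> 'w \<Rightarrow> real^'m::finite) \<Rightarrow> ('w \<Rightarrow> real^'m^'d::finite) \<Rightarrow> real \<Rightarrow> real \<Rightarrow> 'w \<Rightarrow> real^'d" where
  "elem_ito_integral W H s t \<omega> = H \<omega> *v (W t \<omega> - W s \<omega>)"

definition euler_scheme ::
  "'w measure \<Rightarrow> (real \<Rightarrow> 'w \<Rightarrow> real^'m::finite) \<Rightarrow> (real \<Rightarrow> real^'d::finite \<Rightarrow> real^'d) \<Rightarrow>
   (real \<Rightarrow> real^'d \<Rightarrow> real^'m^'d) \<Rightarrow> real \<Rightarrow> (real \<Rightarrow> 'w \<Rightarrow> real^'d) \<Rightarrow> bool" where
  "euler_scheme M W b \<sigma> h X \<longleftrightarrow>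
     (\<forall>t\<ge>0. X t \<in> borel_measurable M) \<and>
     prob_space.indep_set M
       (sets (vimage_algebra (space M) (X 0) borel))
       (sets (vimage_algebra (space M) (\<lambda>\<omega>. \<lambda>t\<in>{0..}. W t \<omega>) (PiM {0..} (\<lambda>_. borel)))) \<and>
     (AE \<omega> in M. \<forall>k::nat. \<forall>t\<in>{real k * h .. real (Suc k) * h}.
        X t \<omega> = X (real k * h) \<omega>
          + integral {real k * h .. t} (\<lambda>s. b (real k * h) (X (real k * h) \<omega>))
          + elem_ito_integral W (\<lambda>\<omega>. \<sigma> (real k * h) (X (real k * h) \<omega>)) (real k * h) t \<omega>)"


section \<open>Densities\<close>

text \<open>Densities are determined only almost everywhere.  Since they get differentiated pointwise,
  the continuous version is meant, which is unique.\<close>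

definition is_density_of ::
  "'w measure \<Rightarrow> ('w \<Rightarrow> real^'d::finite) \<Rightarrow> (real^'d \<Rightarrow> real) \<Rightarrow> bool" where
  "is_density_of M Y f \<longleftrightarrow>
     continuous_on UNIV f \<and> (\<forall>x. 0 \<le> f x) \<and> distributed M lborel Y (\<lambda>x. ennreal (f x))"

text \<open>\<open>p x y\<close> is the density at \<open>x\<close> of \<open>Y\<close> conditioned on \<open>Z = y\<close>, where \<open>Z\<close> has density \<open>\<rho>\<close>.\<close>

definition is_cond_density_of ::
  "'w measure \<Rightarrow> ('w \<Rightarrow> real^'d::finite) \<Rightarrow> ('w \<Rightarrow> real^'d) \<Rightarrow> (real^'d \<Rightarrow> real) \<Rightarrow>
   (real^'d \<Rightarrow> real^'d \<Rightarrow> real) \<Rightarrow> bool" where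
  "is_cond_density_of M Y Z \<rho> p \<longleftrightarrow>
     continuous_on UNIV (\<lambda>(x, y). p x y) \<and> (\<forall>x y. 0 \<le> p x y) \<and>
     distributed M (lborel \<Otimes>\<^sub>M lborel) (\<lambda>\<omega>. (Y \<omega>, Z \<omega>)) (\<lambda>(x, y). ennreal (p x y * \<rho> y))"

text \<open>The constant of the estimates.  A constant quantified existentially in a theorem that is
  polymorphic in the index types \<open>'d\<close> and \<open>'m\<close> could depend on the dimensions.  An explicit
  function of \<open>p\<close> rules this out; its value comes from Jensen's inequality and convexity
  (\<open>2 powr (p - 1)\<close> for the first estimate, \<open>3 powr (p - 1) * 2 powr (2 * p - 1)\<close> for the
  second) and is not optimal.\<close>

definition score_const :: "real \<Rightarrow> real" where
  "score_const p = 12 powr p"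

end

theory Submission
  imports Defs
begin

text \<open>Write \<open>F x y = pt x y * \<rho>0 y\<close> for the joint density of \<open>(X\<^sub>t, X\<^sub>0)\<close> and \<open>D\<^sub>k\<close> for the
derivative along the diagonal direction \<open>(e\<^sub>k, e\<^sub>k)\<close>.  In the coordinates \<open>x\<close> and \<open>w = y - x\<close> the
operator \<open>D\<^sub>k\<close> is a derivative in \<open>x\<^sub>k\<close> alone, and \<open>\<rho>t\<close> is the marginal of \<open>F\<close> in \<open>x\<close>.
Therefore \<open>\<partial>\<^sub>k \<rho>t (x)\<close> is the integral of \<open>D\<^sub>k F (x, y)\<close> over \<open>y\<close>, for almost every \<open>x\<close>, as soon
as \<open>D\<^sub>k F\<close> is integrable: no boundary terms can arise because nothing is integrated by parts.  This is
\<open>diagonal_derivative_of_marginal\<close>.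

Now \<open>D\<^sub>k F = F V\<^sub>k\<close> with \<open>V = R + \<nabla> ln \<rho>0\<close>.  Hence \<open>\<nabla> ln \<rho>t (x)\<close> is the conditional
expectation of \<open>V\<close> given \<open>X\<^sub>t = x\<close>, and Jensen's inequality (\<open>averaged_powr\<close>) yields the first
estimate.  A second application of the same fact, to \<open>F V\<^sub>k\<close>, uses
\<open>D\<^sub>i (F V\<^sub>k) = F (V\<^sub>i V\<^sub>k + K\<^sub>i\<^sub>k)\<close> with \<open>K = R\<^sub>2 + \<nabla>\<^sup>2 ln \<rho>0\<close>: the Hessian of \<open>ln \<rho>t\<close> is the
conditional expectation of \<open>V\<^sub>i V\<^sub>k + K\<^sub>i\<^sub>k\<close> minus the product of the conditional expectations
of \<open>V\<^sub>i\<close> and \<open>V\<^sub>k\<close>.  Its spectral norm is at most the conditional expectation of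
\<open>2 |V|\<^sup>2 + |K|\<close>, and Jensen's inequality applies again.  If a right-hand side is infinite there is
nothing to show; if it is finite, the moments in it provide the integrability.

These arguments are carried out in the locale \<open>smooth_mixture\<close>.  They need \<open>pt\<close> to be positive and of
class \<open>C\<^sup>2\<close> in both variables jointly, and \<open>\<rho>t\<close> to be of class \<open>C\<^sup>2\<close>.  Both come from the
scheme.  One step has the Gaussian kernel \<open>exp (- Q) / Z\<close>, where \<open>Q\<close> is a quadratic form built from the
inverse of \<open>\<Lambda>\<close> and \<open>Z\<close> is its integral.  Ellipticity bounds its derivatives in the end point
up to second order uniformly in the starting point, while its derivatives in the starting point have
Gaussian tails in the end point, locally uniformly in the starting point.  Over several steps the density is
\<open>\<integral> g\<^sub>k (x, u) p\<^sub>k (u, y) du\<close>: derivatives in \<open>x\<close> fall on the last kernel, those in \<open>y\<close> on the first, so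
the products are dominated and one may differentiate under the integral sign.  The given \<open>pt\<close> and
\<open>\<rho>t\<close> are continuous versions of the densities so obtained, hence equal to them everywhere.\<close>


section \<open>Functions of class \<open>C\<^sup>k\<close>\<close>

lemma Ck_on_Suc_D: "Ck_on (Suc k) S f \<Longrightarrow> Ck_on k S f"
proof (induction k arbitrary: f)
  case 0
  then show ?case
    by (auto intro: has_derivative_continuous simp: continuous_on_eq_continuous_within)
next
  case (Suc k)
  then show ?case by (metis Ck_on.simps(2))
qed

lemma Ck_on_mono: "Ck_on k S f \<Longrightarrow> j \<le> k \<Longrightarrow> Ck_on j S f"
proof (induction k)
  case (Suc k)
  then show ?case using Ck_on_Suc_D le_SucE by blast
qed simp

lemma Ck_on_continuous: "Ck_on k S f \<Longrightarrow> continuous_on S f"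
  using Ck_on_mono[of k S f 0] by simp

lemma Ck_on_const: "Ck_on k S (\<lambda>x. c)"
proof (induction k arbitrary: c)
  case (Suc k)
  show ?case by (simp, rule exI[of _ "\<lambda>_ _. 0"]) (auto simp: Suc)
qed simp

lemma Ck_on_add: "Ck_on k S f \<Longrightarrow> Ck_on k S g \<Longrightarrow> Ck_on k S (\<lambda>x. f x + g x)"
proof (induction k arbitrary: f g)
  case 0 then show ?case by (auto intro: continuous_on_add)
next
  case (Suc k)
  from Suc.prems obtain f' g' where
    "\<forall>x\<in>S. (f has_derivative f' x) (at x within S)" "\<forall>v. Ck_on k S (\<lambda>x. f' x v)"
    "\<forall>x\<in>S. (g has_derivative g' x) (at x within S)" "\<forall>v. Ck_on k S (\<lambda>x. g' x v)" by auto
  then show ?case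
    by (simp, intro exI[of _ "\<lambda>x v. f' x v + g' x v"]) (auto intro!: has_derivative_add Suc.IH)
qed

lemma Ck_on_bounded_linear:
  assumes L: "bounded_linear L"
  shows "Ck_on k S f \<Longrightarrow> Ck_on k S (\<lambda>x. L (f x))"
proof (induction k arbitrary: f)
  case 0 then show ?case
    using bounded_linear.continuous_on[OF L] by simp
next
  case (Suc k)
  from Suc.prems obtain f' where
    "\<forall>x\<in>S. (f has_derivative f' x) (at x within S)" "\<forall>v. Ck_on k S (\<lambda>x. f' x v)" by auto
  then show ?case
    by (simp, intro exI[of _ "\<lambda>x v. L (f' x v)"])
      (auto intro!: bounded_linear.has_derivative[OF L] Suc.IH)
qed

lemma Ck_on_mult:
  fixes f g :: "'a::euclidean_space \<Rightarrow> real"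
  shows "Ck_on k S f \<Longrightarrow> Ck_on k S g \<Longrightarrow> Ck_on k S (\<lambda>x. f x * g x)"
proof (induction k arbitrary: f g)
  case 0 then show ?case by (auto intro: continuous_on_mult)
next
  case (Suc k)
  note fg = Suc.prems[THEN Ck_on_Suc_D]
  from Suc.prems obtain f' g' where
    "\<forall>x\<in>S. (f has_derivative f' x) (at x within S)" "\<forall>v. Ck_on k S (\<lambda>x. f' x v)"
    "\<forall>x\<in>S. (g has_derivative g' x) (at x within S)" "\<forall>v. Ck_on k S (\<lambda>x. g' x v)" by auto
  then show ?case
    by (simp, intro exI[of _ "\<lambda>x v. f x * g' x v + f' x v * g x"])
      (auto intro!: has_derivative_mult Suc.IH Ck_on_add fg)
qed

lemma Ck_on_minus: "Ck_on k S f \<Longrightarrow> Ck_on k S (\<lambda>x. - f x)"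
  by (rule Ck_on_bounded_linear[OF bounded_linear_minus[OF bounded_linear_ident]])

lemma Ck_on_diff: "Ck_on k S f \<Longrightarrow> Ck_on k S g \<Longrightarrow> Ck_on k S (\<lambda>x. f x - g x)"
  using Ck_on_add[of k S f "\<lambda>x. - g x"] Ck_on_minus[of k S g] by simp

lemma Ck_on_sum: "(\<And>i. i \<in> I \<Longrightarrow> Ck_on k S (f i)) \<Longrightarrow> Ck_on k S (\<lambda>x. \<Sum>i\<in>I. f i x)"
  by (induction I rule: infinite_finite_induct) (auto intro: Ck_on_const Ck_on_add)

lemma Ck_on_prod:
  fixes f :: "'i \<Rightarrow> 'a::euclidean_space \<Rightarrow> real"
  shows "(\<And>i. i \<in> I \<Longrightarrow> Ck_on k S (f i)) \<Longrightarrow> Ck_on k S (\<lambda>x. \<Prod>i\<in>I. f i x)"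
  by (induction I rule: infinite_finite_induct) (auto intro: Ck_on_const Ck_on_mult)

lemma Ck_on_linear_comp:
  assumes L: "bounded_linear L" and LS: "L ` S \<subseteq> T"
  shows "Ck_on k T f \<Longrightarrow> Ck_on k S (\<lambda>x. f (L x))"
proof (induction k arbitrary: f)
  case 0 then show ?case
    using bounded_linear.continuous_on[OF L continuous_on_id] LS
    by (auto intro: continuous_on_compose2)
next
  case (Suc k)
  from Suc.prems obtain f' where f':
    "\<forall>x\<in>T. (f has_derivative f' x) (at x within T)" "\<forall>v. Ck_on k T (\<lambda>x. f' x v)" by auto
  have "((\<lambda>x. f (L x)) has_derivative (\<lambda>v. f' (L x) (L v))) (at x within S)" if "x \<in> S" for x
    using has_derivative_in_compose[OF bounded_linear_imp_has_derivative[OF L]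
        has_derivative_subset[OF f'(1)[rule_format, of "L x"] LS]] that LS by auto
  with f' show ?case
    by (simp, intro exI[of _ "\<lambda>x v. f' (L x) (L v)"]) (auto intro: Suc.IH)
qed

lemma Ck_on_slice:
  assumes t: "(t::real) \<in> T"
  shows "Ck_on k (T \<times> UNIV) f \<Longrightarrow> Ck_on k UNIV (\<lambda>x. f (t, x))"
proof (induction k arbitrary: f)
  case 0 then show ?case using t
    by (auto intro!: continuous_on_compose2[of "T \<times> UNIV" f] continuous_intros)
next
  case (Suc k)
  from Suc.prems obtain f' where f':
    "\<forall>x\<in>T \<times> UNIV. (f has_derivative f' x) (at x within T \<times> UNIV)"
    "\<forall>v. Ck_on k (T \<times> UNIV) (\<lambda>x. f' x v)" by auto
  have "((\<lambda>x. f (t, x)) has_derivative (\<lambda>v. f' (t, x) (0, v))) (at x)" for x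
  proof -
    have "((\<lambda>x. (t, x)) has_derivative (\<lambda>v. (0, v))) (at x within UNIV)"
      by (auto intro!: derivative_eq_intros)
    from has_derivative_in_compose[OF this has_derivative_subset[OF f'(1)[rule_format, of "(t, x)"]]]
    show ?thesis using t by auto
  qed
  with f' show ?case
    by (simp, intro exI[of _ "\<lambda>x v. f' (t, x) (0, v)"]) (auto intro: Suc.IH)
qed

lemma Ck_on_exp:
  fixes f :: "'a::euclidean_space \<Rightarrow> real"
  shows "Ck_on k S f \<Longrightarrow> Ck_on k S (\<lambda>x. exp (f x))"
proof (induction k arbitrary: f)
  case 0 then show ?case by (auto intro: continuous_on_exp)
next
  case (Suc k)
  note f = Suc.prems[THEN Ck_on_Suc_D]
  from Suc.prems obtain f' where
    "\<forall>x\<in>S. (f has_derivative f' x) (at x within S)" "\<forall>v. Ck_on k S (\<lambda>x. f' x v)" by auto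
  then show ?case
    by (simp, intro exI[of _ "\<lambda>x v. f' x v * exp (f x)"])
      (auto intro!: Suc.IH Ck_on_mult f derivative_eq_intros)
qed

lemma Ck_on_inverse:
  fixes f :: "'a::euclidean_space \<Rightarrow> real"
  assumes "\<And>x. x \<in> S \<Longrightarrow> f x \<noteq> 0"
  shows "Ck_on k S f \<Longrightarrow> Ck_on k S (\<lambda>x. inverse (f x))"
  using assms
proof (induction k arbitrary: f)
  case 0 then show ?case by (auto intro: continuous_on_inverse)
next
  case (Suc k)
  note f = Suc.prems(1)[THEN Ck_on_Suc_D]
  from Suc.prems(1) obtain f' where
    "\<forall>x\<in>S. (f has_derivative f' x) (at x within S)" "\<forall>v. Ck_on k S (\<lambda>x. f' x v)" by auto
  with Suc.prems(2) show ?case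
    by (simp, intro exI[of _ "\<lambda>x v. - (inverse (f x) * f' x v * inverse (f x))"])
      (auto intro!: Suc.IH[OF f] Ck_on_mult Ck_on_minus has_derivative_inverse)
qed

lemma Ck_on_ln:
  fixes f :: "'a::euclidean_space \<Rightarrow> real"
  assumes pos: "\<And>x. x \<in> S \<Longrightarrow> f x > 0" and f: "Ck_on k S f"
  shows "Ck_on k S (\<lambda>x. ln (f x))"
proof (cases k)
  case 0 then show ?thesis using pos f by (auto intro!: continuous_on_ln) (metis less_irrefl)
next
  case (Suc j)
  from f obtain f' where
    "\<forall>x\<in>S. (f has_derivative f' x) (at x within S)" "\<forall>v. Ck_on j S (\<lambda>x. f' x v)" by (auto simp: Suc)
  moreover have "Ck_on j S f" using f Ck_on_Suc_D Suc by auto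
  ultimately show ?thesis
    using pos unfolding Suc
    by (simp, intro exI[of _ "\<lambda>x v. inverse (f x) * f' x v"])
      (auto intro!: Ck_on_mult Ck_on_inverse derivative_eq_intros simp: divide_inverse dest: less_imp_neq[THEN not_sym])
qed


section \<open>Parameter-dependent functions with dominated derivatives\<close>

text \<open>The first argument of \<open>f\<close> is a parameter, the second one the variable of integration.  The predicate
\<open>P\<close> selects a class of admissible dominating functions: constants, polynomials, Gaussians, or the
integrable functions.  Keeping it abstract gives one calculus for all of them, in which for
instance a polynomial times a Gaussian is again dominated by a Gaussian.\<close>

definition locally_dominated ::
  "(('z::euclidean_space \<Rightarrow> real) \<Rightarrow> bool) \<Rightarrow> ('a::euclidean_space \<Rightarrow> 'z \<Rightarrow> real) \<Rightarrow> bool" where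
  "locally_dominated P f \<longleftrightarrow>
     (\<forall>w. f w \<in> borel_measurable borel) \<and> (\<forall>z. continuous_on UNIV (\<lambda>w. f w z)) \<and>
     (\<forall>w0. \<exists>e>0. \<exists>H. P H \<and> (\<forall>w\<in>ball w0 e. \<forall>z. \<bar>f w z\<bar> \<le> H z))"

primrec dom_Ck ::
  "(('z::euclidean_space \<Rightarrow> real) \<Rightarrow> bool) \<Rightarrow> nat \<Rightarrow> ('a::euclidean_space \<Rightarrow> 'z \<Rightarrow> real) \<Rightarrow> bool" where
  "dom_Ck P 0 f \<longleftrightarrow> locally_dominated P f"
| "dom_Ck P (Suc k) f \<longleftrightarrow> locally_dominated P f \<and>
     (\<exists>f'. (\<forall>w z. ((\<lambda>w. f w z) has_derivative f' w z) (at w)) \<and> (\<forall>v. dom_Ck P k (\<lambda>w z. f' w z v)))"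

lemma dom_Ck_locally_dominated: "dom_Ck P k f \<Longrightarrow> locally_dominated P f"
  by (cases k) auto

lemma dom_Ck_Suc_D: "dom_Ck P (Suc k) f \<Longrightarrow> dom_Ck P k f"
proof (induction k arbitrary: f)
  case (Suc k)
  then show ?case by (metis dom_Ck.simps(2))
qed simp

lemma dom_Ck_mono:
  assumes "\<And>H. P H \<Longrightarrow> Q H"
  shows "dom_Ck P k f \<Longrightarrow> dom_Ck Q k f"
proof (induction k arbitrary: f)
  case 0 then show ?case using assms by (simp add: locally_dominated_def) blast
next
  case (Suc k)
  have "locally_dominated Q f" using Suc.prems assms by (simp add: locally_dominated_def) blast
  with Suc show ?case by (simp, blast)
qed

lemma dom_Ck_linear_comp:
  assumes L: "bounded_linear L"
  shows "dom_Ck P k f \<Longrightarrow> dom_Ck P k (\<lambda>w. f (L w))"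
proof (induction k arbitrary: f)
  have *: "locally_dominated P (\<lambda>w. f (L w))" if f: "locally_dominated P f" for f
    unfolding locally_dominated_def
  proof (intro conjI allI)
    show "f (L w) \<in> borel_measurable borel" for w using f by (auto simp: locally_dominated_def)
    show "continuous_on UNIV (\<lambda>w. f (L w) z)" for z
      using f bounded_linear.continuous_on[OF L continuous_on_id]
      by (auto simp: locally_dominated_def intro: continuous_on_compose2)
    fix w0
    obtain e H where e: "e > 0" "P H" "\<forall>w\<in>ball (L w0) e. \<forall>z. \<bar>f w z\<bar> \<le> H z"
      using f unfolding locally_dominated_def by metis
    have "isCont L w0" using linear_continuous_at[OF L] .
    with e(1) obtain d where "d > 0" "\<forall>w. dist w w0 < d \<longrightarrow> dist (L w) (L w0) < e"
      by (auto simp: continuous_at_eps_delta)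
    with e show "\<exists>e>0. \<exists>H. P H \<and> (\<forall>w\<in>ball w0 e. \<forall>z. \<bar>f (L w) z\<bar> \<le> H z)"
      by (intro exI[of _ d]) (auto intro!: exI[of _ H] simp: dist_commute)
  qed
  {
    case 0 with * show ?case by simp
  next
  case (Suc k)
  from Suc.prems obtain f' where f':
    "\<forall>w z. ((\<lambda>w. f w z) has_derivative f' w z) (at w)" "\<forall>v. dom_Ck P k (\<lambda>w z. f' w z v)" by auto
  have "((\<lambda>w. f (L w) z) has_derivative (\<lambda>v. f' (L w) z (L v))) (at w)" for w z
    using has_derivative_compose[OF bounded_linear_imp_has_derivative[OF L], of "\<lambda>w. f w z"] f' by auto
  with f' Suc * show ?case
    by (auto intro!: exI[of _ "\<lambda>w z v. f' (L w) z (L v)"])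
  }
qed

lemma locally_dominated_add:
  assumes P: "\<And>H1 H2. P H1 \<Longrightarrow> P H2 \<Longrightarrow> \<exists>H. P H \<and> (\<forall>z. \<bar>H1 z\<bar> + \<bar>H2 z\<bar> \<le> H z)"
    and f: "locally_dominated P f" and g: "locally_dominated P g"
  shows "locally_dominated P (\<lambda>w z. f w z + g w z)"
  unfolding locally_dominated_def
proof (intro conjI allI)
  have [measurable]: "f w \<in> borel_measurable borel" "g w \<in> borel_measurable borel" for w
    using f g by (auto simp: locally_dominated_def)
  show "(\<lambda>z. f w z + g w z) \<in> borel_measurable borel" for w
    by measurable
  show "continuous_on UNIV (\<lambda>w. f w z + g w z)" for z
    using f g by (auto simp: locally_dominated_def intro: continuous_on_add)
  fix w0
  obtain e1 H1 where 1: "e1 > 0" "P H1" "\<forall>w\<in>ball w0 e1. \<forall>z. \<bar>f w z\<bar> \<le> H1 z"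
    using f by (auto simp: locally_dominated_def) meson
  obtain e2 H2 where 2: "e2 > 0" "P H2" "\<forall>w\<in>ball w0 e2. \<forall>z. \<bar>g w z\<bar> \<le> H2 z"
    using g by (auto simp: locally_dominated_def) meson
  obtain H where H: "P H" "\<And>z. \<bar>H1 z\<bar> + \<bar>H2 z\<bar> \<le> H z" using P 1(2) 2(2) by blast
  have "\<bar>f w z + g w z\<bar> \<le> H z" if "w \<in> ball w0 (min e1 e2)" for w z
  proof -
    have "\<bar>f w z\<bar> \<le> H1 z" "\<bar>g w z\<bar> \<le> H2 z" using that 1 2 by auto
    with H(2)[of z] show ?thesis by linarith
  qed
  then show "\<exists>e>0. \<exists>H. P H \<and> (\<forall>w\<in>ball w0 e. \<forall>z. \<bar>f w z + g w z\<bar> \<le> H z)"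
    using 1 2 H(1) by (intro exI[of _ "min e1 e2"]) auto
qed

lemma dom_Ck_add:
  assumes P: "\<And>H1 H2. P H1 \<Longrightarrow> P H2 \<Longrightarrow> \<exists>H. P H \<and> (\<forall>z. \<bar>H1 z\<bar> + \<bar>H2 z\<bar> \<le> H z)"
  shows "dom_Ck P k f \<Longrightarrow> dom_Ck P k g \<Longrightarrow> dom_Ck P k (\<lambda>w z. f w z + g w z)"
proof (induction k arbitrary: f g)
  case 0 show ?case unfolding dom_Ck.simps
    by (rule locally_dominated_add, erule P, assumption) (use 0 in auto)
next
  case (Suc k)
  from Suc.prems obtain f' g' where d:
    "\<And>w z. ((\<lambda>w. f w z) has_derivative f' w z) (at w)" "\<And>v. dom_Ck P k (\<lambda>w z. f' w z v)"
    "\<And>w z. ((\<lambda>w. g w z) has_derivative g' w z) (at w)" "\<And>v. dom_Ck P k (\<lambda>w z. g' w z v)" by auto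
  have "locally_dominated P (\<lambda>w z. f w z + g w z)"
    by (rule locally_dominated_add, erule P, assumption) (use Suc.prems in auto)
  moreover have "dom_Ck P k (\<lambda>w z. f' w z v + g' w z v)" for v
    using Suc.IH d by blast
  ultimately show ?case
    using has_derivative_add[OF d(1,3)]
    by (simp, intro exI[of _ "\<lambda>w z v. f' w z v + g' w z v"]) simp
qed

lemma locally_dominated_mult:
  assumes P: "\<And>H1 H2. P1 H1 \<Longrightarrow> P2 H2 \<Longrightarrow> \<exists>H. P H \<and> (\<forall>z. \<bar>H1 z\<bar> * \<bar>H2 z\<bar> \<le> H z)"
    and f: "locally_dominated P1 f" and g: "locally_dominated P2 g"
  shows "locally_dominated P (\<lambda>w z. f w z * g w z)"
  unfolding locally_dominated_def
proof (intro conjI allI)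
  have [measurable]: "f w \<in> borel_measurable borel" "g w \<in> borel_measurable borel" for w
    using f g by (auto simp: locally_dominated_def)
  show "(\<lambda>z. f w z * g w z) \<in> borel_measurable borel" for w
    by measurable
  show "continuous_on UNIV (\<lambda>w. f w z * g w z)" for z
    using f g by (auto simp: locally_dominated_def intro: continuous_on_mult)
  fix w0
  obtain e1 H1 where 1: "e1 > 0" "P1 H1" "\<forall>w\<in>ball w0 e1. \<forall>z. \<bar>f w z\<bar> \<le> H1 z"
    using f by (auto simp: locally_dominated_def) meson
  obtain e2 H2 where 2: "e2 > 0" "P2 H2" "\<forall>w\<in>ball w0 e2. \<forall>z. \<bar>g w z\<bar> \<le> H2 z"
    using g by (auto simp: locally_dominated_def) meson
  obtain H where H: "P H" "\<And>z. \<bar>H1 z\<bar> * \<bar>H2 z\<bar> \<le> H z" using P 1(2) 2(2) by blast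
  have "\<bar>f w z * g w z\<bar> \<le> H z" if "w \<in> ball w0 (min e1 e2)" for w z
  proof -
    have "\<bar>f w z\<bar> \<le> H1 z" "\<bar>g w z\<bar> \<le> H2 z" using that 1 2 by auto
    then have "\<bar>f w z * g w z\<bar> \<le> \<bar>H1 z\<bar> * \<bar>H2 z\<bar>" by (auto simp: abs_mult intro!: mult_mono)
    with H(2)[of z] show ?thesis by linarith
  qed
  then show "\<exists>e>0. \<exists>H. P H \<and> (\<forall>w\<in>ball w0 e. \<forall>z. \<bar>f w z * g w z\<bar> \<le> H z)"
    using 1 2 H(1) by (intro exI[of _ "min e1 e2"]) auto
qed

lemma dom_Ck_mult:
  assumes P: "\<And>H1 H2. P1 H1 \<Longrightarrow> P2 H2 \<Longrightarrow> \<exists>H. P H \<and> (\<forall>z. \<bar>H1 z\<bar> * \<bar>H2 z\<bar> \<le> H z)"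
    and add: "\<And>H1 H2. P H1 \<Longrightarrow> P H2 \<Longrightarrow> \<exists>H. P H \<and> (\<forall>z. \<bar>H1 z\<bar> + \<bar>H2 z\<bar> \<le> H z)"
  shows "dom_Ck P1 k f \<Longrightarrow> dom_Ck P2 k g \<Longrightarrow> dom_Ck P k (\<lambda>w z. f w z * g w z)"
proof (induction k arbitrary: f g)
  case 0 show ?case unfolding dom_Ck.simps
    by (rule locally_dominated_mult[where ?P1.0=P1 and ?P2.0=P2], erule P, assumption) (use 0 in auto)
next
  case (Suc k)
  note fg = Suc.prems[THEN dom_Ck_Suc_D]
  from Suc.prems obtain f' g' where d:
    "\<And>w z. ((\<lambda>w. f w z) has_derivative f' w z) (at w)" "\<And>v. dom_Ck P1 k (\<lambda>w z. f' w z v)"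
    "\<And>w z. ((\<lambda>w. g w z) has_derivative g' w z) (at w)" "\<And>v. dom_Ck P2 k (\<lambda>w z. g' w z v)" by auto
  have "locally_dominated P (\<lambda>w z. f w z * g w z)"
    by (rule locally_dominated_mult[where ?P1.0=P1 and ?P2.0=P2], erule P, assumption) (use Suc.prems in auto)
  moreover have "dom_Ck P k (\<lambda>w z. f w z * g' w z v + f' w z v * g w z)" for v
    by (rule dom_Ck_add, erule add, assumption) (rule Suc.IH[OF fg(1) d(4)], rule Suc.IH[OF d(2) fg(2)])
  ultimately show ?case
    using has_derivative_mult[OF d(1,3)]
    by (simp, intro exI[of _ "\<lambda>w z v. f w z * g' w z v + f' w z v * g w z"]) simp
qed

text \<open>Every derivative is \<open>exp f\<close> times a polynomial in the derivatives of \<open>f\<close>; as multiplication by functions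
dominated in \<open>P1\<close> preserves domination in \<open>P2\<close>, it suffices to dominate \<open>exp f\<close> itself in \<open>P2\<close>.\<close>

lemma dom_Ck_exp:
  assumes P: "\<And>H1 H2. P1 H1 \<Longrightarrow> P2 H2 \<Longrightarrow> \<exists>H. P2 H \<and> (\<forall>z. \<bar>H1 z\<bar> * \<bar>H2 z\<bar> \<le> H z)"
    and add: "\<And>H1 H2. P2 H1 \<Longrightarrow> P2 H2 \<Longrightarrow> \<exists>H. P2 H \<and> (\<forall>z. \<bar>H1 z\<bar> + \<bar>H2 z\<bar> \<le> H z)"
    and e: "locally_dominated P2 (\<lambda>w z. exp (f w z))"
  shows "dom_Ck P1 k f \<Longrightarrow> dom_Ck P2 k (\<lambda>w z. exp (f w z))"
proof (induction k)
  case 0 then show ?case using e by simp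
next
  case (Suc k)
  note f = Suc.prems[THEN dom_Ck_Suc_D]
  from Suc.prems obtain f' where
    f': "\<And>w z. ((\<lambda>w. f w z) has_derivative f' w z) (at w)" "\<And>v. dom_Ck P1 k (\<lambda>w z. f' w z v)" by auto
  have "((\<lambda>w. exp (f w z)) has_derivative (\<lambda>v. f' w z v * exp (f w z))) (at w)" for w z
    using f'(1)[of z w] by (auto intro!: derivative_eq_intros)
  moreover have "dom_Ck P2 k (\<lambda>w z. f' w z v * exp (f w z))" for v
    by (rule dom_Ck_mult[where ?P1.0=P1 and ?P2.0=P2], erule P, assumption, erule add, assumption)
      (rule f'(2), rule Suc.IH[OF f])
  ultimately show ?case using e
    by (simp, intro exI[of _ "\<lambda>w z v. f' w z v * exp (f w z)"]) simp
qed

lemma locally_dominated_const: "P (\<lambda>z. \<bar>m z\<bar>) \<Longrightarrow> m \<in> borel_measurable borel \<Longrightarrow> locally_dominated P (\<lambda>w z. m z)"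
  by (auto simp: locally_dominated_def intro!: exI[of _ 1] exI[of _ "\<lambda>z. \<bar>m z\<bar>"])

lemma dom_Ck_const:
  assumes "P (\<lambda>_. 0)" "P (\<lambda>z. \<bar>m z\<bar>)" "m \<in> borel_measurable borel"
  shows "dom_Ck P k (\<lambda>w z. m z)"
  using assms(2,3)
proof (induction k arbitrary: m)
  case 0 then show ?case by (simp add: locally_dominated_const)
next
  case (Suc k)
  with assms(1) show ?case
    by (auto intro!: exI[of _ "\<lambda>_ _ _. 0"] locally_dominated_const)
qed

definition dom_const :: "('z \<Rightarrow> real) \<Rightarrow> bool" where
  "dom_const H \<longleftrightarrow> (\<exists>K. H = (\<lambda>_. K))"

text \<open>A continuous function is bounded on compact balls.\<close>

lemma dom_Ck_of_Ck:
  fixes f :: "'a::euclidean_space \<Rightarrow> real"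
  shows "Ck_on k UNIV f \<Longrightarrow> dom_Ck dom_const k (\<lambda>w (z::'z::euclidean_space). f w)"
proof (induction k arbitrary: f)
  have *: "locally_dominated dom_const (\<lambda>w (z::'z). f w)" if f: "continuous_on UNIV f" for f :: "'a \<Rightarrow> real"
    unfolding locally_dominated_def
  proof (intro conjI allI)
    fix w0
    have "compact (f ` cball w0 1)" using f
      by (intro compact_continuous_image) (auto intro: continuous_on_subset)
    then obtain K where K: "\<And>w. w \<in> cball w0 1 \<Longrightarrow> \<bar>f w\<bar> \<le> K"
      by (metis (no_types, lifting) bounded_iff compact_imp_bounded imageI real_norm_def)
    show "\<exists>e>0. \<exists>H. dom_const H \<and> (\<forall>w\<in>ball w0 e. \<forall>z::'z. \<bar>f w\<bar> \<le> H z)"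
      using K by (intro exI[of _ 1]) (auto simp: dom_const_def intro!: exI[of _ "\<lambda>_. K"])
  qed (use f in auto)
  {
    case 0 with * show ?case by simp
  next
  case (Suc k)
  from Suc.prems obtain f' where
    f': "\<forall>w. (f has_derivative f' w) (at w)" "\<forall>v. Ck_on k UNIV (\<lambda>w. f' w v)" by auto
  moreover have "continuous_on UNIV f" using Suc.prems Ck_on_continuous by blast
  ultimately show ?case using *[of f] Suc.IH by (simp, intro exI[of _ "\<lambda>w z. f' w"]) simp
  }
qed

text \<open>The two factors depend on different parameters.  This is how the density after several steps
becomes smooth in both of its arguments jointly: the end point enters through the last kernel,
the starting point through the preceding ones.\<close>

lemma dom_Ck_integrable_cmult:
  assumes a: "dom_Ck dom_const k a" and f: "dom_Ck (integrable \<mu>) k f"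
  shows "dom_Ck (integrable \<mu>) k (\<lambda>(x, y) z. a x z * f y z)"
proof -
  have "dom_Ck (integrable \<mu>) k (\<lambda>w z. a (fst w) z * f (snd w) z)"
  proof (rule dom_Ck_mult[where ?P1.0=dom_const and ?P2.0="integrable \<mu>"])
    show "dom_Ck dom_const k (\<lambda>w. a (fst w))"
      using dom_Ck_linear_comp[OF bounded_linear_fst a] .
    show "dom_Ck (integrable \<mu>) k (\<lambda>w. f (snd w))"
      using dom_Ck_linear_comp[OF bounded_linear_snd f] .
  next
    fix H1 H2 :: "'a \<Rightarrow> real"
    assume "dom_const H1" "integrable \<mu> H2"
    then show "\<exists>H. integrable \<mu> H \<and> (\<forall>z. \<bar>H1 z\<bar> * \<bar>H2 z\<bar> \<le> H z)"
      by (auto simp: dom_const_def intro!: exI[of _ "\<lambda>z. \<bar>H1 z\<bar> * \<bar>H2 z\<bar>"])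
  next
    fix H1 H2 :: "'a \<Rightarrow> real"
    assume "integrable \<mu> H1" "integrable \<mu> H2"
    then show "\<exists>H. integrable \<mu> H \<and> (\<forall>z. \<bar>H1 z\<bar> + \<bar>H2 z\<bar> \<le> H z)"
      by (auto intro!: exI[of _ "\<lambda>z. \<bar>H1 z\<bar> + \<bar>H2 z\<bar>"])
  qed
  then show ?thesis by (simp add: case_prod_unfold)
qed

section \<open>Differentiation under the integral sign\<close>

lemma continuous_integral_locally_dominated:
  fixes f :: "'a::euclidean_space \<Rightarrow> 'z::euclidean_space \<Rightarrow> real"
  assumes sets: "sets \<mu> = sets borel" and f: "locally_dominated (integrable \<mu>) f"
  shows "integrable \<mu> (f w)" and "continuous_on UNIV (\<lambda>w. \<integral>z. f w z \<partial>\<mu>)"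
proof -
  have meas: "f w \<in> borel_measurable \<mu>" for w
    using f sets measurable_cong_sets[OF sets refl] by (auto simp: locally_dominated_def)
  show int: "integrable \<mu> (f w)" for w
  proof -
    obtain e H where e: "e > 0" "integrable \<mu> H" "\<forall>w'\<in>ball w e. \<forall>z. \<bar>f w' z\<bar> \<le> H z"
      using f unfolding locally_dominated_def by metis
    then have "\<bar>f w z\<bar> \<le> \<bar>H z\<bar>" for z by (metis abs_ge_self centre_in_ball order_trans)
    with e(2) show ?thesis
      by (intro Bochner_Integration.integrable_bound[OF _ meas, of H]) auto
  qed
  have "((\<lambda>w. \<integral>z. f w z \<partial>\<mu>) \<longlongrightarrow> (\<integral>z. f w0 z \<partial>\<mu>)) (at w0)" for w0
  proof -
    obtain e H where e: "e > 0" "integrable \<mu> H" "\<And>w z. w\<in>ball w0 e \<Longrightarrow> \<bar>f w z\<bar> \<le> H z"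
      using f unfolding locally_dominated_def by metis
    show ?thesis
      unfolding tendsto_at_iff_sequentially
    proof (intro allI impI)
      fix X :: "nat \<Rightarrow> 'a" assume X: "\<forall>i. X i \<in> UNIV - {w0}" "X \<longlonglongrightarrow> w0"
      obtain N where N: "\<And>n. n \<ge> N \<Longrightarrow> X n \<in> ball w0 e"
        using X(2) e(1) unfolding lim_sequentially by (metis dist_commute mem_ball)
      have "(\<lambda>n. \<integral>z. f (X (n + N)) z \<partial>\<mu>) \<longlonglongrightarrow> (\<integral>z. f w0 z \<partial>\<mu>)"
      proof (rule integral_dominated_convergence[where w=H])
        show "AE z in \<mu>. (\<lambda>n. f (X (n + N)) z) \<longlonglongrightarrow> f w0 z"
        proof (rule AE_I2)
          fix z
          have "isCont (\<lambda>w. f w z) w0" using f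
            by (auto simp: locally_dominated_def continuous_on_eq_continuous_at)
          from isCont_tendsto_compose[OF this LIMSEQ_ignore_initial_segment[OF X(2)]]
          show "(\<lambda>n. f (X (n + N)) z) \<longlonglongrightarrow> f w0 z" .
        qed
      qed (use e N meas in auto)
      then show "((\<lambda>w. \<integral>z. f w z \<partial>\<mu>) \<circ> X) \<longlonglongrightarrow> (\<integral>z. f w0 z \<partial>\<mu>)"
        unfolding comp_def using LIMSEQ_offset[where f="\<lambda>n. \<integral>z. f (X n) z \<partial>\<mu>"] by blast
    qed
  qed
  then show "continuous_on UNIV (\<lambda>w. \<integral>z. f w z \<partial>\<mu>)"
    by (simp add: continuous_on_def)
qed

text \<open>The difference quotients of \<open>f\<close> are dominated through the mean value inequality.  Domination is known
for each direction separately; the sum over a basis turns it into a bound on the operator norm of the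
derivative.\<close>

lemma has_derivative_integral_locally_dominated:
  fixes f :: "'a::euclidean_space \<Rightarrow> 'z::euclidean_space \<Rightarrow> real"
  assumes sets: "sets \<mu> = sets borel" and f: "locally_dominated (integrable \<mu>) f"
    and f': "\<And>w z. ((\<lambda>w. f w z) has_derivative f' w z) (at w)"
    and df': "\<And>v. locally_dominated (integrable \<mu>) (\<lambda>w z. f' w z v)"
  shows "((\<lambda>w. \<integral>z. f w z \<partial>\<mu>) has_derivative (\<lambda>v. \<integral>z. f' w z v \<partial>\<mu>)) (at w)"
proof -
  note int = continuous_integral_locally_dominated(1)[OF sets]
  have lin: "linear (f' w z)" for w z using f' has_derivative_linear by blast
  have "\<forall>v. \<exists>e H. e > 0 \<and> integrable \<mu> H \<and> (\<forall>w'\<in>ball w e. \<forall>z. \<bar>f' w' z v\<bar> \<le> H z)"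
    using df' unfolding locally_dominated_def by blast
  then obtain e H where "\<forall>v. e v > 0 \<and> integrable \<mu> (H v) \<and> (\<forall>w'\<in>ball w (e v). \<forall>z. \<bar>f' w' z v\<bar> \<le> H v z)"
    unfolding choice_iff by blast
  then have e: "\<And>v. e v > 0" "\<And>v. integrable \<mu> (H v)" "\<And>v w' z. w' \<in> ball w (e v) \<Longrightarrow> \<bar>f' w' z v\<bar> \<le> H v z"
    by blast+
  define d where "d = Min (e ` Basis)"
  have d: "d > 0" "\<And>b. b \<in> Basis \<Longrightarrow> d \<le> e b" using e(1) by (auto simp: d_def)
  define G where "G z = (\<Sum>b\<in>Basis. H b z)" for z
  have G: "integrable \<mu> G" unfolding G_def using e(2) by auto
  have opG: "norm (f' w' z v) \<le> G z * norm v" if "w' \<in> ball w d" for w' z v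
  proof -
    have "f' w' z v = (\<Sum>b\<in>Basis. (v \<bullet> b) *\<^sub>R f' w' z b)"
      by (subst (1) euclidean_representation[of v, symmetric])
        (simp only: linear_sum[OF lin] linear_cmul[OF lin])
    also have "norm \<dots> \<le> (\<Sum>b\<in>Basis. norm v * H b z)"
    proof (rule sum_norm_le)
      fix b :: 'a assume b: "b \<in> Basis"
      then have "w' \<in> ball w (e b)" using that d(2)[OF b] by auto
      then have "\<bar>f' w' z b\<bar> \<le> H b z" by (rule e(3))
      then show "norm ((v \<bullet> b) *\<^sub>R f' w' z b) \<le> norm v * H b z"
        using Basis_le_norm[OF b, of v] by (auto simp: abs_mult intro!: mult_mono)
    qed
    finally show ?thesis by (simp add: G_def sum_distrib_left mult.commute sum_distrib_right)
  qed
  have quot: "norm (f w' z - f w z - f' w z (w' - w)) \<le> 2 * G z * norm (w' - w)" if w': "w' \<in> ball w d" for w' z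
  proof -
    have "norm (f w' z - f w z) \<le> G z * norm (w' - w)"
    proof (rule differentiable_bound[where S="ball w d" and f'="\<lambda>w. f' w z"])
      fix x assume "x \<in> ball w d"
      then have op: "norm (f' x z v) \<le> G z * norm v" for v by (rule opG)
      obtain b :: 'a where "b \<in> Basis" using nonempty_Basis by blast
      then have "0 \<le> G z" using order_trans[OF norm_ge_zero op[of b]] by simp
      with op show "onorm (f' x z) \<le> G z" by (intro onorm_bound)
      show "((\<lambda>w. f w z) has_derivative f' x z) (at x within ball w d)"
        by (rule has_derivative_at_withinI, rule f')
    qed (use w' d in auto)
    moreover have "norm (f' w z (w' - w)) \<le> G z * norm (w' - w)" using opG[of w] d by auto
    ultimately show ?thesis using norm_triangle_ineq4[of "f w' z - f w z" "f' w z (w' - w)"] by linarith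
  qed
  have "((\<lambda>w'. norm ((\<integral>z. f w' z \<partial>\<mu>) - (\<integral>z. f w z \<partial>\<mu>) - (\<integral>z. f' w z (w' - w) \<partial>\<mu>)) / norm (w' - w)) \<longlongrightarrow> 0) (at w)"
    unfolding tendsto_at_iff_sequentially
  proof (intro allI impI)
    fix X :: "nat \<Rightarrow> 'a" assume X: "\<forall>i. X i \<in> UNIV - {w}" "X \<longlonglongrightarrow> w"
    let ?r = "\<lambda>w' z. (f w' z - f w z - f' w z (w' - w)) / norm (w' - w)"
    obtain N where N: "\<And>n. n \<ge> N \<Longrightarrow> X n \<in> ball w d"
      using X(2) d(1) unfolding lim_sequentially by (metis dist_commute mem_ball)
    have rint: "integrable \<mu> (?r w')" for w'
      using int[OF f] int[OF df'] by auto
    have "(\<lambda>n. \<integral>z. ?r (X (n + N)) z \<partial>\<mu>) \<longlonglongrightarrow> (\<integral>z. 0 \<partial>\<mu>)"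
    proof (rule integral_dominated_convergence[where w="\<lambda>z. 2 * G z"])
      show "AE z in \<mu>. (\<lambda>n. ?r (X (n + N)) z) \<longlonglongrightarrow> 0"
      proof (rule AE_I2)
        fix z
        have "((\<lambda>w'. norm (f w' z - f w z - f' w z (w' - w)) / norm (w' - w)) \<longlongrightarrow> 0) (at w)"
          using f'[of z w] by (simp add: has_derivative_iff_norm)
        then have "((\<lambda>w'. ?r w' z) \<longlongrightarrow> 0) (at w)"
          by (subst tendsto_norm_zero_iff[symmetric]) (simp add: abs_divide)
        then have "((\<lambda>w'. ?r w' z) \<circ> X) \<longlonglongrightarrow> 0" using X unfolding tendsto_at_iff_sequentially by blast
        from LIMSEQ_ignore_initial_segment[OF this, of N] show "(\<lambda>n. ?r (X (n + N)) z) \<longlonglongrightarrow> 0"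
          by (simp add: comp_def)
      qed
      fix n
      show "AE z in \<mu>. norm (?r (X (n + N)) z) \<le> 2 * G z"
        using quot[OF N[of "n + N"]] X(1) by (intro AE_I2) (simp add: divide_le_eq)
      show "?r (X (n + N)) \<in> borel_measurable \<mu>" using rint by blast
    qed (use G in auto)
    then have "(\<lambda>n. norm (\<integral>z. ?r (X (n + N)) z \<partial>\<mu>)) \<longlonglongrightarrow> 0"
      by (intro tendsto_norm_zero) (simp only: Bochner_Integration.integral_zero)
    moreover have "(\<integral>z. ?r w' z \<partial>\<mu>) = ((\<integral>z. f w' z \<partial>\<mu>) - (\<integral>z. f w z \<partial>\<mu>) - (\<integral>z. f' w z (w' - w) \<partial>\<mu>)) / norm (w' - w)" for w'
      using int[OF f] int[OF df'] by simp
    ultimately have "(\<lambda>n. norm ((\<integral>z. f (X (n + N)) z \<partial>\<mu>) - (\<integral>z. f w z \<partial>\<mu>) - (\<integral>z. f' w z (X (n + N) - w) \<partial>\<mu>)) / norm (X (n + N) - w)) \<longlonglongrightarrow> 0"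
      by (simp only: abs_divide real_norm_def abs_norm_cancel)
    then show "((\<lambda>w'. norm ((\<integral>z. f w' z \<partial>\<mu>) - (\<integral>z. f w z \<partial>\<mu>) - (\<integral>z. f' w z (w' - w) \<partial>\<mu>)) / norm (w' - w)) \<circ> X) \<longlonglongrightarrow> 0"
      unfolding comp_def
      using LIMSEQ_offset[where f="\<lambda>n. norm ((\<integral>z. f (X n) z \<partial>\<mu>) - (\<integral>z. f w z \<partial>\<mu>) - (\<integral>z. f' w z (X n - w) \<partial>\<mu>)) / norm (X n - w)"]
      by blast
  qed
  moreover have "bounded_linear (\<lambda>v. \<integral>z. f' w z v \<partial>\<mu>)"
  proof (rule linear_conv_bounded_linear[THEN iffD1], rule linearI)
    show "(\<integral>z. f' w z (u + v) \<partial>\<mu>) = (\<integral>z. f' w z u \<partial>\<mu>) + (\<integral>z. f' w z v \<partial>\<mu>)" for u v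
      using int[OF df'] by (simp add: linear_add[OF lin])
    show "(\<integral>z. f' w z (c *\<^sub>R v) \<partial>\<mu>) = c *\<^sub>R (\<integral>z. f' w z v \<partial>\<mu>)" for c v
      by (simp add: linear_cmul[OF lin])
  qed
  ultimately show ?thesis by (simp add: has_derivative_iff_norm)
qed

lemma Ck_on_integral:
  assumes sets: "sets \<mu> = sets borel"
  shows "dom_Ck (integrable \<mu>) k f \<Longrightarrow> Ck_on k UNIV (\<lambda>w. \<integral>z. f w z \<partial>\<mu>)"
proof (induction k arbitrary: f)
  case 0 then show ?case using continuous_integral_locally_dominated(2)[OF sets] by simp
next
  case (Suc k)
  from Suc.prems obtain f' where
    f': "\<And>w z. ((\<lambda>w. f w z) has_derivative f' w z) (at w)" "\<And>v. dom_Ck (integrable \<mu>) k (\<lambda>w z. f' w z v)"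
    and f: "locally_dominated (integrable \<mu>) f" by auto
  have "((\<lambda>w. \<integral>z. f w z \<partial>\<mu>) has_derivative (\<lambda>v. \<integral>z. f' w z v \<partial>\<mu>)) (at w)" for w
    using f' f by (intro has_derivative_integral_locally_dominated[OF sets f]) (auto dest: dom_Ck_locally_dominated)
  with Suc.IH[OF f'(2)] show ?case
    by (simp, intro exI[of _ "\<lambda>w v. \<integral>z. f' w z v \<partial>\<mu>"]) simp
qed

section \<open>Polynomial and Gaussian domination\<close>

definition dom_poly :: "('z::euclidean_space \<Rightarrow> real) \<Rightarrow> bool" where
  "dom_poly H \<longleftrightarrow> (\<exists>K n. H = (\<lambda>z. K * (1 + (norm z)\<^sup>2) ^ n))"

definition dom_gauss :: "('z::euclidean_space \<Rightarrow> real) \<Rightarrow> bool" where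
  "dom_gauss H \<longleftrightarrow> (\<exists>K c. c > 0 \<and> H = (\<lambda>z. K * exp (- c * (norm z)\<^sup>2)))"

lemma dom_poly_add:
  assumes "dom_poly H1" "dom_poly H2"
  shows "\<exists>H. dom_poly H \<and> (\<forall>z. \<bar>H1 z\<bar> + \<bar>H2 z\<bar> \<le> H z)"
proof -
  obtain K1 n1 K2 n2 where
    1: "H1 = (\<lambda>z. K1 * (1 + (norm z)\<^sup>2) ^ n1)" and 2: "H2 = (\<lambda>z. K2 * (1 + (norm z)\<^sup>2) ^ n2)"
    using assms by (auto simp: dom_poly_def)
  have "\<bar>H1 z\<bar> + \<bar>H2 z\<bar> \<le> (\<bar>K1\<bar> + \<bar>K2\<bar>) * (1 + (norm z)\<^sup>2) ^ (n1 + n2)" for z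
    unfolding 1 2 abs_mult distrib_right
    by (intro add_mono mult_left_mono) (auto simp: abs_of_nonneg intro!: power_increasing)
  then show ?thesis by (intro exI[of _ "\<lambda>z. (\<bar>K1\<bar> + \<bar>K2\<bar>) * (1 + (norm z)\<^sup>2) ^ (n1 + n2)"]) (auto simp: dom_poly_def)
qed

lemma dom_poly_mult:
  assumes "dom_poly H1" "dom_poly H2"
  shows "\<exists>H. dom_poly H \<and> (\<forall>z. \<bar>H1 z\<bar> * \<bar>H2 z\<bar> \<le> H z)"
proof -
  obtain K1 n1 K2 n2 where
    1: "H1 = (\<lambda>z. K1 * (1 + (norm z)\<^sup>2) ^ n1)" and 2: "H2 = (\<lambda>z. K2 * (1 + (norm z)\<^sup>2) ^ n2)"
    using assms by (auto simp: dom_poly_def)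
  have "\<bar>H1 z\<bar> * \<bar>H2 z\<bar> = \<bar>K1 * K2\<bar> * (1 + (norm z)\<^sup>2) ^ (n1 + n2)" for z
    unfolding 1 2 by (simp add: abs_mult power_add)
  then show ?thesis by (intro exI[of _ "\<lambda>z. \<bar>K1 * K2\<bar> * (1 + (norm z)\<^sup>2) ^ (n1 + n2)"]) (auto simp: dom_poly_def)
qed

lemma dom_gauss_add:
  assumes "dom_gauss H1" "dom_gauss H2"
  shows "\<exists>H. dom_gauss H \<and> (\<forall>z. \<bar>H1 z\<bar> + \<bar>H2 z\<bar> \<le> H z)"
proof -
  obtain K1 c1 K2 c2 where c: "c1 > 0" "c2 > 0" and
    1: "H1 = (\<lambda>z. K1 * exp (- c1 * (norm z)\<^sup>2))" and 2: "H2 = (\<lambda>z. K2 * exp (- c2 * (norm z)\<^sup>2))"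
    using assms by (auto simp: dom_gauss_def)
  have "\<bar>H1 z\<bar> + \<bar>H2 z\<bar> \<le> (\<bar>K1\<bar> + \<bar>K2\<bar>) * exp (- min c1 c2 * (norm z)\<^sup>2)" for z
    unfolding 1 2 abs_mult distrib_right
    by (intro add_mono mult_left_mono) (auto intro!: mult_right_mono)
  moreover have "min c1 c2 > 0" using c by simp
  ultimately show ?thesis unfolding dom_gauss_def by blast
qed

text \<open>Half of the Gaussian exponent absorbs the polynomial.\<close>

lemma dom_poly_gauss_mult:
  assumes "dom_poly H1" "dom_gauss H2"
  shows "\<exists>H. dom_gauss H \<and> (\<forall>z. \<bar>H1 z\<bar> * \<bar>H2 z\<bar> \<le> H z)"
proof -
  obtain K1 n K2 c where c: "c > 0" and
    1: "H1 = (\<lambda>z. K1 * (1 + (norm z)\<^sup>2) ^ n)" and 2: "H2 = (\<lambda>z. K2 * exp (- c * (norm z)\<^sup>2))"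
    using assms by (auto simp: dom_gauss_def dom_poly_def)
  \<comment> \<open>the successor avoids a division by zero; \<open>n a \<le> c / 2\<close> is all that matters\<close>
  define a where "a = c / (2 * (real n + 1))"
  have a: "a > 0" "real n * a \<le> c / 2" using c by (auto simp: a_def field_simps)
  have "\<bar>H1 z\<bar> * \<bar>H2 z\<bar> \<le> (\<bar>K1 * K2\<bar> * (1 + 1 / a) ^ n) * exp (- (c / 2) * (norm z)\<^sup>2)" for z
  proof -
    have "1 + (norm z)\<^sup>2 \<le> (1 + 1 / a) * (1 + a * (norm z)\<^sup>2)"
      using a(1) by (simp add: field_simps)
    also have "\<dots> \<le> (1 + 1 / a) * exp (a * (norm z)\<^sup>2)"
      using a(1) by (intro mult_left_mono exp_ge_add_one_self) auto
    finally have "(1 + (norm z)\<^sup>2) ^ n \<le> ((1 + 1 / a) * exp (a * (norm z)\<^sup>2)) ^ n"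
      by (intro power_mono) auto
    also have "\<dots> = (1 + 1 / a) ^ n * exp (real n * a * (norm z)\<^sup>2)"
      by (simp add: power_mult_distrib exp_of_nat_mult[symmetric] mult.assoc)
    also have "\<dots> \<le> (1 + 1 / a) ^ n * exp (c / 2 * (norm z)\<^sup>2)"
    proof (intro mult_left_mono)
      have "real n * a * (norm z)\<^sup>2 \<le> c / 2 * (norm z)\<^sup>2"
        using a(2) by (rule mult_right_mono) simp
      then show "exp (real n * a * (norm z)\<^sup>2) \<le> exp (c / 2 * (norm z)\<^sup>2)" by simp
    qed (use a in simp)
    finally have "(1 + (norm z)\<^sup>2) ^ n * exp (- c * (norm z)\<^sup>2) \<le> (1 + 1 / a) ^ n * exp (c / 2 * (norm z)\<^sup>2) * exp (- c * (norm z)\<^sup>2)"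
      by (intro mult_right_mono) auto
    also have "\<dots> = (1 + 1 / a) ^ n * exp (- (c / 2) * (norm z)\<^sup>2)"
      by (simp add: mult.assoc exp_add[symmetric])
    finally have "\<bar>K1 * K2\<bar> * ((1 + (norm z)\<^sup>2) ^ n * exp (- c * (norm z)\<^sup>2)) \<le> \<bar>K1 * K2\<bar> * ((1 + 1 / a) ^ n * exp (- (c / 2) * (norm z)\<^sup>2))"
      by (intro mult_left_mono) auto
    then show ?thesis unfolding 1 2 by (simp add: abs_mult mult_ac)
  qed
  moreover have "c / 2 > 0" using c by simp
  ultimately show ?thesis unfolding dom_gauss_def by blast
qed

lemma nn_integral_gauss_finite:
  assumes c: "c > 0"
  shows "(\<integral>\<^sup>+z. ennreal (exp (- c * (norm (z::'z::euclidean_space))\<^sup>2)) \<partial>lborel) < \<infinity>"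
proof -
  have 1: "(\<integral>\<^sup>+r. ennreal (exp (- c * r\<^sup>2)) \<partial>lborel) < \<infinity>"
  proof -
    define s where "s = 1 / sqrt (2 * c)"
    have s: "s > 0" "s\<^sup>2 = 1 / (2 * c)" using c by (auto simp: s_def power_divide)
    have "integrable lborel (\<lambda>r. sqrt (2 * pi * s\<^sup>2) * normal_density 0 s r)"
      using s by (intro integrable_mult_right) auto
    also have "(\<lambda>r. sqrt (2 * pi * s\<^sup>2) * normal_density 0 s r) = (\<lambda>r. exp (- c * r\<^sup>2))"
      using c s by (auto simp: normal_density_def field_simps)
    finally have "integrable lborel (\<lambda>r. exp (- c * r\<^sup>2))" .
    then show ?thesis by (subst nn_integral_eq_integral) auto
  qed
  have "(\<integral>\<^sup>+z. ennreal (exp (- c * (norm (z::'z))\<^sup>2)) \<partial>lborel) =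
      (\<integral>\<^sup>+z. (\<Prod>b\<in>Basis. ennreal (exp (- c * ((z::'z) \<bullet> b)\<^sup>2))) \<partial>lborel)"
  proof (intro nn_integral_cong)
    fix z :: 'z
    have "- c * (norm z)\<^sup>2 = (\<Sum>b\<in>Basis. - c * (z \<bullet> b)\<^sup>2)"
      unfolding power2_norm_eq_inner euclidean_inner[of z z] by (simp add: sum_distrib_left power2_eq_square)
    then show "ennreal (exp (- c * (norm z)\<^sup>2)) = (\<Prod>b\<in>Basis. ennreal (exp (- c * (z \<bullet> b)\<^sup>2)))"
      by (simp add: prod_ennreal exp_sum)
  qed
  also have "\<dots> = (\<Prod>b\<in>(Basis::'z set). (\<integral>\<^sup>+r. ennreal (exp (- c * r\<^sup>2)) \<partial>lborel))"
    by (rule nn_integral_lborel_prod) auto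
  also have "\<dots> < \<infinity>"
    using 1 by (simp add: ennreal_prod_eq_top less_top[symmetric] power_eq_top_ennreal)
  finally show ?thesis .
qed

lemma dom_gauss_integrable:
  assumes "dom_gauss (H :: 'z::euclidean_space \<Rightarrow> real)" shows "integrable lborel H"
proof -
  obtain K c where c: "c > 0" and H: "H = (\<lambda>z. K * exp (- c * (norm z)\<^sup>2))"
    using assms by (auto simp: dom_gauss_def)
  have "integrable lborel (\<lambda>z::'z. exp (- c * (norm z)\<^sup>2))"
    using nn_integral_gauss_finite[OF c, where 'z='z] by (intro integrableI_bounded) auto
  then show ?thesis unfolding H by simp
qed

section \<open>Smooth dependence of the inverse matrix\<close>

lemma norm_matrix_vector_le: "norm (A *v x) \<le> norm A * norm x"
  for A :: "real^'n::finite^'m::finite"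
proof -
  have "norm (A *v x) = L2_set (\<lambda>i. \<bar>A $ i \<bullet> x\<bar>) UNIV"
    by (simp add: norm_vec_def matrix_vector_mul_component)
  also have "\<dots> \<le> L2_set (\<lambda>i. norm (A $ i) * norm x) UNIV"
    by (intro L2_set_mono) (auto intro: Cauchy_Schwarz_ineq2)
  also have "\<dots> = norm A * norm x"
    by (simp add: norm_vec_def[of A] L2_set_left_distrib)
  finally show ?thesis .
qed

lemma Ck_on_vec_nth: "Ck_on k S f \<Longrightarrow> Ck_on k S (\<lambda>x. f x $ i)"
  by (rule Ck_on_bounded_linear[OF bounded_linear_vec_nth])

lemma Ck_on_det:
  fixes A :: "'a::euclidean_space \<Rightarrow> real^'n::finite^'n"
  assumes "\<And>i j. Ck_on k S (\<lambda>x. A x $ i $ j)"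
  shows "Ck_on k S (\<lambda>x. det (A x))"
  unfolding det_def by (intro Ck_on_sum Ck_on_mult Ck_on_const Ck_on_prod assms)

lemma matrix_inv_mult:
  assumes "invertible A"
  shows "A ** matrix_inv A = mat 1" "matrix_inv A ** A = mat 1"
  using someI_ex[OF assms[unfolded invertible_def]] unfolding matrix_inv_def by auto

lemma matrix_inv_entry:
  fixes A :: "real^'n::finite^'n"
  assumes "invertible A"
  shows "matrix_inv A $ i $ j = det (\<chi> r s. if s = i then axis j 1 $ r else A $ r $ s) / det A"
proof -
  have d: "det A \<noteq> 0" using assms invertible_det_nz by blast
  have "A *v (matrix_inv A *v axis j 1) = axis j 1"
    using matrix_inv_mult(1)[OF assms] by (simp add: matrix_vector_mul_assoc)
  then have "matrix_inv A *v axis j 1 = (\<chi> k. det (\<chi> r s. if s = k then axis j 1 $ r else A $ r $ s) / det A)"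
    using cramer[OF d] by blast
  moreover have "(matrix_inv A *v axis j 1) $ i = matrix_inv A $ i $ j"
    by (simp add: matrix_vector_mul_component inner_axis)
  ultimately show ?thesis by simp
qed

text \<open>By Cramer's rule the entries are rational functions of the entries of \<open>A\<close>.\<close>

lemma Ck_on_matrix_inv:
  fixes A :: "'a::euclidean_space \<Rightarrow> real^'n::finite^'n"
  assumes A: "\<And>i j. Ck_on k S (\<lambda>x. A x $ i $ j)" and inv: "\<And>x. invertible (A x)"
  shows "Ck_on k S (\<lambda>x. matrix_inv (A x) $ i $ j)"
  unfolding matrix_inv_entry[OF inv] divide_inverse
proof (intro Ck_on_mult Ck_on_inverse Ck_on_det)
  show "Ck_on k S (\<lambda>x. (\<chi> r s. if s = i then axis j 1 $ r else A x $ r $ s) $ i' $ j')" for i' j'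
    using A by (cases "j' = i") (simp_all add: Ck_on_const)
  show "det (A x) \<noteq> 0" for x using inv invertible_det_nz by blast
qed (rule A)

lemma locally_dominated_bounded:
  assumes "\<And>w. f w \<in> borel_measurable borel" "\<And>z. continuous_on UNIV (\<lambda>w. f w z)" "\<And>w z. \<bar>f w z\<bar> \<le> K"
  shows "locally_dominated dom_const f"
  unfolding locally_dominated_def dom_const_def using assms zero_less_one by blast

section \<open>The transition kernel of one step\<close>

lemma continuous_on_slices:
  assumes "continuous_on UNIV (\<lambda>(x, y). f x y)"
  shows "continuous_on UNIV (\<lambda>x. f x y)" "continuous_on UNIV (\<lambda>y. f x y)"
proof -
  have "continuous_on UNIV (\<lambda>x. (x, y))" "continuous_on UNIV (\<lambda>y. (x, y))"
    by (intro continuous_on_Pair continuous_on_id continuous_on_const)+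
  from this[THEN continuous_on_compose2[OF assms]]
  show "continuous_on UNIV (\<lambda>x. f x y)" "continuous_on UNIV (\<lambda>y. f x y)" by simp_all
qed

lemma dom_poly_const: "dom_const H \<Longrightarrow> dom_poly H"
  unfolding dom_const_def dom_poly_def by (metis mult.right_neutral power_0)

lemma dom_Ck_poly_mult: "dom_Ck dom_poly k f \<Longrightarrow> dom_Ck dom_poly k g \<Longrightarrow> dom_Ck dom_poly k (\<lambda>w z. f w z * g w z)"
  by (rule dom_Ck_mult[where ?P1.0=dom_poly and ?P2.0=dom_poly])
    (auto intro: dom_poly_mult dom_poly_add)

lemma dom_Ck_poly_add: "dom_Ck dom_poly k f \<Longrightarrow> dom_Ck dom_poly k g \<Longrightarrow> dom_Ck dom_poly k (\<lambda>w z. f w z + g w z)"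
  by (rule dom_Ck_add) (auto intro: dom_poly_add)

lemma dom_Ck_poly_zero: "dom_Ck dom_poly k (\<lambda>_ _. 0)"
  by (rule dom_Ck_const) (auto intro!: dom_poly_const simp: dom_const_def)

lemma dom_Ck_poly_sum:
  assumes "finite I" "\<And>i. i \<in> I \<Longrightarrow> dom_Ck dom_poly k (f i)"
  shows "dom_Ck dom_poly k (\<lambda>y x. \<Sum>i\<in>I. f i y x)"
  using assms
proof (induction I)
  case empty
  then show ?case by (simp add: dom_Ck_poly_zero)
next
  case (insert i I)
  then show ?case by (auto intro!: dom_Ck_poly_add)
qed

lemma dom_Ck_poly_exp:
  "locally_dominated dom_gauss (\<lambda>w z. exp (f w z)) \<Longrightarrow> dom_Ck dom_poly k f \<Longrightarrow> dom_Ck dom_gauss k (\<lambda>w z. exp (f w z))"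
  by (rule dom_Ck_exp[where ?P1.0=dom_poly]) (auto intro: dom_poly_gauss_mult dom_gauss_add)

lemma Ck_on_id: "Ck_on k UNIV (\<lambda>x. x)"
proof (cases k)
  case (Suc j)
  then show ?thesis by (simp, intro exI[of _ "\<lambda>_ v. v"]) (simp add: Ck_on_const)
qed simp

text \<open>One step of length \<open>\<delta>\<close> moves \<open>y\<close> to \<open>y + \<delta> \<beta> y + S y w\<close>, where \<open>w\<close> is Gaussian with covariance
\<open>\<delta> I\<close>.\<close>

locale elliptic_step =
  fixes \<delta> \<kappa> :: real
    and \<beta> :: "real^'d::finite \<Rightarrow> real^'d"
    and S :: "real^'d \<Rightarrow> real^'m::finite^'d"
  assumes \<delta>: "0 < \<delta>" and \<kappa>: "0 < \<kappa>"
    and \<beta>: "Ck_on 2 UNIV \<beta>" and S: "Ck_on 2 UNIV S"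
    and elliptic: "\<And>y. pos_semidef (S y ** transpose (S y) - mat \<kappa>)"
begin

definition Lam :: "real^'d \<Rightarrow> real^'d^'d" where
  "Lam y = S y ** transpose (S y)"

definition step_mean :: "real^'d \<Rightarrow> real^'d" where
  "step_mean y = y + \<delta> *\<^sub>R \<beta> y"

definition form :: "real^'d \<Rightarrow> real^'d \<Rightarrow> real^'d \<Rightarrow> real" where
  "form y u v = u \<bullet> (matrix_inv (Lam y) *v v)"

definition weight :: "real^'d \<Rightarrow> real^'d \<Rightarrow> real" where
  "weight x y = exp (- (form y (x - step_mean y) (x - step_mean y) / (2 * \<delta>)))"

text \<open>The normalisation is left as an integral: its smoothness then follows by differentiation under the
integral sign, and a lower bound by comparison with a fixed Gaussian.\<close>

definition mass :: "real^'d \<Rightarrow> real" where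
  "mass y = (\<integral>x. weight x y \<partial>lborel)"

definition kernel :: "real^'d \<Rightarrow> real^'d \<Rightarrow> real" where
  "kernel x y = weight x y * inverse (mass y)"

lemma Lam_inner: "u \<bullet> (Lam y *v v) = (transpose (S y) *v u) \<bullet> (transpose (S y) *v v)"
  unfolding Lam_def
  by (simp add: matrix_vector_mul_assoc[symmetric] dot_lmul_matrix[symmetric] transpose_matrix_vector)

lemma Lam_coercive: "\<kappa> * (norm v)\<^sup>2 \<le> (norm (transpose (S y) *v v))\<^sup>2"
proof -
  have "0 \<le> v \<bullet> ((Lam y - mat \<kappa>) *v v)"
    using elliptic[of y] by (simp add: pos_semidef_def Lam_def)
  also have "(mat \<kappa> :: real^'d^'d) *v v = \<kappa> *\<^sub>R v"
    by (simp add: vec_eq_iff matrix_vector_mult_def mat_def if_distrib[of "\<lambda>x. x * _"] cong: if_cong)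
  then have "v \<bullet> ((Lam y - mat \<kappa>) *v v) = v \<bullet> (Lam y *v v) - \<kappa> * (norm v)\<^sup>2"
    by (simp add: matrix_vector_mult_diff_rdistrib inner_diff_right power2_norm_eq_inner)
  finally show ?thesis by (simp add: Lam_inner power2_norm_eq_inner)
qed

lemma Lam_invertible: "invertible (Lam y)"
proof -
  have "v = 0" if "Lam y *v v = 0" for v
  proof -
    have "(norm (transpose (S y) *v v))\<^sup>2 = 0"
      using Lam_inner[of v y v] that by (simp add: power2_norm_eq_inner)
    with Lam_coercive[of v y] \<kappa> show ?thesis by (simp add: mult_le_0_iff)
  qed
  then have "\<exists>B. B ** Lam y = mat 1" using matrix_left_invertible_ker by blast
  then show ?thesis using invertible_left_inverse by blast
qed

lemma Lam_matrix_inv: "Lam y *v (matrix_inv (Lam y) *v v) = v"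
  by (simp add: matrix_vector_mul_assoc matrix_inv_mult[OF Lam_invertible])

text \<open>Symmetry, positivity and the Cauchy-Schwarz inequality for the form are read off from this
representation as a Euclidean inner product.\<close>

lemma form_eq:
  "form y u v = (transpose (S y) *v (matrix_inv (Lam y) *v u)) \<bullet> (transpose (S y) *v (matrix_inv (Lam y) *v v))"
  unfolding form_def
  by (subst (2) inner_commute, subst Lam_inner[symmetric], subst Lam_matrix_inv, rule inner_commute)

lemma form_sym: "form y u v = form y v u"
  by (simp add: form_eq inner_commute)

lemma form_nonneg: "0 \<le> form y u u"
  by (simp add: form_eq)

lemma form_diff: "form y (u - u') v = form y u v - form y u' v" "form y v (u - u') = form y v u - form y v u'"
  by (simp_all add: form_def inner_diff_left inner_diff_right matrix_vector_mult_diff_distrib)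

text \<open>With \<open>a = \<Lambda>\<^sup>-\<^sup>1 v\<close>, ellipticity gives \<open>\<kappa> |a|\<^sup>2 \<le> \<langle>a, \<Lambda> a\<rangle> = \<langle>a, v\<rangle>\<close>.\<close>

lemma form_le: "form y v v \<le> (norm v)\<^sup>2 / \<kappa>"
proof -
  let ?a = "matrix_inv (Lam y) *v v"
  have "\<kappa> * (norm ?a)\<^sup>2 \<le> form y v v"
    using Lam_coercive[of ?a y] by (simp add: form_eq power2_norm_eq_inner)
  also have "\<dots> \<le> norm v * norm ?a"
    unfolding form_def by (rule norm_cauchy_schwarz)
  finally have 1: "\<kappa> * (norm ?a)\<^sup>2 \<le> norm v * norm ?a" .
  have "\<kappa> * norm ?a \<le> norm v"
  proof (cases "norm ?a = 0")
    case False
    then have "norm ?a * (\<kappa> * norm ?a) \<le> norm ?a * norm v" using 1 by (simp add: power2_eq_square mult_ac)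
    then show ?thesis using False by (simp add: mult_le_cancel_left)
  qed simp
  then have "norm ?a \<le> norm v / \<kappa>" using \<kappa> by (simp add: field_simps)
  then have "norm v * norm ?a \<le> norm v * (norm v / \<kappa>)" by (intro mult_left_mono) auto
  with \<open>form y v v \<le> norm v * norm ?a\<close> show ?thesis by (simp add: power2_eq_square)
qed

lemma form_Cauchy_Schwarz: "(form y u v)\<^sup>2 \<le> form y u u * form y v v"
  unfolding form_eq using Cauchy_Schwarz_ineq by (metis inner_commute)

lemma norm_le_form: "(norm x)\<^sup>2 \<le> (norm (S y))\<^sup>2 * form y x x"
proof -
  let ?w = "transpose (S y) *v (matrix_inv (Lam y) *v x)"
  have "x = S y *v ?w"
    using Lam_matrix_inv[of y x] by (simp add: Lam_def matrix_vector_mul_assoc matrix_mul_assoc)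
  then have "norm x \<le> norm (S y) * norm ?w" using norm_matrix_vector_le by metis
  then have "(norm x)\<^sup>2 \<le> (norm (S y) * norm ?w)\<^sup>2" by (intro power_mono) auto
  then show ?thesis by (simp add: form_eq power_mult_distrib power2_norm_eq_inner)
qed

lemma S_nonzero: "S y \<noteq> 0"
proof
  assume 0: "S y = 0"
  obtain b :: "real^'d" where "b \<in> Basis" using nonempty_Basis by blast
  then show False using norm_le_form[of b y] by (simp add: 0)
qed

lemma Lam_entry: "Lam y $ i $ j = (\<Sum>k\<in>UNIV. S y $ i $ k * S y $ j $ k)"
  by (simp add: Lam_def matrix_matrix_mult_def transpose_def)

lemma Ck_on_Lam_inv: "Ck_on 2 UNIV (\<lambda>y. matrix_inv (Lam y) $ i $ j)"
proof (rule Ck_on_matrix_inv)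
  show "Ck_on 2 UNIV (\<lambda>y. Lam y $ i $ j)" for i j
    unfolding Lam_entry by (intro Ck_on_sum Ck_on_mult Ck_on_vec_nth S)
qed (rule Lam_invertible)

lemma Ck_on_step_mean: "Ck_on 2 UNIV (\<lambda>y. step_mean y $ i)"
  unfolding step_mean_def
  by (intro Ck_on_vec_nth Ck_on_add Ck_on_id Ck_on_bounded_linear[OF bounded_linear_scaleR_right] \<beta>)

lemma form_sum: "form y u v = (\<Sum>i\<in>UNIV. \<Sum>j\<in>UNIV. matrix_inv (Lam y) $ i $ j * (u $ i * v $ j))"
  by (simp add: form_def inner_vec_def matrix_vector_mult_def sum_distrib_left mult_ac)

lemma Ck_on_weight: "Ck_on 2 UNIV (\<lambda>(x, y). weight x y)"
proof -
  have lin: "Ck_on 2 UNIV (\<lambda>w. (fst w - step_mean (snd w)) $ i)" for i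
  proof -
    have "Ck_on 2 UNIV (\<lambda>w::(real^'d) \<times> (real^'d). fst w $ i)"
      using Ck_on_linear_comp[OF bounded_linear_fst, of UNIV UNIV 2 "\<lambda>x. x $ i"] Ck_on_vec_nth[OF Ck_on_id] by auto
    moreover have "Ck_on 2 UNIV (\<lambda>w::(real^'d) \<times> (real^'d). step_mean (snd w) $ i)"
      using Ck_on_linear_comp[OF bounded_linear_snd, of UNIV UNIV 2 "\<lambda>y. step_mean y $ i"] Ck_on_step_mean by auto
    ultimately show ?thesis by (simp add: Ck_on_diff)
  qed
  have "Ck_on 2 UNIV (\<lambda>w::(real^'d) \<times> (real^'d). matrix_inv (Lam (snd w)) $ i $ j)" for i j
    using Ck_on_linear_comp[OF bounded_linear_snd, of UNIV UNIV 2 "\<lambda>y. matrix_inv (Lam y) $ i $ j"] Ck_on_Lam_inv by auto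
  then have "Ck_on 2 UNIV (\<lambda>w. form (snd w) (fst w - step_mean (snd w)) (fst w - step_mean (snd w)))"
    unfolding form_sum by (intro Ck_on_sum Ck_on_mult lin)
  then have "Ck_on 2 UNIV (\<lambda>w. weight (fst w) (snd w))"
    unfolding weight_def divide_inverse by (intro Ck_on_exp Ck_on_minus Ck_on_mult Ck_on_const)
  then show ?thesis by (simp add: case_prod_unfold)
qed

text \<open>On a compact ball of starting points the mean and the diffusion matrix are bounded, and then the
exponent is at most a constant minus a multiple of \<open>|x|\<^sup>2\<close>.\<close>

lemma weight_upper:
  "\<exists>e>0. \<exists>K c. c > 0 \<and> (\<forall>y\<in>ball y0 e. \<forall>x. weight x y \<le> K * exp (- c * (norm x)\<^sup>2))"
proof -
  have "continuous_on UNIV S" "continuous_on UNIV \<beta>" using S \<beta> Ck_on_continuous by blast+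
  then have cm: "continuous_on UNIV (\<lambda>y. norm (step_mean y))" and cs: "continuous_on UNIV (\<lambda>y. norm (S y))"
    unfolding step_mean_def by (intro continuous_intros; simp)+
  have "compact ((\<lambda>y. norm (step_mean y)) ` cball y0 1)" "compact ((\<lambda>y. norm (S y)) ` cball y0 1)"
    using cm cs by (auto intro!: compact_continuous_image intro: continuous_on_subset)
  from this[THEN compact_imp_bounded] obtain m0 s where
      "\<forall>x\<in>(\<lambda>y. norm (step_mean y)) ` cball y0 1. \<bar>x\<bar> \<le> m0" "\<forall>x\<in>(\<lambda>y. norm (S y)) ` cball y0 1. \<bar>x\<bar> \<le> s"
    unfolding bounded_real by blast
  then have m0: "\<And>y. y \<in> cball y0 1 \<Longrightarrow> norm (step_mean y) \<le> m0"
      and s0: "\<And>y. y \<in> cball y0 1 \<Longrightarrow> norm (S y) \<le> s"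
    by auto
  have s: "s > 0" using s0[of y0] S_nonzero[of y0] by (metis centre_in_cball zero_le_one less_le_trans zero_less_norm_iff)
  define a where "a = 1 / (2 * \<delta> * s\<^sup>2)"
  have a: "a > 0" using \<delta> s by (simp add: a_def)
  have "weight x y \<le> exp (a * m0\<^sup>2) * exp (- (a / 2) * (norm x)\<^sup>2)" if y: "y \<in> ball y0 1" for x y
  proof -
    let ?u = "x - step_mean y"
    have m: "norm (step_mean y) \<le> m0" and sy: "norm (S y) \<le> s" using m0[of y] s0[of y] y by auto
    have "norm x \<le> norm ?u + m0"
      using norm_triangle_ineq[of ?u "step_mean y"] m by simp
    then have "(norm x)\<^sup>2 \<le> (norm ?u + m0)\<^sup>2" by (intro power_mono) auto
    also have "\<dots> \<le> 2 * (norm ?u)\<^sup>2 + 2 * m0\<^sup>2"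
      using sum_squares_bound[of "norm ?u" m0] by (simp add: power2_sum)
    finally have 1: "(norm x)\<^sup>2 / 2 - m0\<^sup>2 \<le> (norm ?u)\<^sup>2" by simp
    have "(norm ?u)\<^sup>2 \<le> (norm (S y))\<^sup>2 * form y ?u ?u" by (rule norm_le_form)
    also have "\<dots> \<le> s\<^sup>2 * form y ?u ?u"
      using sy by (intro mult_right_mono form_nonneg power_mono) auto
    finally have "a * (norm ?u)\<^sup>2 \<le> form y ?u ?u / (2 * \<delta>)"
      using s \<delta> by (simp add: a_def field_simps)
    moreover have "a * ((norm x)\<^sup>2 / 2 - m0\<^sup>2) \<le> a * (norm ?u)\<^sup>2"
      using 1 a by (intro mult_left_mono) auto
    ultimately have "- (form y ?u ?u / (2 * \<delta>)) \<le> a * m0\<^sup>2 + (- (a / 2) * (norm x)\<^sup>2)"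
      by (simp add: right_diff_distrib)
    then have "weight x y \<le> exp (a * m0\<^sup>2 + (- (a / 2) * (norm x)\<^sup>2))" unfolding weight_def by (simp only: exp_le_cancel_iff)
    then show ?thesis by (simp only: exp_add)
  qed
  then show ?thesis using a by (intro exI[of _ 1] conjI exI[of _ "exp (a * m0\<^sup>2)"] exI[of _ "a / 2"] ballI allI) auto
qed

lemma weight_pos: "weight x y > 0" by (simp add: weight_def)

lemma weight_continuous: "continuous_on UNIV (\<lambda>(x, y). weight x y)"
  using Ck_on_weight Ck_on_continuous by blast

lemma weight_continuous1: "continuous_on UNIV (\<lambda>x. weight x y)"
  by (rule continuous_on_slices(1)[OF weight_continuous])

lemma weight_continuous2: "continuous_on UNIV (\<lambda>y. weight x y)"
  by (rule continuous_on_slices(2)[OF weight_continuous])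

lemma dom_gauss_weight0: "locally_dominated dom_gauss (\<lambda>y x. weight x y)"
  unfolding locally_dominated_def
proof (intro conjI allI)
  show "(\<lambda>x. weight x y) \<in> borel_measurable borel" for y
    using weight_continuous1 borel_measurable_continuous_onI by blast
  show "continuous_on UNIV (\<lambda>y. weight x y)" for x by (rule weight_continuous2)
  fix y0 :: "real^'d"
  obtain e K c where "e > 0" "c > 0" "\<forall>y\<in>ball y0 e. \<forall>x. weight x y \<le> K * exp (- c * (norm x)\<^sup>2)"
    using weight_upper by blast
  then show "\<exists>e>0. \<exists>H. dom_gauss H \<and> (\<forall>y\<in>ball y0 e. \<forall>x. \<bar>weight x y\<bar> \<le> H x)"
    by (intro exI[of _ e] conjI exI[of _ "\<lambda>x. K * exp (- c * (norm x)\<^sup>2)"])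
      (auto simp: dom_gauss_def less_imp_le[OF weight_pos])
qed

text \<open>The exponent is a quadratic polynomial in \<open>x\<close> whose coefficients are smooth functions of \<open>y\<close>.\<close>

lemma dom_Ck_gauss_weight: "dom_Ck dom_gauss 2 (\<lambda>y x. weight x y)"
proof -
  have Ck: "dom_Ck dom_poly 2 (\<lambda>y (x::real^'d). g y)" if "Ck_on 2 UNIV g" for g :: "real^'d \<Rightarrow> real"
    by (rule dom_Ck_mono[OF dom_poly_const dom_Ck_of_Ck[OF that]])
  have lin: "dom_Ck dom_poly 2 (\<lambda>y x. (x - step_mean y) $ i)" for i
  proof -
    have "locally_dominated dom_poly (\<lambda>(y::real^'d) (x::real^'d). x $ i)"
    proof -
      have "\<bar>x $ i\<bar> \<le> 1 * (1 + (norm x)\<^sup>2) ^ 1" for x :: "real^'d"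
      proof -
        have "\<bar>x $ i\<bar> \<le> norm x" by (rule component_le_norm_cart)
        also have "\<dots> \<le> 1 + (norm x)\<^sup>2"
          using sum_squares_bound[of "norm x" 1] by (simp add: power2_eq_square) (use norm_ge_zero[of x] in linarith)
        finally show ?thesis by simp
      qed
      moreover have "dom_poly (\<lambda>x::real^'d. 1 * (1 + (norm x)\<^sup>2) ^ 1)" unfolding dom_poly_def by blast
      ultimately show ?thesis unfolding locally_dominated_def
        by (auto intro!: borel_measurable_continuous_onI continuous_intros exI[of _ 1])
    qed
    moreover have "dom_poly (\<lambda>_::real^'d. 0)" by (intro dom_poly_const) (auto simp: dom_const_def)
    ultimately have "dom_Ck dom_poly 2 (\<lambda>(y::real^'d) (x::real^'d). x $ i)"
      unfolding numeral_2_eq_2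
      by (simp, intro conjI exI[of _ "\<lambda>_ _ _. 0"] allI) (auto intro!: locally_dominated_const exI[of _ "\<lambda>_ _ _. 0"])
    moreover have "dom_Ck dom_poly 2 (\<lambda>y (x::real^'d). - step_mean y $ i)"
      by (intro Ck Ck_on_minus Ck_on_step_mean)
    ultimately have "dom_Ck dom_poly 2 (\<lambda>y x. x $ i + - step_mean y $ i)"
      by (rule dom_Ck_poly_add)
    then show ?thesis by simp
  qed
  have form: "dom_Ck dom_poly 2 (\<lambda>y x. form y (x - step_mean y) (x - step_mean y))"
    unfolding form_sum
    by (intro dom_Ck_poly_sum dom_Ck_poly_mult lin Ck Ck_on_Lam_inv) auto
  have "dom_Ck dom_poly 2 (\<lambda>y x. (- 1 / (2 * \<delta>)) * form y (x - step_mean y) (x - step_mean y))"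
    by (intro dom_Ck_poly_mult form Ck Ck_on_const)
  then have "dom_Ck dom_gauss 2 (\<lambda>y x. exp ((- 1 / (2 * \<delta>)) * form y (x - step_mean y) (x - step_mean y)))"
    using dom_gauss_weight0
    by (intro dom_Ck_poly_exp) (simp_all add: weight_def)
  then show ?thesis by (simp add: weight_def)
qed

end

lemma integral_lborel_pos:
  fixes f :: "'a::euclidean_space \<Rightarrow> real"
  assumes "integrable lborel f" "\<And>x. f x > 0"
  shows "(\<integral>x. f x \<partial>lborel) > 0"
proof -
  have "(\<integral>x. f x \<partial>lborel) \<noteq> 0"
  proof
    assume "(\<integral>x. f x \<partial>lborel) = 0"
    then have "AE x in lborel. f x = 0"
      using integral_nonneg_eq_0_iff_AE[OF assms(1)] assms(2) by (simp add: less_imp_le)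
    then have "AE x in (lborel :: 'a measure). False"
      using assms(2) by (auto elim!: eventually_mono) (metis less_irrefl)
    then have "emeasure (lborel :: 'a measure) UNIV = 0"
      by (subst (asm) AE_iff_measurable[of UNIV]) auto
    then show False by simp
  qed
  moreover have "(\<integral>x. f x \<partial>lborel) \<ge> 0" using assms(2) by (simp add: less_imp_le)
  ultimately show ?thesis by simp
qed

lemma integral_lborel_translate:
  fixes f :: "'a::euclidean_space \<Rightarrow> real"
  assumes "f \<in> borel_measurable borel"
  shows "(\<integral>x. f (x - c) \<partial>lborel) = (\<integral>x. f x \<partial>lborel)"
  using assms by (subst lborel_distr_plus[of c, symmetric], subst integral_distr) auto

context elliptic_step
begin

lemma dom_Ck_integrable_weight: "dom_Ck (integrable lborel) 2 (\<lambda>y x. weight x y)"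
  by (rule dom_Ck_mono[OF dom_gauss_integrable dom_Ck_gauss_weight])

lemma weight_integrable: "integrable lborel (\<lambda>x. weight x y)"
  using continuous_integral_locally_dominated(1)[OF _ dom_Ck_locally_dominated[OF dom_Ck_integrable_weight]] by simp

lemma Ck_on_mass: "Ck_on 2 UNIV mass"
  using Ck_on_integral[OF _ dom_Ck_integrable_weight] by (simp add: mass_def[abs_def])

lemma mass_pos: "mass y > 0"
  unfolding mass_def by (intro integral_lborel_pos weight_integrable weight_pos)

text \<open>Ellipticity bounds the weight from below by a translate of one fixed Gaussian.\<close>

lemma mass_lower: "\<exists>m>0. \<forall>y. m \<le> mass y"
proof (intro exI conjI allI)
  let ?g = "\<lambda>x::real^'d. exp (- (1 / (2 * \<delta> * \<kappa>)) * (norm x)\<^sup>2)"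
  have g: "integrable lborel ?g"
    using \<delta> \<kappa>
    by (intro dom_gauss_integrable, unfold dom_gauss_def)
      (rule exI[of _ 1], rule exI[of _ "1 / (2 * \<delta> * \<kappa>)"], simp)
  then show "0 < (\<integral>x. ?g x \<partial>lborel)" by (intro integral_lborel_pos) auto
  fix y
  have [measurable]: "?g \<in> borel_measurable borel" by measurable
  have "(\<integral>x. ?g x \<partial>lborel) = (\<integral>x. ?g (x - step_mean y) \<partial>lborel)"
    by (rule integral_lborel_translate[symmetric]) measurable
  also have "\<dots> \<le> mass y"
    unfolding mass_def
  proof (rule integral_mono)
    show "integrable lborel (\<lambda>x. ?g (x - step_mean y))"
      using g by (subst (asm) lborel_distr_plus[of "- step_mean y", symmetric], subst (asm) integrable_distr_eq) auto
    show "?g (x - step_mean y) \<le> weight x y" for x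
      using form_le[of y "x - step_mean y"] \<delta> \<kappa> unfolding weight_def by (simp add: field_simps)
  qed (rule weight_integrable)
  finally show "(\<integral>x. ?g x \<partial>lborel) \<le> mass y" .
qed

lemma Ck_on_inverse_mass: "Ck_on 2 UNIV (\<lambda>y. inverse (mass y))"
  by (rule Ck_on_inverse[OF _ Ck_on_mass]) (use mass_pos in \<open>simp add: less_imp_neq[THEN not_sym]\<close>)

lemma kernel_pos: "kernel x y > 0"
  by (simp add: kernel_def weight_pos mass_pos)

lemma kernel_integrable: "integrable lborel (\<lambda>x. kernel x y)"
  by (simp add: kernel_def weight_integrable)

lemma kernel_integral: "(\<integral>x. kernel x y \<partial>lborel) = 1"
  using mass_pos[of y] by (simp add: kernel_def mass_def[symmetric])

lemma Ck_on_kernel: "Ck_on 2 UNIV (\<lambda>(x, y). kernel x y)"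
proof -
  have "Ck_on 2 UNIV (\<lambda>w::(real^'d) \<times> (real^'d). inverse (mass (snd w)))"
    using Ck_on_linear_comp[OF bounded_linear_snd, of UNIV UNIV 2 "\<lambda>y. inverse (mass y)"] Ck_on_inverse_mass by auto
  then show ?thesis
    using Ck_on_mult[OF Ck_on_weight] unfolding kernel_def case_prod_unfold by blast
qed

lemma kernel_continuous: "continuous_on UNIV (\<lambda>(x, y). kernel x y)"
  using Ck_on_kernel Ck_on_continuous by blast

text \<open>Here the starting point is the parameter and the end point the variable of integration.\<close>

lemma dom_Ck_gauss_kernel: "dom_Ck dom_gauss 2 (\<lambda>y x. kernel x y)"
proof -
  have "dom_Ck dom_poly 2 (\<lambda>y (x::real^'d). inverse (mass y))"
    by (rule dom_Ck_mono[OF dom_poly_const dom_Ck_of_Ck[OF Ck_on_inverse_mass]])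
  then have "dom_Ck dom_gauss 2 (\<lambda>y x. inverse (mass y) * weight x y)"
    using dom_Ck_gauss_weight
    by (rule dom_Ck_mult[where ?P1.0=dom_poly and ?P2.0=dom_gauss, rotated 2]) (auto intro: dom_poly_gauss_mult dom_gauss_add)
  then show ?thesis by (simp add: kernel_def mult.commute)
qed

lemma form_has_derivative:
  "((\<lambda>x. form y (x - c) v) has_derivative (\<lambda>u. form y u v)) (at x)"
  "((\<lambda>x. form y (x - c) (x - c)) has_derivative (\<lambda>u. 2 * form y (x - c) u)) (at x)"
proof -
  have M: "((\<lambda>x. matrix_inv (Lam y) *v (x - c)) has_derivative (\<lambda>u. matrix_inv (Lam y) *v u)) (at x)"
    by (rule bounded_linear.has_derivative[OF matrix_vector_mul_bounded_linear]) (auto intro!: derivative_eq_intros)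
  have I: "((\<lambda>x. x - c) has_derivative (\<lambda>u. u)) (at x)" by (auto intro!: derivative_eq_intros)
  show "((\<lambda>x. form y (x - c) v) has_derivative (\<lambda>u. form y u v)) (at x)"
    unfolding form_def by (rule has_derivative_inner_left[OF I])
  have "form y (x - c) u + form y u (x - c) = 2 * form y (x - c) u" for u
    by (simp add: form_sym)
  then show "((\<lambda>x. form y (x - c) (x - c)) has_derivative (\<lambda>u. 2 * form y (x - c) u)) (at x)"
    using has_derivative_inner[OF I M] by (simp add: form_def)
qed

lemma kernel_has_derivative:
  "((\<lambda>x. kernel x y) has_derivative (\<lambda>u. - (form y (x - step_mean y) u / \<delta>) * kernel x y)) (at x)"
  unfolding kernel_def weight_def using \<delta> mass_pos[of y]
  by (auto intro!: derivative_eq_intros form_has_derivative simp: field_simps)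

lemma kernel_has_derivative2:
  "((\<lambda>x. - (form y (x - step_mean y) v / \<delta>) * kernel x y) has_derivative
     (\<lambda>u. (form y (x - step_mean y) v * form y (x - step_mean y) u / \<delta>\<^sup>2 - form y u v / \<delta>) * kernel x y)) (at x)"
  using \<delta>
  by (auto intro!: derivative_eq_intros form_has_derivative kernel_has_derivative simp: field_simps power2_eq_square)

lemma form_continuous: "continuous_on UNIV (\<lambda>y. form y (x - step_mean y) u)"
    "continuous_on UNIV (\<lambda>y. form y v u)"
  unfolding form_sum vector_minus_component
  by (intro Ck_on_continuous[of 2] Ck_on_sum Ck_on_mult Ck_on_Lam_inv Ck_on_diff Ck_on_step_mean Ck_on_const)+

text \<open>Here the end point is the parameter.  With \<open>r\<close> the value of the form at \<open>x - step_mean y\<close>, the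
Cauchy-Schwarz inequality estimates the first derivative of the kernel by \<open>sqrt r\<close> and the second one by
\<open>r + 1\<close>, times the kernel and constants that depend neither on \<open>x\<close> nor on \<open>y\<close>; and
\<open>r exp (- r / (2 \<delta>))\<close> is bounded.\<close>

lemma dom_Ck_const_kernel: "dom_Ck dom_const 2 (\<lambda>x y. kernel x y)"
proof -
  obtain m where m: "m > 0" "\<And>y. m \<le> mass y" using mass_lower by blast
  define r where "r x y = form y (x - step_mean y) (x - step_mean y)" for x y
  have r0: "r x y \<ge> 0" for x y unfolding r_def by (rule form_nonneg)
  have k: "kernel x y \<le> exp (- (r x y / (2 * \<delta>))) / m" for x y
    using m(1) m(2)[of y] unfolding kernel_def weight_def r_def divide_inverse by (intro mult_left_mono) auto
  have k0: "kernel x y \<le> 1 / m" for x y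
    using k[of x y] r0[of x y] \<delta> m(1) by (smt (verit) divide_right_mono divide_nonneg_pos exp_le_one_iff)
  have k1: "r x y * kernel x y \<le> 2 * \<delta> / m" for x y
  proof -
    have "r x y / (2 * \<delta>) \<le> exp (r x y / (2 * \<delta>))"
      using exp_ge_add_one_self[of "r x y / (2 * \<delta>)"] by linarith
    then have "r x y * exp (- (r x y / (2 * \<delta>))) \<le> 2 * \<delta>"
      using \<delta> by (simp add: exp_minus field_simps)
    then have "r x y * exp (- (r x y / (2 * \<delta>))) / m \<le> 2 * \<delta> / m"
      using m(1) by (intro divide_right_mono) auto
    moreover have "r x y * kernel x y \<le> r x y * (exp (- (r x y / (2 * \<delta>))) / m)"
      by (intro mult_left_mono k r0)
    ultimately show ?thesis by simp
  qed
  define B where "B v = (norm v)\<^sup>2 / \<kappa>" for v :: "real^'d"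
  have B0: "B v \<ge> 0" for v using \<kappa> by (simp add: B_def)
  have cs: "(form y (x - step_mean y) v)\<^sup>2 \<le> r x y * B v" for x y v
  proof -
    have "(form y (x - step_mean y) v)\<^sup>2 \<le> r x y * form y v v"
      unfolding r_def by (rule form_Cauchy_Schwarz)
    also have "\<dots> \<le> r x y * B v" unfolding B_def by (intro mult_left_mono form_le r0)
    finally show ?thesis .
  qed
  have amgm: "\<bar>a * b\<bar> \<le> (a\<^sup>2 + b\<^sup>2) / 2" for a b :: real
    using sum_squares_bound[of "\<bar>a\<bar>" "\<bar>b\<bar>"] by (simp add: abs_mult)
  have lin: "\<bar>form y (x - step_mean y) v\<bar> * kernel x y \<le> (2 * \<delta> * B v + 1) / m" for x y v
  proof -
    have "\<bar>form y (x - step_mean y) v\<bar> \<le> (form y (x - step_mean y) v)\<^sup>2 + 1"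
      using amgm[of "form y (x - step_mean y) v" 1] zero_le_power2[of "form y (x - step_mean y) v"] by simp
    also have "\<dots> \<le> r x y * B v + 1" using cs by simp
    finally have "\<bar>form y (x - step_mean y) v\<bar> * kernel x y \<le> (r x y * B v + 1) * kernel x y"
      by (intro mult_right_mono less_imp_le[OF kernel_pos])
    also have "\<dots> = B v * (r x y * kernel x y) + kernel x y" by (simp add: algebra_simps)
    also have "\<dots> \<le> B v * (2 * \<delta> / m) + 1 / m" by (intro add_mono mult_left_mono k0 k1 B0)
    finally show ?thesis by (simp add: add_divide_distrib mult_ac)
  qed
  have meas: "kernel x \<in> borel_measurable borel" for x
    using continuous_on_slices(2)[OF kernel_continuous] by (intro borel_measurable_continuous_onI) auto
  have fmeas: "(\<lambda>y. form y (x - step_mean y) u) \<in> borel_measurable borel" "(\<lambda>y. form y v u) \<in> borel_measurable borel" for x u v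
    using form_continuous by (auto intro: borel_measurable_continuous_onI)
  have cont: "continuous_on UNIV (\<lambda>x. kernel x y)" for y
    using continuous_on_slices(1)[OF kernel_continuous] .
  have fcont: "continuous_on UNIV (\<lambda>x. form y (x - step_mean y) u)" for y u
    using has_derivative_continuous[OF form_has_derivative(1)]
    by (simp add: continuous_on_eq_continuous_at)
  have L0: "locally_dominated dom_const (\<lambda>x y. kernel x y)"
    using meas cont k0 less_imp_le[OF kernel_pos] by (intro locally_dominated_bounded[where K="1 / m"]) auto
  have L1: "locally_dominated dom_const (\<lambda>x y. - (form y (x - step_mean y) v / \<delta>) * kernel x y)" for v
  proof (rule locally_dominated_bounded[where K="((2 * \<delta> * B v + 1) / m) / \<delta>"])
    fix x y
    show "\<bar>- (form y (x - step_mean y) v / \<delta>) * kernel x y\<bar> \<le> ((2 * \<delta> * B v + 1) / m) / \<delta>"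
      using divide_right_mono[OF lin[of y x v], of \<delta>] \<delta> by (simp add: abs_mult kernel_pos less_imp_le)
  qed (use \<delta> meas fmeas cont fcont in \<open>auto intro!: continuous_intros borel_measurable_times borel_measurable_divide\<close>)
  have L2: "locally_dominated dom_const (\<lambda>x y. (form y (x - step_mean y) v * form y (x - step_mean y) u / \<delta>\<^sup>2 - form y u v / \<delta>) * kernel x y)" for u v
  proof (rule locally_dominated_bounded[where K="(B u + B v) * (\<delta> / m) / \<delta>\<^sup>2 + (B u + B v) / 2 / \<delta> * (1 / m)"])
    fix x y
    have "\<bar>form y (x - step_mean y) v * form y (x - step_mean y) u\<bar> \<le> (r x y * B v + r x y * B u) / 2"
      by (rule order_trans[OF amgm]) (intro divide_right_mono add_mono cs, simp)
    then have 1: "\<bar>form y (x - step_mean y) v * form y (x - step_mean y) u\<bar> * kernel x y \<le> (r x y * B v + r x y * B u) / 2 * kernel x y"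
      by (intro mult_right_mono less_imp_le[OF kernel_pos])
    have "(r x y * B v + r x y * B u) / 2 * kernel x y = (B u + B v) / 2 * (r x y * kernel x y)"
      by (simp add: field_simps)
    also have "\<dots> \<le> (B u + B v) / 2 * (2 * \<delta> / m)"
      using B0 by (intro mult_left_mono k1) (auto intro!: add_nonneg_nonneg)
    also have "\<dots> = (B u + B v) * (\<delta> / m)" by simp
    finally have 2: "\<bar>form y (x - step_mean y) v * form y (x - step_mean y) u\<bar> * kernel x y \<le> (B u + B v) * (\<delta> / m)"
      by (rule order_trans[OF 1])
    have "(form y u v)\<^sup>2 \<le> B u * B v"
      unfolding B_def
      by (rule order_trans[OF form_Cauchy_Schwarz], rule mult_mono[OF form_le form_le _ form_nonneg]) (use B0 in \<open>simp add: B_def\<close>)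
    also have "\<dots> \<le> ((B u + B v) / 2)\<^sup>2"
      using sum_squares_bound[of "B u" "B v"] by (simp add: power2_sum power_divide)
    finally have "\<bar>form y u v\<bar> \<le> \<bar>(B u + B v) / 2\<bar>"
      by (simp only: abs_le_square_iff)
    also have "\<dots> = (B u + B v) / 2" using B0[of u] B0[of v] by (intro abs_of_nonneg) simp
    finally have fle: "\<bar>form y u v\<bar> \<le> (B u + B v) / 2" .
    have 3: "\<bar>form y u v\<bar> / \<delta> * kernel x y \<le> (B u + B v) / 2 / \<delta> * (1 / m)"
    proof (rule mult_mono)
      show "\<bar>form y u v\<bar> / \<delta> \<le> (B u + B v) / 2 / \<delta>"
        using fle \<delta> by (intro divide_right_mono) auto
      show "0 \<le> (B u + B v) / 2 / \<delta>" using \<delta> B0[of u] B0[of v] by simp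
    qed (rule k0, rule less_imp_le[OF kernel_pos])
    have tri: "\<bar>(a / \<delta>\<^sup>2 - b / \<delta>) * kernel x y\<bar> \<le> (\<bar>a\<bar> / \<delta>\<^sup>2 + \<bar>b\<bar> / \<delta>) * kernel x y" for a b
    proof -
      have "\<bar>a / \<delta>\<^sup>2 - b / \<delta>\<bar> \<le> \<bar>a\<bar> / \<delta>\<^sup>2 + \<bar>b\<bar> / \<delta>"
        using abs_triangle_ineq4[of "a / \<delta>\<^sup>2" "b / \<delta>"] \<delta> by (simp add: abs_divide)
      from mult_right_mono[OF this less_imp_le[OF kernel_pos]] show ?thesis
        by (simp add: abs_mult less_imp_le[OF kernel_pos])
    qed
    have "\<bar>(form y (x - step_mean y) v * form y (x - step_mean y) u / \<delta>\<^sup>2 - form y u v / \<delta>) * kernel x y\<bar>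
      \<le> (\<bar>form y (x - step_mean y) v * form y (x - step_mean y) u\<bar> / \<delta>\<^sup>2 + \<bar>form y u v\<bar> / \<delta>) * kernel x y"
      by (rule tri)
    also have "\<dots> = \<bar>form y (x - step_mean y) v * form y (x - step_mean y) u\<bar> * kernel x y / \<delta>\<^sup>2 + \<bar>form y u v\<bar> / \<delta> * kernel x y"
      by (simp add: distrib_right)
    also have "\<dots> \<le> (B u + B v) * (\<delta> / m) / \<delta>\<^sup>2 + (B u + B v) / 2 / \<delta> * (1 / m)"
      by (intro add_mono divide_right_mono 2 3) auto
    finally show "\<bar>(form y (x - step_mean y) v * form y (x - step_mean y) u / \<delta>\<^sup>2 - form y u v / \<delta>) * kernel x y\<bar>
      \<le> (B u + B v) * (\<delta> / m) / \<delta>\<^sup>2 + (B u + B v) / 2 / \<delta> * (1 / m)" .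
  qed (use \<delta> meas fmeas cont fcont in \<open>auto intro!: continuous_intros borel_measurable_times borel_measurable_divide borel_measurable_diff\<close>)
  show ?thesis
    unfolding numeral_2_eq_2 dom_Ck.simps
  proof (intro conjI L0 exI allI)
    show "((\<lambda>x. kernel x y) has_derivative (\<lambda>u. - (form y (x - step_mean y) u / \<delta>) * kernel x y)) (at x)" for x y
      by (rule kernel_has_derivative)
    show "locally_dominated dom_const (\<lambda>x y. - (form y (x - step_mean y) v / \<delta>) * kernel x y)" for v by (rule L1)
    show "((\<lambda>x. - (form y (x - step_mean y) v / \<delta>) * kernel x y) has_derivative
     (\<lambda>u. (form y (x - step_mean y) v * form y (x - step_mean y) u / \<delta>\<^sup>2 - form y u v / \<delta>) * kernel x y)) (at x)" for x y v
      by (rule kernel_has_derivative2)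
    show "locally_dominated dom_const (\<lambda>x y. (form y (x - step_mean y) v * form y (x - step_mean y) u / \<delta>\<^sup>2 - form y u v / \<delta>) * kernel x y)" for u v
      by (rule L2)
  qed
qed

end

section \<open>Gaussian vectors under linear maps\<close>

lemma nn_integral_lborel_translate:
  fixes f :: "'a::euclidean_space \<Rightarrow> ennreal"
  assumes [measurable]: "f \<in> borel_measurable borel"
  shows "(\<integral>\<^sup>+x. f (x + c) \<partial>lborel) = (\<integral>\<^sup>+x. f x \<partial>lborel)"
  by (subst (2) lborel_distr_plus[of c, symmetric], subst nn_integral_distr) (auto simp: add.commute)

text \<open>Uniqueness of Haar measure: the image of Lebesgue measure is again translation invariant.  The
proof inserts the indicator of the unit cube, which has integral one, and exchanges integrals twice.
The factor \<open>k\<close> is identified later, from the constant function.\<close>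

lemma nn_integral_linear_bij:
  fixes T :: "'a::euclidean_space \<Rightarrow> 'a"
  assumes T: "linear T" and T': "\<And>x. T (T' x) = x"
  shows "\<exists>k. \<forall>f\<in>borel_measurable borel. (\<integral>\<^sup>+z. f (T z) \<partial>lborel) = k * (\<integral>\<^sup>+x. f x \<partial>lborel)"
proof -
  let ?B = "indicator (cbox 0 One) :: 'a \<Rightarrow> ennreal"
  have "(\<integral>\<^sup>+z. f (T z) \<partial>lborel) = (\<integral>\<^sup>+z. ?B (- T z) \<partial>lborel) * (\<integral>\<^sup>+x. f x \<partial>lborel)"
    if [measurable]: "f \<in> borel_measurable borel" for f :: "'a \<Rightarrow> ennreal"
  proof -
  have [measurable]: "T \<in> borel_measurable borel"
    using T by (intro borel_measurable_continuous_onI linear_continuous_on) (simp add: linear_conv_bounded_linear)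
  have B: "(\<integral>\<^sup>+x. ?B x \<partial>lborel) = 1" by simp
  have "(\<integral>\<^sup>+z. f (T z) \<partial>lborel) = (\<integral>\<^sup>+z. f (T z) * (\<integral>\<^sup>+x. ?B (x + - T z) \<partial>lborel) \<partial>lborel)"
    by (subst nn_integral_lborel_translate) (simp_all only: B, simp_all)
  also have "\<dots> = (\<integral>\<^sup>+z. \<integral>\<^sup>+x. f (T z) * ?B (x + - T z) \<partial>lborel \<partial>lborel)"
    by (intro nn_integral_cong nn_integral_cmult[symmetric]) measurable
  also have "\<dots> = (\<integral>\<^sup>+x. \<integral>\<^sup>+z. f (T z) * ?B (x + - T z) \<partial>lborel \<partial>lborel)"
    by (rule lborel_pair.Fubini') measurable
  also have "\<dots> = (\<integral>\<^sup>+x. \<integral>\<^sup>+z. f (x + T z) * ?B (- T z) \<partial>lborel \<partial>lborel)"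
  proof (rule nn_integral_cong)
    fix x
    have "(\<integral>\<^sup>+z. f (T z) * ?B (x + - T z) \<partial>lborel) = (\<integral>\<^sup>+z. f (T (z + T' x)) * ?B (x + - T (z + T' x)) \<partial>lborel)"
      by (rule nn_integral_lborel_translate[symmetric]) measurable
    also have "\<dots> = (\<integral>\<^sup>+z. f (x + T z) * ?B (- T z) \<partial>lborel)"
      by (simp add: linear_add[OF T] T' add.commute)
    finally show "(\<integral>\<^sup>+z. f (T z) * ?B (x + - T z) \<partial>lborel) = (\<integral>\<^sup>+z. f (x + T z) * ?B (- T z) \<partial>lborel)" .
  qed
  also have "\<dots> = (\<integral>\<^sup>+z. \<integral>\<^sup>+x. f (x + T z) * ?B (- T z) \<partial>lborel \<partial>lborel)"
    by (rule lborel_pair.Fubini') measurable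
  also have "\<dots> = (\<integral>\<^sup>+z. (\<integral>\<^sup>+x. f x \<partial>lborel) * ?B (- T z) \<partial>lborel)"
    by (intro nn_integral_cong, subst nn_integral_multc) (simp_all add: nn_integral_lborel_translate)
  also have "\<dots> = (\<integral>\<^sup>+z. ?B (- T z) \<partial>lborel) * (\<integral>\<^sup>+x. f x \<partial>lborel)"
    by (subst nn_integral_cmult) (simp_all add: mult.commute)
  finally show ?thesis .
  qed
  then show ?thesis by blast
qed

lemma nn_integral_lborel_product:
  fixes f :: "'a::euclidean_space \<Rightarrow> ennreal" and g :: "'b::euclidean_space \<Rightarrow> ennreal"
  assumes [measurable]: "f \<in> borel_measurable borel" "g \<in> borel_measurable borel"
  shows "(\<integral>\<^sup>+z. f (fst z) * g (snd z) \<partial>lborel) = (\<integral>\<^sup>+x. f x \<partial>lborel) * (\<integral>\<^sup>+y. g y \<partial>lborel)"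
proof -
  have "(\<integral>\<^sup>+z. f (fst z) * g (snd z) \<partial>lborel) = (\<integral>\<^sup>+x. \<integral>\<^sup>+y. f x * g y \<partial>lborel \<partial>lborel)"
    unfolding lborel_prod[symmetric]
    by (subst lborel.nn_integral_fst[of "\<lambda>z. f (fst z) * g (snd z)" lborel, symmetric]) auto
  also have "\<dots> = (\<integral>\<^sup>+x. f x * (\<integral>\<^sup>+y. g y \<partial>lborel) \<partial>lborel)"
    by (intro nn_integral_cong nn_integral_cmult) simp
  finally show ?thesis by (simp add: nn_integral_multc)
qed

context elliptic_step
begin

text \<open>A linear involution of \<open>\<real>\<^sup>m \<times> \<real>\<^sup>d\<close> that exchanges the component of \<open>w\<close> in the range of
\<open>transpose S\<close>, which is what \<open>S w\<close> sees, with the auxiliary variable.  It preserves the quadratic form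
\<open>|w|\<^sup>2 + \<langle>x, \<Lambda>\<^sup>-\<^sup>1 x\<rangle>\<close> and has \<open>S w\<close> as its second component; so it turns the law of \<open>S w\<close> into one with a
Gaussian density.\<close>

definition flip :: "real^'d \<Rightarrow> (real^'m) \<times> (real^'d) \<Rightarrow> (real^'m) \<times> (real^'d)" where
  "flip y z = (fst z - transpose (S y) *v (matrix_inv (Lam y) *v (S y *v fst z - snd z)), S y *v fst z)"

lemma linear_flip: "linear (flip y)"
  by (rule linearI) (simp_all add: flip_def matrix_vector_right_distrib matrix_vector_mult_diff_distrib
      matrix_vector_mult_scaleR algebra_simps)

lemma S_transpose_inv: "S y *v (transpose (S y) *v (matrix_inv (Lam y) *v v)) = v"
  using Lam_matrix_inv[of y v] by (simp add: Lam_def matrix_vector_mul_assoc matrix_mul_assoc)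

lemma flip_flip: "flip y (flip y z) = z"
  by (simp add: flip_def matrix_vector_mult_diff_distrib S_transpose_inv del: transpose_matrix_vector)

lemma flip_isometry:
  "(norm (fst (flip y z)))\<^sup>2 + form y (snd (flip y z)) (snd (flip y z)) = (norm (fst z))\<^sup>2 + form y (snd z) (snd z)"
proof -
  let ?s = "S y *v fst z"
  have 1: "fst z \<bullet> (transpose (S y) *v (matrix_inv (Lam y) *v v)) = form y ?s v" for v
    unfolding form_def by (metis dot_lmul_matrix transpose_matrix_vector transpose_transpose inner_commute)
  have 2: "(norm (transpose (S y) *v (matrix_inv (Lam y) *v v)))\<^sup>2 = form y v v" for v
    by (simp add: form_eq power2_norm_eq_inner)
  have "(norm (fst (flip y z)))\<^sup>2 = (norm (fst z))\<^sup>2 + form y (?s - snd z) (?s - snd z) - 2 * form y ?s (?s - snd z)"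
    unfolding flip_def fst_conv 1[symmetric] 2[symmetric] 
    by (simp add: power2_norm_eq_inner inner_diff_left inner_diff_right inner_commute)
  then show ?thesis
    by (simp add: flip_def form_diff form_sym[of y "snd z" ?s])
qed

text \<open>Integrate against the product of the two Gaussian weights, in \<open>w\<close> and in an auxiliary variable of
dimension \<open>d\<close>, and substitute \<open>flip\<close>.  The auxiliary integral is \<open>mass y\<close>.\<close>

lemma Gaussian_pushforward:
  assumes [measurable]: "\<phi> \<in> borel_measurable borel"
    and c: "c * (\<integral>\<^sup>+w. ennreal (exp (- (1 / (2 * \<delta>)) * (norm (w::real^'m))\<^sup>2)) \<partial>lborel) = 1"
  shows "(\<integral>\<^sup>+w. \<phi> (step_mean y + S y *v w) * (c * ennreal (exp (- (1 / (2 * \<delta>)) * (norm w)\<^sup>2))) \<partial>lborel)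
    = (\<integral>\<^sup>+x. \<phi> x * ennreal (kernel x y) \<partial>lborel)"
proof -
  let ?g = "\<lambda>w::real^'m. ennreal (exp (- (1 / (2 * \<delta>)) * (norm w)\<^sup>2))"
  let ?q = "\<lambda>x. ennreal (weight (x + step_mean y) y)"
  have [measurable]: "(\<lambda>x. weight x y) \<in> borel_measurable borel"
    using weight_continuous1 by (rule borel_measurable_continuous_onI)
  have [measurable]: "(\<lambda>w. S y *v w) \<in> borel_measurable borel"
    by (intro borel_measurable_continuous_onI linear_continuous_on matrix_vector_mul_bounded_linear)
  obtain k where k: "\<And>f. f \<in> borel_measurable borel \<Longrightarrow> (\<integral>\<^sup>+z. f (flip y z) \<partial>lborel) = k * (\<integral>\<^sup>+x. f x \<partial>lborel)"
    using nn_integral_linear_bij[OF linear_flip flip_flip] by blast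
  define G where "G = (\<integral>\<^sup>+w. ?g w \<partial>lborel)"
  define Z where "Z = (\<integral>\<^sup>+x. ?q x \<partial>lborel)"
  have Z: "Z = ennreal (mass y)"
    unfolding Z_def mass_def
    by (subst nn_integral_lborel_translate, measurable, rule nn_integral_eq_integral)
      (auto simp: weight_integrable less_imp_le[OF weight_pos])
  have *: "(\<integral>\<^sup>+w. \<psi> (S y *v w) * ?g w \<partial>lborel) * Z = k * (G * (\<integral>\<^sup>+x. \<psi> x * ?q x \<partial>lborel))"
    if [measurable]: "\<psi> \<in> borel_measurable borel" for \<psi>
  proof -
    have "(\<integral>\<^sup>+w. \<psi> (S y *v w) * ?g w \<partial>lborel) * Z = (\<integral>\<^sup>+z. (\<psi> (S y *v fst z) * ?g (fst z)) * ?q (snd z) \<partial>lborel)"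
      unfolding Z_def by (rule nn_integral_lborel_product[symmetric]) measurable
    also have "\<dots> = (\<integral>\<^sup>+z. ?g (fst (flip y z)) * (\<psi> (snd (flip y z)) * ?q (snd (flip y z))) \<partial>lborel)"
    proof (intro nn_integral_cong)
      fix z :: "(real^'m) \<times> (real^'d)"
      have "?g w * ?q x = ennreal (exp (- (1 / (2 * \<delta>)) * ((norm w)\<^sup>2 + form y x x)))" for w x
        by (simp add: weight_def ennreal_mult'[symmetric] exp_add[symmetric] add_divide_distrib)
      then have iso: "?g (fst z) * ?q (snd z) = ?g (fst (flip y z)) * ?q (snd (flip y z))"
        by (simp only: flip_isometry)
      have "(\<psi> (S y *v fst z) * ?g (fst z)) * ?q (snd z) = \<psi> (snd (flip y z)) * (?g (fst z) * ?q (snd z))"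
        by (simp add: flip_def mult.assoc)
      also have "\<dots> = ?g (fst (flip y z)) * (\<psi> (snd (flip y z)) * ?q (snd (flip y z)))"
        unfolding iso by (rule mult.left_commute)
      finally show "(\<psi> (S y *v fst z) * ?g (fst z)) * ?q (snd z)
          = ?g (fst (flip y z)) * (\<psi> (snd (flip y z)) * ?q (snd (flip y z)))" .
    qed
    also have "\<dots> = k * (\<integral>\<^sup>+z. ?g (fst z) * (\<psi> (snd z) * ?q (snd z)) \<partial>lborel)"
      by (rule k, subst borel_prod[symmetric]) measurable
    also have "(\<integral>\<^sup>+z. ?g (fst z) * (\<psi> (snd z) * ?q (snd z)) \<partial>lborel) = G * (\<integral>\<^sup>+x. \<psi> x * ?q x \<partial>lborel)"
      unfolding G_def by (rule nn_integral_lborel_product) measurable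
    finally show ?thesis .
  qed
  have G: "c * G = 1" using c by (simp add: G_def)
  \<comment> \<open>the constant function determines the factor \<open>k\<close>\<close>
  have "G * Z = k * (G * Z)" using *[of "\<lambda>_. 1"] by (simp add: G_def Z_def)
  then have "(c * G) * Z = k * ((c * G) * Z)" by (metis mult.assoc mult.left_commute)
  then have "Z = k * Z" by (simp add: G)
  then have "Z / Z = k * Z / Z" by simp
  then have k1: "k = 1" using mass_pos[of y] by (simp add: Z mult_divide_eq_ennreal ennreal_divide_self)
  let ?\<psi> = "\<lambda>x. \<phi> (step_mean y + x)"
  have "(\<integral>\<^sup>+w. \<phi> (step_mean y + S y *v w) * (c * ?g w) \<partial>lborel) = c * (\<integral>\<^sup>+w. ?\<psi> (S y *v w) * ?g w \<partial>lborel)"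
    by (subst nn_integral_cmult[symmetric]) (auto simp: mult_ac)
  also have "\<dots> = c * (\<integral>\<^sup>+w. ?\<psi> (S y *v w) * ?g w \<partial>lborel) * (Z / Z)"
    using mass_pos[of y] by (simp add: Z ennreal_divide_self)
  also have "\<dots> = (c * G) * (\<integral>\<^sup>+x. ?\<psi> x * ?q x \<partial>lborel) / Z"
    using *[of ?\<psi>] by (simp add: k1 ennreal_times_divide mult.assoc)
  also have "\<dots> = (\<integral>\<^sup>+x. ?\<psi> x * ?q x \<partial>lborel) / Z" by (simp add: G)
  also have "(\<integral>\<^sup>+x. ?\<psi> x * ?q x \<partial>lborel) = (\<integral>\<^sup>+x. \<phi> x * ennreal (weight x y) \<partial>lborel)"
    by (subst nn_integral_lborel_translate[of "\<lambda>x. \<phi> x * ennreal (weight x y)" "step_mean y", symmetric]) (auto simp: add.commute)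
  also have "\<dots> / Z = (\<integral>\<^sup>+x. \<phi> x * ennreal (weight x y) / Z \<partial>lborel)"
    by (rule nn_integral_divide[symmetric]) measurable
  also have "\<dots> = (\<integral>\<^sup>+x. \<phi> x * ennreal (kernel x y) \<partial>lborel)"
    using mass_pos[of y] unfolding Z kernel_def
    by (intro nn_integral_cong) (simp add: ennreal_times_divide[symmetric] divide_ennreal less_imp_le[OF weight_pos] divide_inverse)
  finally show ?thesis .
qed

end

section \<open>Composition of smooth kernels\<close>

text \<open>The last clause of \<open>smooth_density\<close> is about derivatives in the starting point \<open>y\<close>, with dominating
functions that are integrable over the end point \<open>x\<close>.  A \<open>smooth_kernel\<close> has in addition derivatives
in the end point that are bounded uniformly in the starting point.\<close>

definition smooth_density :: "(real^'d::finite \<Rightarrow> real^'d \<Rightarrow> real) \<Rightarrow> bool" where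
  "smooth_density p \<longleftrightarrow> (\<forall>x y. 0 < p x y) \<and> Ck_on 2 UNIV (\<lambda>(x, y). p x y) \<and>
     dom_Ck (integrable lborel) 2 (\<lambda>y x. p x y)"

definition smooth_kernel :: "(real^'d::finite \<Rightarrow> real^'d \<Rightarrow> real) \<Rightarrow> bool" where
  "smooth_kernel g \<longleftrightarrow> smooth_density g \<and> dom_Ck dom_const 2 g \<and> (\<forall>y. (\<integral>x. g x y \<partial>lborel) = 1)"

definition chain :: "(real^'d::finite \<Rightarrow> real^'d \<Rightarrow> real) \<Rightarrow> (real^'d \<Rightarrow> real^'d \<Rightarrow> real) \<Rightarrow> real^'d \<Rightarrow> real^'d \<Rightarrow> real" where
  "chain g p x y = (\<integral>u. g x u * p u y \<partial>lborel)"

lemma (in elliptic_step) smooth_kernel_kernel: "smooth_kernel kernel"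
  unfolding smooth_kernel_def smooth_density_def
proof (intro conjI allI)
  show "dom_Ck (integrable lborel) 2 (\<lambda>y x. kernel x y)"
    by (rule dom_Ck_mono[OF dom_gauss_integrable dom_Ck_gauss_kernel])
qed (rule kernel_pos Ck_on_kernel dom_Ck_const_kernel kernel_integral)+

lemma smooth_kernel_bounded:
  assumes "smooth_kernel g"
  obtains K where "\<And>u. \<bar>g x u\<bar> \<le> K"
proof -
  have "locally_dominated dom_const g"
    using assms dom_Ck_locally_dominated unfolding smooth_kernel_def by blast
  then obtain e H where "e > 0" "dom_const H" "\<forall>w\<in>ball x e. \<forall>z. \<bar>g w z\<bar> \<le> H z"
    unfolding locally_dominated_def by meson
  then show thesis using that unfolding dom_const_def by (metis centre_in_ball)
qed

lemma smooth_densityD: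
  assumes "smooth_density p"
  shows "0 < p x y" "continuous_on UNIV (\<lambda>(x, y). p x y)" "integrable lborel (\<lambda>x. p x y)"
    "(\<lambda>(x, y). p x y) \<in> borel_measurable borel"
    "(\<lambda>(x, y). p x y) \<in> borel_measurable (borel \<Otimes>\<^sub>M borel)"
proof -
  show "0 < p x y" using assms by (simp add: smooth_density_def)
  show c: "continuous_on UNIV (\<lambda>(x, y). p x y)" using assms Ck_on_continuous unfolding smooth_density_def by blast
  show "(\<lambda>(x, y). p x y) \<in> borel_measurable borel" using c by (rule borel_measurable_continuous_onI)
  then show "(\<lambda>(x, y). p x y) \<in> borel_measurable (borel \<Otimes>\<^sub>M borel)" by (simp add: borel_prod)
  have "locally_dominated (integrable lborel) (\<lambda>y x. p x y)"
    using assms dom_Ck_locally_dominated unfolding smooth_density_def by blast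
  then show "integrable lborel (\<lambda>x. p x y)"
    using continuous_integral_locally_dominated(1)[of lborel "\<lambda>y x. p x y"] by simp
qed

text \<open>Averaging over one more step keeps the domination: the new dominating function is the average of the old
one, and it is integrable because the kernel has mass one in its end point.\<close>

lemma locally_dominated_average:
  fixes g :: "real^'d::finite \<Rightarrow> real^'d \<Rightarrow> real"
  assumes g: "smooth_kernel g" and f: "locally_dominated (integrable lborel) f"
  shows "locally_dominated (integrable lborel) (\<lambda>y u. g x u * f y u)"
    and "locally_dominated (integrable lborel) (\<lambda>y x. \<integral>u. g x u * f y u \<partial>lborel)"
proof -
  have gd: "smooth_density g" using g by (simp add: smooth_kernel_def)
  note g_nn = less_imp_le[OF smooth_densityD(1)[OF gd]]
  have gm[measurable]: "(\<lambda>(x, u). g x u) \<in> borel_measurable (borel \<Otimes>\<^sub>M borel)" by (rule smooth_densityD(5)[OF gd])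
  have fm[measurable]: "f y \<in> borel_measurable borel" for y using f by (simp add: locally_dominated_def)
  have *: "locally_dominated (integrable lborel) (\<lambda>y u. g x u * f y u)" for x
    unfolding locally_dominated_def
  proof (intro conjI allI)
    show "(\<lambda>u. g x u * f y u) \<in> borel_measurable borel" for y by measurable
    show "continuous_on UNIV (\<lambda>y. g x u * f y u)" for u
      using f by (auto simp: locally_dominated_def intro!: continuous_on_mult continuous_on_const)
    fix y0
    obtain e H where e: "e > 0" "integrable lborel H" "\<forall>y\<in>ball y0 e. \<forall>u. \<bar>f y u\<bar> \<le> H u"
      using f unfolding locally_dominated_def by meson
    obtain K where K: "\<And>u. \<bar>g x u\<bar> \<le> K"
      using smooth_kernel_bounded[OF g, of x] by blast
    have "\<bar>g x u * f y u\<bar> \<le> K * \<bar>H u\<bar>" if "y \<in> ball y0 e" for y u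
      unfolding abs_mult using e(3) that K[of u] by (intro mult_mono) (auto intro: order_trans[OF _ abs_ge_self])
    then show "\<exists>e>0. \<exists>H. integrable lborel H \<and> (\<forall>y\<in>ball y0 e. \<forall>u. \<bar>g x u * f y u\<bar> \<le> H u)"
      using e(1,2) by (intro exI[of _ e] conjI exI[of _ "\<lambda>u. K * \<bar>H u\<bar>"]) auto
  qed
  then show "locally_dominated (integrable lborel) (\<lambda>y u. g x u * f y u)" .
  note int = continuous_integral_locally_dominated[OF sets_lborel *]
  show "locally_dominated (integrable lborel) (\<lambda>y x. \<integral>u. g x u * f y u \<partial>lborel)"
    unfolding locally_dominated_def
  proof (intro conjI allI)
    show "(\<lambda>x. \<integral>u. g x u * f y u \<partial>lborel) \<in> borel_measurable borel" for y by measurable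
    show "continuous_on UNIV (\<lambda>y. \<integral>u. g x u * f y u \<partial>lborel)" for x by (rule int(2))
    fix y0
    obtain e H where e: "e > 0" "integrable lborel H" "\<forall>y\<in>ball y0 e. \<forall>u. \<bar>f y u\<bar> \<le> H u"
      using f unfolding locally_dominated_def by meson
    have [measurable]: "H \<in> borel_measurable borel" using e(2) by auto
    have pair: "integrable (lborel \<Otimes>\<^sub>M lborel) (\<lambda>(x, u). g x u * \<bar>H u\<bar>)"
    proof (rule integrableI_bounded)
      have "(\<integral>\<^sup>+z. ennreal (norm (case z of (x, u) \<Rightarrow> g x u * \<bar>H u\<bar>)) \<partial>(lborel \<Otimes>\<^sub>M lborel))
          = (\<integral>\<^sup>+u. \<integral>\<^sup>+x. ennreal (g x u) * ennreal \<bar>H u\<bar> \<partial>lborel \<partial>lborel)"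
        by (subst lborel_pair.nn_integral_snd[symmetric]) (auto simp: abs_mult g_nn ennreal_mult)
      also have "\<dots> = (\<integral>\<^sup>+u. ennreal \<bar>H u\<bar> \<partial>lborel)"
      proof (intro nn_integral_cong)
        fix u
        have "(\<integral>\<^sup>+x. ennreal (g x u) \<partial>lborel) = 1"
          using g smooth_densityD(3)[OF gd] by (subst nn_integral_eq_integral) (auto simp: g_nn smooth_kernel_def)
        then show "(\<integral>\<^sup>+x. ennreal (g x u) * ennreal \<bar>H u\<bar> \<partial>lborel) = ennreal \<bar>H u\<bar>"
          by (subst nn_integral_multc) auto
      qed
      also have "\<dots> < \<infinity>" using e(2) by (simp add: integrable_iff_bounded)
      finally show "(\<integral>\<^sup>+z. ennreal (norm (case z of (x, u) \<Rightarrow> g x u * \<bar>H u\<bar>)) \<partial>(lborel \<Otimes>\<^sub>M lborel)) < \<infinity>" .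
    qed measurable
    have "\<bar>\<integral>u. g x u * f y u \<partial>lborel\<bar> \<le> (\<integral>u. g x u * \<bar>H u\<bar> \<partial>lborel)" if y: "y \<in> ball y0 e" for y x
    proof -
      obtain K where K: "\<And>u. \<bar>g x u\<bar> \<le> K"
        using smooth_kernel_bounded[OF g, of x] by blast
      have gH: "integrable lborel (\<lambda>u. g x u * \<bar>H u\<bar>)"
      proof (rule Bochner_Integration.integrable_bound[of _ "\<lambda>u. K * \<bar>H u\<bar>"])
        show "AE u in lborel. norm (g x u * \<bar>H u\<bar>) \<le> norm (K * \<bar>H u\<bar>)"
        proof (rule AE_I2)
          fix u
          have "\<bar>g x u\<bar> \<le> \<bar>K\<bar>" using K[of u] by simp
          then show "norm (g x u * \<bar>H u\<bar>) \<le> norm (K * \<bar>H u\<bar>)" by (simp add: abs_mult mult_right_mono)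
        qed
      qed (use e(2) in auto)
      have "\<bar>\<integral>u. g x u * f y u \<partial>lborel\<bar> \<le> (\<integral>u. \<bar>g x u * f y u\<bar> \<partial>lborel)"
        by (rule integral_abs_bound)
      also have "\<dots> \<le> (\<integral>u. g x u * \<bar>H u\<bar> \<partial>lborel)"
      proof (rule integral_mono)
        show "\<bar>g x u * f y u\<bar> \<le> g x u * \<bar>H u\<bar>" for u
          using e(3) y g_nn[of x u] by (auto simp: abs_mult intro!: mult_left_mono intro: order_trans[OF _ abs_ge_self])
      qed (use int(1) gH in auto)
      finally show ?thesis .
    qed
    moreover have "integrable lborel (\<lambda>x. \<integral>u. g x u * \<bar>H u\<bar> \<partial>lborel)"
      using lborel_pair.integrable_fst'[OF pair] by simp
    ultimately show "\<exists>e>0. \<exists>H. integrable lborel H \<and> (\<forall>y\<in>ball y0 e. \<forall>x. \<bar>\<integral>u. g x u * f y u \<partial>lborel\<bar> \<le> H x)"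
      using e(1) by blast
  qed
qed

lemma dom_Ck_average:
  fixes g :: "real^'d::finite \<Rightarrow> real^'d \<Rightarrow> real"
  assumes g: "smooth_kernel g"
  shows "dom_Ck (integrable lborel) k f \<Longrightarrow> dom_Ck (integrable lborel) k (\<lambda>y x. \<integral>u. g x u * f y u \<partial>lborel)"
proof (induction k arbitrary: f)
  case 0
  then show ?case using locally_dominated_average(2)[OF g] by simp
next
  case (Suc k)
  from Suc.prems obtain f' where
    f: "locally_dominated (integrable lborel) f" and
    f': "\<And>w z. ((\<lambda>w. f w z) has_derivative f' w z) (at w)" "\<And>v. dom_Ck (integrable lborel) k (\<lambda>w z. f' w z v)"
    by auto
  have "((\<lambda>y. \<integral>u. g x u * f y u \<partial>lborel) has_derivative (\<lambda>v. \<integral>u. g x u * f' y u v \<partial>lborel)) (at y)" for x y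
    by (rule has_derivative_integral_locally_dominated[OF sets_lborel locally_dominated_average(1)[OF g f]])
      (auto intro!: has_derivative_mult_right f' locally_dominated_average(1)[OF g] dom_Ck_locally_dominated[OF f'(2)])
  with Suc.IH[OF f'(2)] locally_dominated_average(2)[OF g f] show ?case
    by (simp, intro exI[of _ "\<lambda>y x v. \<integral>u. g x u * f' y u v \<partial>lborel"]) simp
qed

lemma chain_integrable:
  assumes g: "smooth_kernel g" and p: "smooth_density p"
  shows "integrable lborel (\<lambda>u. g x u * p u y)"
proof -
  have "locally_dominated (integrable lborel) (\<lambda>y u. g x u * p u y)"
    using p dom_Ck_locally_dominated unfolding smooth_density_def
    by (intro locally_dominated_average(1)[OF g]) blast
  from continuous_integral_locally_dominated(1)[OF sets_lborel this] show ?thesis .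
qed

text \<open>Derivatives in the end point act on the last kernel \<open>g\<close>, those in the starting point on \<open>p\<close>.\<close>

lemma smooth_density_chain:
  assumes g: "smooth_kernel g" and p: "smooth_density p"
  shows "smooth_density (chain g p)"
  unfolding smooth_density_def
proof (intro conjI allI)
  have gd: "smooth_density g" using g by (simp add: smooth_kernel_def)
  show "0 < chain g p x y" for x y
    unfolding chain_def
    by (intro integral_lborel_pos chain_integrable[OF g p] mult_pos_pos smooth_densityD(1) gd p)
  have "dom_Ck (integrable lborel) 2 (\<lambda>(x, y) u. g x u * p u y)"
    using g p by (intro dom_Ck_integrable_cmult) (auto simp: smooth_kernel_def smooth_density_def)
  from Ck_on_integral[OF sets_lborel this] show "Ck_on 2 UNIV (\<lambda>(x, y). chain g p x y)"
    by (simp add: chain_def case_prod_unfold)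
  show "dom_Ck (integrable lborel) 2 (\<lambda>y x. chain g p x y)"
    unfolding chain_def using p by (intro dom_Ck_average[OF g]) (simp add: smooth_density_def)
qed

lemma nn_integral_chain:
  assumes g: "smooth_kernel g" and p: "smooth_density p"
  shows "ennreal (chain g p x y) = (\<integral>\<^sup>+u. ennreal (g x u) * ennreal (p u y) \<partial>lborel)"
proof -
  have gd: "smooth_density g" using g by (simp add: smooth_kernel_def)
  show ?thesis
    unfolding chain_def
  proof (subst nn_integral_eq_integral[OF chain_integrable[OF g p], symmetric])
    show "AE u in lborel. 0 \<le> g x u * p u y"
      using less_imp_le[OF smooth_densityD(1)[OF gd]] less_imp_le[OF smooth_densityD(1)[OF p]] by simp
    show "(\<integral>\<^sup>+u. ennreal (g x u * p u y) \<partial>lborel) = (\<integral>\<^sup>+u. ennreal (g x u) * ennreal (p u y) \<partial>lborel)"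
      by (intro nn_integral_cong ennreal_mult less_imp_le[OF smooth_densityD(1)[OF gd]] less_imp_le[OF smooth_densityD(1)[OF p]])
  qed
qed

lemma Ck_on_average:
  assumes g: "smooth_kernel g" and \<mu>: "finite_measure \<mu>" "sets \<mu> = sets borel"
  shows "Ck_on 2 UNIV (\<lambda>x. \<integral>u. g x u \<partial>\<mu>)" "integrable \<mu> (g x)"
proof -
  interpret finite_measure \<mu> by fact
  have d: "dom_Ck (integrable \<mu>) 2 g"
    by (rule dom_Ck_mono[of dom_const]) (use g in \<open>auto simp: smooth_kernel_def dom_const_def\<close>)
  then show "Ck_on 2 UNIV (\<lambda>x. \<integral>u. g x u \<partial>\<mu>)" by (rule Ck_on_integral[OF \<mu>(2)])
  show "integrable \<mu> (g x)"
    by (rule continuous_integral_locally_dominated(1)[OF \<mu>(2) dom_Ck_locally_dominated[OF d]])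
qed

section \<open>Derivatives of marginals along the diagonal\<close>

text \<open>The positive and the negative part of \<open>g\<close> are densities of finite measures that agree on all half-lines.\<close>

lemma AE_zero_if_tail_integrals_zero:
  fixes g :: "real \<Rightarrow> real"
  assumes g: "integrable lborel g" and zero: "\<And>a. (\<integral>r. indicator {a<..} r * g r \<partial>lborel) = 0"
  shows "AE r in lborel. g r = 0"
proof -
  have [measurable]: "g \<in> borel_measurable borel" using g by auto
  let ?p = "\<lambda>r. ennreal (g r)" and ?n = "\<lambda>r. ennreal (- g r)"
  have fin: "(\<integral>\<^sup>+r. ?p r \<partial>lborel) \<noteq> \<infinity>"
    using g by (simp add: real_integrable_def)
  have em: "emeasure (density lborel ?p) {a<..} = ennreal (\<integral>r. indicator {a<..} r * max 0 (g r) \<partial>lborel)"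
      "emeasure (density lborel ?n) {a<..} = ennreal (\<integral>r. indicator {a<..} r * max 0 (- g r) \<partial>lborel)" for a
  proof -
    have i: "integrable lborel (\<lambda>r. indicator {a<..} r * max 0 (g r))" "integrable lborel (\<lambda>r. indicator {a<..} r * max 0 (- g r))"
      using g by (auto intro!: integrable_real_mult_indicator simp: mult.commute[of "indicator _ _"])
    show "emeasure (density lborel ?p) {a<..} = ennreal (\<integral>r. indicator {a<..} r * max 0 (g r) \<partial>lborel)"
      by (subst nn_integral_eq_integral[OF i(1), symmetric])
        (auto simp: emeasure_density max_def ennreal_neg intro!: nn_integral_cong split: split_indicator)
    show "emeasure (density lborel ?n) {a<..} = ennreal (\<integral>r. indicator {a<..} r * max 0 (- g r) \<partial>lborel)"
      by (subst nn_integral_eq_integral[OF i(2), symmetric])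
        (auto simp: emeasure_density max_def ennreal_neg intro!: nn_integral_cong split: split_indicator)
  qed
  have eq: "(\<integral>r. indicator {a<..} r * max 0 (g r) \<partial>lborel) = (\<integral>r. indicator {a<..} r * max 0 (- g r) \<partial>lborel)" for a
  proof -
    have i: "integrable lborel (\<lambda>r. indicator {a<..} r * max 0 (g r))" "integrable lborel (\<lambda>r. indicator {a<..} r * max 0 (- g r))"
      using g by (auto intro!: integrable_real_mult_indicator simp: mult.commute[of "indicator _ _"])
    have "(\<integral>r. indicator {a<..} r * max 0 (g r) \<partial>lborel) - (\<integral>r. indicator {a<..} r * max 0 (- g r) \<partial>lborel)
        = (\<integral>r. indicator {a<..} r * g r \<partial>lborel)"
      by (subst Bochner_Integration.integral_diff[OF i, symmetric])
        (auto intro!: Bochner_Integration.integral_cong simp: max_def split: split_indicator)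
    then show ?thesis using zero[of a] by simp
  qed
  have "density lborel ?p = density lborel ?n"
    by (rule measure_eqI_lessThan) (auto simp: em eq)
  then have "AE r in lborel. ?p r = ?n r"
    using fin by (subst (asm) finite_density_unique) auto
  then show ?thesis
  proof eventually_elim
    case (elim r)
    then show ?case by (cases "g r \<ge> 0") (auto simp: ennreal_neg)
  qed
qed

text \<open>Rational end points suffice, since the indefinite integral is continuous.  This form is convenient
when the hypothesis holds outside a null set that depends on the end point.\<close>

lemma AE_zero_if_initial_integrals_zero:
  fixes f :: "real \<Rightarrow> real"
  assumes f: "set_integrable lborel {0..1} f"
    and zero: "\<And>s. s \<in> {0..1} \<Longrightarrow> s \<in> \<rat> \<Longrightarrow> (LINT r:{0..s}|lborel. f r) = 0"
  shows "AE r in lborel. r \<in> {0..1} \<longrightarrow> f r = 0"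
proof -
  have sub: "set_integrable lborel {0..s} f" if "s \<in> {0..1}" for s
    using that by (intro set_integrable_subset[OF f]) auto
  have io: "f integrable_on {0..1}" using set_borel_integral_eq_integral(1)[OF f] .
  define h where "h s = integral {0..s} f" for s
  have "continuous_on {0..1} h"
    unfolding h_def by (rule indefinite_integral_continuous_1[OF io])
  then have closed: "closed {s\<in>{0..1}. h s = 0}" by (intro continuous_closed_preimage_constant) auto
  have rat: "h s = 0" if "s \<in> {0..1}" "s \<in> \<rat>" for s
    using zero[OF that] set_borel_integral_eq_integral(2)[OF sub[OF that(1)]] by (simp add: h_def)
  have h0: "h s = 0" if s: "s \<in> {0..1}" for s
  proof (rule ccontr)
    assume n: "h s \<noteq> 0"
    then have "s \<noteq> 1" using rat[of 1] by auto
    then have "s < 1" using s by auto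
    have "open (- {s\<in>{0..1}. h s = 0})" using closed by (simp add: open_Compl)
    moreover have "s \<in> - {s\<in>{0..1}. h s = 0}" using n by simp
    ultimately obtain e where e: "e > 0" "ball s e \<subseteq> - {s\<in>{0..1}. h s = 0}"
      unfolding open_contains_ball by blast
    obtain q where q: "q \<in> \<rat>" "s < q" "q < min 1 (s + e)"
      using Rats_dense_in_real[of s "min 1 (s + e)"] e(1) \<open>s < 1\<close> by auto
    then have "q \<in> ball s e" "q \<in> {0..1}" using s by (auto simp: dist_real_def)
    with e(2) rat[of q] q(1) show False by auto
  qed
  have int: "(LINT r:{0..s}|lborel. f r) = 0" if "s \<in> {0..1}" for s
    using h0[OF that] set_borel_integral_eq_integral(2)[OF sub[OF that]] by (simp add: h_def)
  have f': "integrable lborel (\<lambda>r. indicator {0..1} r * f r)"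
    using f by (simp add: set_integrable_def)
  have "AE r in lborel. indicator {0..1} r * f r = 0"
  proof (rule AE_zero_if_tail_integrals_zero[OF f'])
    fix a :: real
    consider "a < 0" | "a \<in> {0..1}" | "a > 1" by force
    then show "(\<integral>r. indicator {a<..} r * (indicator {0..1} r * f r) \<partial>lborel) = 0"
    proof cases
      case 1
      then have "(\<integral>r. indicator {a<..} r * (indicator {0..1} r * f r) \<partial>lborel) = (LINT r:{0..1}|lborel. f r)"
        unfolding set_lebesgue_integral_def by (intro Bochner_Integration.integral_cong) (auto split: split_indicator)
      then show ?thesis using int[of 1] by simp
    next
      case 2
      have "(\<integral>r. indicator {a<..} r * (indicator {0..1} r * f r) \<partial>lborel)
          = (LINT r:{0..1}|lborel. f r) - (LINT r:{0..a}|lborel. f r)"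
        unfolding set_lebesgue_integral_def
          Bochner_Integration.integral_diff[OF f[unfolded set_integrable_def] sub[OF 2, unfolded set_integrable_def], symmetric]
        using 2 by (auto intro!: Bochner_Integration.integral_cong split: split_indicator)
      then show ?thesis using int[of 1] int[OF 2] by simp
    next
      case 3
      then have z: "indicator {a<..} r * (indicator {0..1} r * f r) = 0" for r
        by (auto split: split_indicator)
      show ?thesis unfolding z by simp
    qed
  qed
  then show ?thesis by eventually_elim (auto split: split_indicator_asm)
qed

lemma AE_lborel_translate:
  fixes c :: "'a::euclidean_space"
  assumes "AE x in lborel. P x"
  shows "AE x in lborel. P (x + c)"
proof -
  obtain N where N: "{x. \<not> P x} \<subseteq> N" "emeasure lborel N = 0" "N \<in> sets (lborel :: 'a measure)"
    using assms by (auto elim!: AE_E)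
  have "AE x in distr lborel borel ((+) c). x \<notin> N"
    unfolding lborel_distr_plus using N by (intro AE_not_in) auto
  then have "AE x in lborel. c + x \<notin> N"
    using N(3) by (subst (asm) AE_distr_iff) auto
  then show ?thesis
    using N(1) by (auto elim!: eventually_mono simp: add.commute)
qed

text \<open>The gauge integral integrates every derivative, and where \<open>f\<close> is Lebesgue integrable the two integrals
agree.\<close>

lemma set_FTC_real:
  fixes F f :: "real \<Rightarrow> real"
  assumes "0 \<le> s" and F: "\<And>r. (F has_real_derivative f r) (at r)" and f: "set_integrable lborel {0..s} f"
  shows "(LINT r:{0..s}|lborel. f r) = F s - F 0"
proof -
  have "(f has_integral F s - F 0) {0..s}"
    using F assms(1) by (intro fundamental_theorem_of_calculus)
      (auto intro: has_vector_derivative_at_within simp: has_real_derivative_iff_has_vector_derivative)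
  then show ?thesis
    using set_borel_integral_eq_integral(2)[OF f] by (simp add: integral_unique)
qed

lemma DERIV_along_line:
  fixes f :: "'a::real_vector \<Rightarrow> real"
  assumes "\<And>x. ((\<lambda>s. f (x + s *\<^sub>R e)) has_real_derivative f' x) (at 0)"
  shows "((\<lambda>s. f (x + s *\<^sub>R e)) has_real_derivative f' (x + r *\<^sub>R e)) (at r)"
proof -
  have "((\<lambda>s. f (x + (s + r) *\<^sub>R e)) has_real_derivative f' (x + r *\<^sub>R e)) (at 0)"
  proof -
    have "x + (s + r) *\<^sub>R e = (x + r *\<^sub>R e) + s *\<^sub>R e" for s by (simp add: algebra_simps)
    then show ?thesis using assms[of "x + r *\<^sub>R e"] by (simp only:)
  qed
  then show ?thesis using DERIV_shift[of "\<lambda>s. f (x + s *\<^sub>R e)" _ 0 r] by simp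
qed

text \<open>Shifting the variable \<open>y\<close> along with \<open>x\<close> does not change the integral over \<open>y\<close>.  The increment
\<open>u (x + s e) - u x\<close> is therefore the integral of diagonal increments of \<open>F1\<close>, that is, of \<open>F2\<close> over
\<open>[0, s]\<close> times the whole space; Fubini's theorem turns it into the integral over \<open>[0, s]\<close> of the marginal of
\<open>F2\<close>.  Along almost every line \<open>u'\<close> and that marginal thus have the same integrals.  Both \<open>u\<close> and
\<open>F1\<close> may themselves be derivatives, so that the lemma can be iterated.\<close>

lemma diagonal_derivative_of_marginal:
  fixes F1 F2 :: "'a::euclidean_space \<Rightarrow> 'a \<Rightarrow> real" and u u' :: "'a \<Rightarrow> real" and e :: 'a
  assumes F1: "integrable (lborel \<Otimes>\<^sub>M lborel) (\<lambda>(x, y). F1 x y)"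
    and F2: "integrable (lborel \<Otimes>\<^sub>M lborel) (\<lambda>(x, y). F2 x y)"
    and dF: "\<And>x y. ((\<lambda>s. F1 (x + s *\<^sub>R e) (y + s *\<^sub>R e)) has_real_derivative F2 x y) (at 0)"
    and u: "AE x in lborel. u x = (\<integral>y. F1 x y \<partial>lborel)"
    and du: "\<And>x. ((\<lambda>s. u (x + s *\<^sub>R e)) has_real_derivative u' x) (at 0)"
    and cont: "continuous_on UNIV u'"
  shows "AE x in lborel. u' x = (\<integral>y. F2 x y \<partial>lborel)"
proof -
  have [measurable]: "(\<lambda>(x, y). F2 x y) \<in> borel_measurable (borel \<Otimes>\<^sub>M borel)"
      "(\<lambda>(x, y). F1 x y) \<in> borel_measurable (borel \<Otimes>\<^sub>M borel)"
    using borel_measurable_integrable[OF F2] borel_measurable_integrable[OF F1]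
    by (simp_all cong: measurable_cong_sets)
  have [measurable]: "u' \<in> borel_measurable borel" using cont by (rule borel_measurable_continuous_onI)
  define v where "v x = (\<integral>y. F2 x y \<partial>lborel)" for x
  have [measurable]: "v \<in> borel_measurable borel" unfolding v_def by measurable
  define I where "I = {0..1::real}"
  have [measurable]: "I \<in> sets borel" by (simp add: I_def)
  have dF': "((\<lambda>s. F1 (x + s *\<^sub>R e) (y + s *\<^sub>R e)) has_real_derivative F2 (x + r *\<^sub>R e) (y + r *\<^sub>R e)) (at r)" for x y r
    using DERIV_along_line[of "\<lambda>z. F1 (fst z) (snd z)" "(e, e)" "\<lambda>z. F2 (fst z) (snd z)" "(x, y)" r] dF
    by simp
  have du': "((\<lambda>s. u (x + s *\<^sub>R e)) has_real_derivative u' (x + r *\<^sub>R e)) (at r)" for x r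
    by (rule DERIV_along_line[OF du])

  \<comment> \<open>for almost every \<open>x\<close> the diagonal derivative is integrable over \<open>[0, 1]\<close> times the whole space\<close>
  let ?N = "\<lambda>x y r. ennreal \<bar>F2 (x + r *\<^sub>R e) (y + r *\<^sub>R e)\<bar> * indicator I r"
  define K where "K = (\<integral>\<^sup>+x. \<integral>\<^sup>+y. ennreal \<bar>F2 x y\<bar> \<partial>lborel \<partial>lborel)"
  have K: "K < \<infinity>"
  proof -
    have "K = (\<integral>\<^sup>+z. ennreal (norm (case z of (x, y) \<Rightarrow> F2 x y)) \<partial>(lborel \<Otimes>\<^sub>M lborel))"
      unfolding K_def by (subst lborel.nn_integral_fst[symmetric]) auto
    also have "\<dots> < \<infinity>" using F2 by (simp add: integrable_iff_bounded)
    finally show ?thesis .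
  qed
  have inner: "(\<integral>\<^sup>+x. \<integral>\<^sup>+y. ?N x y r \<partial>lborel \<partial>lborel) = K * indicator I r" for r
  proof -
    have "(\<integral>\<^sup>+x. \<integral>\<^sup>+y. ?N x y r \<partial>lborel \<partial>lborel) = (\<integral>\<^sup>+x. (\<integral>\<^sup>+y. ennreal \<bar>F2 (x + r *\<^sub>R e) (y + r *\<^sub>R e)\<bar> \<partial>lborel) * indicator I r \<partial>lborel)"
      by (intro nn_integral_cong nn_integral_multc) measurable
    also have "\<dots> = (\<integral>\<^sup>+x. (\<integral>\<^sup>+y. ennreal \<bar>F2 (x + r *\<^sub>R e) y\<bar> \<partial>lborel) * indicator I r \<partial>lborel)"
      by (subst nn_integral_lborel_translate[of "\<lambda>y. ennreal \<bar>F2 (_ + r *\<^sub>R e) y\<bar>" "r *\<^sub>R e"]) auto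
    also have "\<dots> = (\<integral>\<^sup>+x. (\<integral>\<^sup>+y. ennreal \<bar>F2 (x + r *\<^sub>R e) y\<bar> \<partial>lborel) \<partial>lborel) * indicator I r"
      by (intro nn_integral_multc) measurable
    also have "(\<integral>\<^sup>+x. (\<integral>\<^sup>+y. ennreal \<bar>F2 (x + r *\<^sub>R e) y\<bar> \<partial>lborel) \<partial>lborel) = K"
      unfolding K_def
      by (rule nn_integral_lborel_translate[of "\<lambda>x. (\<integral>\<^sup>+y. ennreal \<bar>F2 x y\<bar> \<partial>lborel)" "r *\<^sub>R e"]) measurable
    finally show ?thesis .
  qed
  have "(\<integral>\<^sup>+x. \<integral>\<^sup>+y. \<integral>\<^sup>+r. ?N x y r \<partial>lborel \<partial>lborel \<partial>lborel) = (\<integral>\<^sup>+x. \<integral>\<^sup>+r. \<integral>\<^sup>+y. ?N x y r \<partial>lborel \<partial>lborel \<partial>lborel)"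
    by (intro nn_integral_cong lborel_pair.Fubini') measurable
  also have "\<dots> = (\<integral>\<^sup>+r. \<integral>\<^sup>+x. \<integral>\<^sup>+y. ?N x y r \<partial>lborel \<partial>lborel \<partial>lborel)"
    by (rule lborel_pair.Fubini') measurable
  also have "\<dots> = (\<integral>\<^sup>+r. K * indicator I r \<partial>lborel)" by (simp only: inner)
  also have "\<dots> = K" by (subst nn_integral_cmult) (simp_all add: I_def)
  finally have total: "(\<integral>\<^sup>+x. \<integral>\<^sup>+y. \<integral>\<^sup>+r. ?N x y r \<partial>lborel \<partial>lborel \<partial>lborel) \<noteq> \<infinity>" using K by simp
  have AE1: "AE x in lborel. (\<integral>\<^sup>+y. \<integral>\<^sup>+r. ?N x y r \<partial>lborel \<partial>lborel) \<noteq> \<infinity>"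
    by (rule nn_integral_PInf_AE[OF _ total]) measurable

  have slice: "integrable (lborel \<Otimes>\<^sub>M lborel) (\<lambda>(r, y). indicator I r * F2 (x + r *\<^sub>R e) (y + r *\<^sub>R e))"
    if "(\<integral>\<^sup>+y. \<integral>\<^sup>+r. ?N x y r \<partial>lborel \<partial>lborel) \<noteq> \<infinity>" for x
  proof (rule integrableI_bounded)
    have "(\<integral>\<^sup>+z. ennreal (norm (case z of (r, y) \<Rightarrow> indicator I r * F2 (x + r *\<^sub>R e) (y + r *\<^sub>R e))) \<partial>(lborel \<Otimes>\<^sub>M lborel))
        = (\<integral>\<^sup>+y. \<integral>\<^sup>+r. ?N x y r \<partial>lborel \<partial>lborel)"
      by (subst lborel_pair.nn_integral_snd[symmetric])
        (auto simp: abs_mult intro!: nn_integral_cong split: split_indicator)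
    then show "(\<integral>\<^sup>+z. ennreal (norm (case z of (r, y) \<Rightarrow> indicator I r * F2 (x + r *\<^sub>R e) (y + r *\<^sub>R e))) \<partial>(lborel \<Otimes>\<^sub>M lborel)) < \<infinity>"
      using that by (simp add: less_top)
  qed measurable

  have incr: "AE x in lborel. u (x + s *\<^sub>R e) - u x = (LINT r:{0..s}|lborel. v (x + r *\<^sub>R e))"
    if s: "s \<in> {0..1}" for s
  proof -
    have i1: "AE x in lborel. integrable lborel (F1 x)"
      using lborel_pair.AE_integrable_fst'[OF F1] by simp
    have sI: "indicator {0..s} r * (indicator I r * a) = indicator {0..s} r * (a::real)" for r a
      using s by (auto simp: I_def split: split_indicator)
    show ?thesis
      using AE1 i1 AE_lborel_translate[OF i1, of "s *\<^sub>R e"] u AE_lborel_translate[OF u, of "s *\<^sub>R e"]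
    proof eventually_elim
      case (elim x)
      let ?f = "\<lambda>r y. F2 (x + r *\<^sub>R e) (y + r *\<^sub>R e)"
      note sl = slice[OF elim(1)]
      have sl': "integrable (lborel \<Otimes>\<^sub>M lborel) (\<lambda>(r, y). indicator {0..s} r * ?f r y)"
      proof -
        have "integrable (lborel \<Otimes>\<^sub>M lborel) (\<lambda>z. indicator ({0..s} \<times> UNIV) z *\<^sub>R (case z of (r, y) \<Rightarrow> indicator I r * ?f r y))"
          by (rule integrable_mult_indicator[OF _ sl]) simp
        also have "(\<lambda>z. indicator ({0..s} \<times> UNIV) z *\<^sub>R (case z of (r, y) \<Rightarrow> indicator I r * ?f r y))
            = (\<lambda>(r, y). indicator {0..s} r * ?f r y)"
          using sI by (auto simp: indicator_times fun_eq_iff)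
        finally show ?thesis .
      qed
      have i2: "integrable lborel (\<lambda>y. F1 (x + s *\<^sub>R e) (y + s *\<^sub>R e))"
        using elim(3) by (subst (asm) lborel_distr_plus[of "s *\<^sub>R e", symmetric], subst (asm) integrable_distr_eq) (auto simp: add.commute)
      have "u (x + s *\<^sub>R e) - u x = (\<integral>y. F1 (x + s *\<^sub>R e) y \<partial>lborel) - (\<integral>y. F1 x y \<partial>lborel)"
        using elim by simp
      also have "(\<integral>y. F1 (x + s *\<^sub>R e) y \<partial>lborel) = (\<integral>y. F1 (x + s *\<^sub>R e) (y + s *\<^sub>R e) \<partial>lborel)"
        using integral_lborel_translate[of "F1 (x + s *\<^sub>R e)" "- (s *\<^sub>R e)"] by simp
      also have "\<dots> - (\<integral>y. F1 x y \<partial>lborel) = (\<integral>y. F1 (x + s *\<^sub>R e) (y + s *\<^sub>R e) - F1 x y \<partial>lborel)"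
        using i2 elim(2) by simp
      also have "\<dots> = (\<integral>y. (LINT r:{0..s}|lborel. ?f r y) \<partial>lborel)"
      proof (rule integral_cong_AE)
        show "AE y in lborel. F1 (x + s *\<^sub>R e) (y + s *\<^sub>R e) - F1 x y = (LINT r:{0..s}|lborel. ?f r y)"
          using lborel_pair.AE_integrable_snd[OF sl']
        proof eventually_elim
          case (elim y)
          then have "set_integrable lborel {0..s} (\<lambda>r. ?f r y)" by (simp add: set_integrable_def)
          from set_FTC_real[OF _ dF' this] s show ?case by simp
        qed
      qed (simp_all add: set_lebesgue_integral_def)
      also have "\<dots> = (\<integral>r. (\<integral>y. indicator {0..s} r * ?f r y \<partial>lborel) \<partial>lborel)"
        using lborel_pair.Fubini_integral[OF sl'] by (simp add: set_lebesgue_integral_def)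
      also have "\<dots> = (LINT r:{0..s}|lborel. v (x + r *\<^sub>R e))"
      proof -
        have "(\<integral>y. ?f r y \<partial>lborel) = v (x + r *\<^sub>R e)" for r
          using integral_lborel_translate[of "F2 (x + r *\<^sub>R e)" "- (r *\<^sub>R e)"] by (simp add: v_def)
        then show ?thesis by (simp add: set_lebesgue_integral_def)
      qed
      finally show ?case .
    qed
  qed
  \<comment> \<open>the exceptional set of \<open>incr\<close> depends on \<open>s\<close>, hence the restriction to countably many \<open>s\<close>\<close>
  have "AE x in lborel. \<forall>s\<in>\<rat>. s \<in> {0..1} \<longrightarrow> u (x + s *\<^sub>R e) - u x = (LINT r:{0..s}|lborel. v (x + r *\<^sub>R e))"
    using incr by (intro AE_ball_countable[THEN iffD2] countable_rat ballI) (auto intro: eventually_mono)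
  then have "AE x in lborel. AE r in lborel. r \<in> I \<longrightarrow> u' (x + r *\<^sub>R e) = v (x + r *\<^sub>R e)"
    using AE1
  proof eventually_elim
    case (elim x)
    have cl: "continuous_on A (\<lambda>r. u' (x + r *\<^sub>R e))" for A
      by (rule continuous_on_compose2[OF cont]) (auto intro!: continuous_intros)
    have iu: "set_integrable lborel {0..s} (\<lambda>r. u' (x + r *\<^sub>R e))" for s
      by (intro borel_integrable_atLeastAtMost' cl)
    have "integrable lborel (\<lambda>r. \<integral>y. indicator I r * F2 (x + r *\<^sub>R e) (y + r *\<^sub>R e) \<partial>lborel)"
      using lborel_pair.integrable_fst'[OF slice[OF elim(2)]] by simp
    also have "(\<lambda>r. \<integral>y. indicator I r * F2 (x + r *\<^sub>R e) (y + r *\<^sub>R e) \<partial>lborel) = (\<lambda>r. indicator I r * v (x + r *\<^sub>R e))"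
      using integral_lborel_translate[of "F2 (x + _ *\<^sub>R e)" "- (_ *\<^sub>R e)"] by (simp add: v_def fun_eq_iff)
    finally have iv: "set_integrable lborel {0..1} (\<lambda>r. v (x + r *\<^sub>R e))"
      by (simp add: set_integrable_def I_def)
    have "AE r in lborel. r \<in> {0..1} \<longrightarrow> u' (x + r *\<^sub>R e) - v (x + r *\<^sub>R e) = 0"
    proof (rule AE_zero_if_initial_integrals_zero)
      show "set_integrable lborel {0..1} (\<lambda>r. u' (x + r *\<^sub>R e) - v (x + r *\<^sub>R e))"
        by (intro set_integral_diff iu iv)
      fix s :: real assume s: "s \<in> {0..1}" "s \<in> \<rat>"
      have iv': "set_integrable lborel {0..s} (\<lambda>r. v (x + r *\<^sub>R e))"
        using s by (intro set_integrable_subset[OF iv]) auto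
      have "(LINT r:{0..s}|lborel. u' (x + r *\<^sub>R e)) = u (x + s *\<^sub>R e) - u (x + 0 *\<^sub>R e)"
        using s du' iu by (intro set_FTC_real) auto
      then show "(LINT r:{0..s}|lborel. u' (x + r *\<^sub>R e) - v (x + r *\<^sub>R e)) = 0"
        using elim(1) s by (subst set_integral_diff(2)[OF iu iv']) simp
    qed
    then show ?case by (simp add: I_def)
  qed
  moreover have "{z \<in> space (lborel \<Otimes>\<^sub>M lborel). snd z \<in> I \<longrightarrow> u' (fst z + snd z *\<^sub>R e) = v (fst z + snd z *\<^sub>R e)}
      \<in> sets (lborel \<Otimes>\<^sub>M lborel)"
    by measurable
  ultimately have "AE r in lborel. AE x in lborel. r \<in> I \<longrightarrow> u' (x + r *\<^sub>R e) = v (x + r *\<^sub>R e)"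
    using lborel_pair.AE_commute[where P="\<lambda>x r. r \<in> I \<longrightarrow> u' (x + r *\<^sub>R e) = v (x + r *\<^sub>R e)"] by blast
  moreover have "\<not> (AE r in lborel. r \<notin> I)"
    by (subst AE_iff_measurable[of I]) (auto simp: I_def)
  ultimately have "\<exists>r\<in>I. AE x in lborel. r \<in> I \<longrightarrow> u' (x + r *\<^sub>R e) = v (x + r *\<^sub>R e)"
    by (metis (mono_tags, lifting) eventually_mono)
  \<comment> \<open>one good \<open>r\<close> is enough: translating by \<open>- r e\<close> removes it\<close>
  then obtain r where r: "r \<in> I" "AE x in lborel. r \<in> I \<longrightarrow> u' (x + r *\<^sub>R e) = v (x + r *\<^sub>R e)"
    by blast
  from AE_lborel_translate[OF r(2), of "- (r *\<^sub>R e)"] r(1)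
  show ?thesis by (simp add: v_def)
qed

section \<open>Derivatives along lines and weighted moments\<close>

lemma pderiv_x_eqI:
  assumes "((\<lambda>s. f (x + s *\<^sub>R axis k 1)) has_real_derivative d) (at 0)"
  shows "pderiv_x k f x = d"
  using assms unfolding pderiv_x_def has_real_derivative_iff_has_vector_derivative
  by (rule vector_derivative_at)

lemma has_derivative_along_line:
  fixes f :: "'a::real_normed_vector \<Rightarrow> real"
  assumes "(f has_derivative D) (at x)"
  shows "((\<lambda>s. f (x + s *\<^sub>R e)) has_real_derivative D e) (at 0)"
proof -
  have "((\<lambda>s::real. x + s *\<^sub>R e) has_derivative (\<lambda>s. s *\<^sub>R e)) (at 0)"
    by (auto intro!: derivative_eq_intros)
  from has_derivative_compose[OF this] assms
  have "((\<lambda>s. f (x + s *\<^sub>R e)) has_derivative (\<lambda>s. D (s *\<^sub>R e))) (at 0)" by simp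
  moreover have "D (s *\<^sub>R e) = D e * s" for s
    using linear_cmul[OF has_derivative_linear[OF assms]] by simp
  ultimately show ?thesis by (simp add: has_field_derivative_def)
qed

lemma pderiv_x_has_derivative:
  fixes f :: "real^'n::finite \<Rightarrow> real"
  assumes "(f has_derivative D) (at x)"
  shows "pderiv_x k f x = D (axis k 1)"
  by (rule pderiv_x_eqI[OF has_derivative_along_line[OF assms]])

lemma pderiv_x_differentiable:
  fixes f :: "real^'n::finite \<Rightarrow> real"
  assumes "f differentiable (at x)"
  shows "((\<lambda>s. f (x + s *\<^sub>R axis k 1)) has_real_derivative pderiv_x k f x) (at 0)"
proof -
  obtain D where D: "(f has_derivative D) (at x)" using assms unfolding differentiable_def by blast
  show ?thesis using has_derivative_along_line[OF D, of "axis k 1"] pderiv_x_has_derivative[OF D] by simp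
qed

lemma pderiv_xy_has_derivative:
  assumes D: "((\<lambda>(x, y). G x y) has_derivative D) (at (x, y))"
  shows "pderiv_xy l G x y = D (axis l 1, axis l 1)"
proof -
  have 1: "((\<lambda>s. G (x + s *\<^sub>R axis l 1) y) has_real_derivative D (axis l 1, 0)) (at 0)"
    using has_derivative_along_line[OF D, of "(axis l 1, 0)"] by simp
  have 2: "((\<lambda>s. G x (y + s *\<^sub>R axis l 1)) has_real_derivative D (0, axis l 1)) (at 0)"
    using has_derivative_along_line[OF D, of "(0, axis l 1)"] by simp
  have "pderiv_xy l G x y = D (axis l 1, 0) + D (0, axis l 1)"
    unfolding pderiv_xy_def using pderiv_x_eqI[of "\<lambda>x'. G x' y", OF 1] pderiv_x_eqI[of "\<lambda>y'. G x y'", OF 2] by simp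
  also have "\<dots> = D (axis l 1, axis l 1)"
    using linear_add[OF has_derivative_linear[OF D], of "(axis l 1, 0)" "(0, axis l 1)"] by simp
  finally show ?thesis .
qed

lemma Ck_on_pderiv_x:
  fixes f :: "real^'n::finite \<Rightarrow> real"
  assumes "Ck_on (Suc k) UNIV f"
  shows "Ck_on k UNIV (pderiv_x i f)"
    and "((\<lambda>s. f (x + s *\<^sub>R axis i 1)) has_real_derivative pderiv_x i f x) (at 0)"
proof -
  obtain f' where f': "\<And>x. (f has_derivative f' x) (at x)" "\<And>v. Ck_on k UNIV (\<lambda>x. f' x v)"
    using assms by auto
  have "pderiv_x i f = (\<lambda>x. f' x (axis i 1))" using pderiv_x_has_derivative[OF f'(1)] by auto
  with f'(2) show "Ck_on k UNIV (pderiv_x i f)" by simp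
  show "((\<lambda>s. f (x + s *\<^sub>R axis i 1)) has_real_derivative pderiv_x i f x) (at 0)"
    using f'(1) by (intro pderiv_x_differentiable) (auto simp: differentiable_def)
qed

text \<open>The operator that is defined by two separate partial derivatives is the derivative along the diagonal,
because the function has a total derivative.\<close>

lemma Ck_on_pderiv_xy:
  fixes G :: "real^'n::finite \<Rightarrow> real^'n \<Rightarrow> real"
  assumes "Ck_on (Suc k) UNIV (\<lambda>(x, y). G x y)"
  shows "Ck_on k UNIV (\<lambda>(x, y). pderiv_xy i G x y)"
    and "((\<lambda>s. G (x + s *\<^sub>R axis i 1) (y + s *\<^sub>R axis i 1)) has_real_derivative pderiv_xy i G x y) (at 0)"
proof -
  obtain D where D: "\<And>z. ((\<lambda>(x, y). G x y) has_derivative D z) (at z)" "\<And>v. Ck_on k UNIV (\<lambda>z. D z v)"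
    using assms by auto
  have eq: "pderiv_xy i G x y = D (x, y) (axis i 1, axis i 1)" for x y
    by (rule pderiv_xy_has_derivative[OF D(1)])
  then have "(\<lambda>(x, y). pderiv_xy i G x y) = (\<lambda>z. D z (axis i 1, axis i 1))" by auto
  with D(2) show "Ck_on k UNIV (\<lambda>(x, y). pderiv_xy i G x y)" by simp
  show "((\<lambda>s. G (x + s *\<^sub>R axis i 1) (y + s *\<^sub>R axis i 1)) has_real_derivative pderiv_xy i G x y) (at 0)"
    using has_derivative_along_line[OF D(1)[of "(x, y)"], of "(axis i 1, axis i 1)"] by (simp add: eq)
qed

lemma borel_measurable_line_derivative:
  fixes g :: "'a::euclidean_space \<Rightarrow> real"
  assumes [measurable]: "g \<in> borel_measurable borel"
    and d: "\<And>x. ((\<lambda>s. g (x + s *\<^sub>R e)) has_real_derivative g' x) (at 0)"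
  shows "g' \<in> borel_measurable borel"
proof (rule borel_measurable_LIMSEQ_real)
  fix x
  have "((\<lambda>s. (g (x + s *\<^sub>R e) - g x) / s) \<longlongrightarrow> g' x) (at 0)"
    using d[of x] by (simp add: DERIV_def)
  moreover have "filterlim (\<lambda>n. inverse (real (Suc n))) (at 0) sequentially"
    using LIMSEQ_inverse_real_of_nat by (auto simp: filterlim_at)
  ultimately show "(\<lambda>n. (g (x + inverse (real (Suc n)) *\<^sub>R e) - g x) / inverse (real (Suc n))) \<longlonglongrightarrow> g' x"
    by (rule filterlim_compose)
qed measurable

lemma powr_above_tangent:
  assumes p: "p \<ge> 1" and m: "m > 0" and x: "x \<ge> (0::real)"
  shows "m powr p + p * m powr (p - 1) * (x - m) \<le> x powr p"
proof (cases "x = 0")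
  case True
  have "p * m powr (p - 1) * m = p * m powr p" using m by (simp add: powr_diff)
  moreover have "m powr p \<le> p * m powr p" using p by (simp add: mult_le_cancel_right1)
  ultimately show ?thesis using True p by (simp add: algebra_simps)
next
  case False
  have "(x powr p) - (m powr p) \<ge> (p * m powr (p - 1)) * (x - m)"
  proof (rule convex_on_imp_above_tangent[OF powr_convex[OF p]])
    show "((\<lambda>x. x powr p) has_field_derivative p * m powr (p - 1)) (at m within {0<..})"
      by (rule has_field_derivative_at_within[OF has_real_derivative_powr[OF m]])
  qed (use x m False in \<open>auto simp: interior_open\<close>)
  then show ?thesis by simp
qed

text \<open>The tangent of the power function at the mean lies below it;
multiplied by the weight \<open>w\<close> and integrated, its linear term vanishes.\<close>

lemma Jensen_powr_density:
  fixes w g :: "'a \<Rightarrow> real"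
  assumes p: "p \<ge> 1" and w: "integrable M w" "\<And>x. 0 \<le> w x" and c: "0 < (\<integral>x. w x \<partial>M)"
    and g: "g \<in> borel_measurable M" "\<And>x. 0 \<le> g x" and wg: "integrable M (\<lambda>x. w x * g x)"
  shows "ennreal (((\<integral>x. w x * g x \<partial>M) / (\<integral>x. w x \<partial>M)) powr p * (\<integral>x. w x \<partial>M)) \<le> (\<integral>\<^sup>+x. ennreal (w x * g x powr p) \<partial>M)"
proof (cases "(\<integral>\<^sup>+x. ennreal (w x * g x powr p) \<partial>M) = \<infinity> \<or> (\<integral>x. w x * g x \<partial>M) = 0")
  case True
  then show ?thesis by auto
next
  case False
  define c where "c = (\<integral>x. w x \<partial>M)"
  define m where "m = (\<integral>x. w x * g x \<partial>M) / c"
  have "0 \<le> (\<integral>x. w x * g x \<partial>M)" using w g by simp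
  with False c have m: "m > 0" by (auto simp: m_def c_def)
  have [measurable]: "w \<in> borel_measurable M" "g \<in> borel_measurable M" using w g by auto
  have int: "integrable M (\<lambda>x. w x * g x powr p)"
    using False w(2) g(2) by (intro integrableI_bounded) (auto simp: less_top)
  have "m powr p * c = (\<integral>x. m powr p * w x + p * m powr (p - 1) * (w x * g x - m * w x) \<partial>M)"
    using w(1) wg c by (simp add: c_def m_def)
  also have "\<dots> \<le> (\<integral>x. w x * g x powr p \<partial>M)"
  proof (rule integral_mono)
    fix x
    have "w x * (m powr p + p * m powr (p - 1) * (g x - m)) \<le> w x * g x powr p"
      using powr_above_tangent[OF p m g(2)] w(2) by (intro mult_left_mono)
    then show "m powr p * w x + p * m powr (p - 1) * (w x * g x - m * w x) \<le> w x * g x powr p"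
      by (simp add: algebra_simps)
  qed (use w wg int in auto)
  finally have "ennreal (m powr p * c) \<le> ennreal (\<integral>x. w x * g x powr p \<partial>M)" by (rule ennreal_leI)
  also have "\<dots> = (\<integral>\<^sup>+x. ennreal (w x * g x powr p) \<partial>M)"
    using w(2) int by (intro nn_integral_eq_integral[symmetric]) auto
  finally show ?thesis by (simp add: m_def c_def)
qed

lemma powr_le_one_plus: "(1::real) \<le> p \<Longrightarrow> 0 \<le> r \<Longrightarrow> r \<le> 1 + r powr p"
proof (cases "r \<le> 1")
  case True
  then show ?thesis using powr_ge_zero[of r p] by linarith
next
  case False
  assume "1 \<le> p"
  then have "r powr 1 \<le> r powr p" using False by (intro powr_mono) auto
  then show ?thesis using False by simp
qed

lemma spec_norm_le: "norm (A *v x) \<le> spec_norm A * norm x"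
  unfolding spec_norm_def by (rule onorm[OF matrix_vector_mul_bounded_linear])

lemma spec_norm_nonneg: "0 \<le> spec_norm A"
  unfolding spec_norm_def by (rule onorm_pos_le[OF matrix_vector_mul_bounded_linear])

text \<open>The choice \<open>a = A b\<close> recovers the norm of \<open>A b\<close>.\<close>

lemma spec_norm_boundI:
  fixes A :: "real^'n::finite^'m::finite"
  assumes "\<And>a b. \<bar>a \<bullet> (A *v b)\<bar> \<le> B * norm a * norm b" 
  shows "spec_norm A \<le> B"
  unfolding spec_norm_def
proof (rule onorm_le)
  fix b
  show "norm (A *v b) \<le> B * norm b"
  proof (cases "A *v b = 0")
    case True
    have "0 \<le> B * norm b"
    proof -
      obtain a :: "real^'m" where "a \<in> Basis" using nonempty_Basis by blast
      then have "0 \<le> B * 1 * norm b" using order_trans[OF abs_ge_zero assms[of a b]] by simp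
      then show ?thesis by simp
    qed
    then show ?thesis using True by simp
  next
    case False
    have "norm (A *v b) * norm (A *v b) \<le> norm (A *v b) * (B * norm b)"
      using assms[of "A *v b" b] by (simp add: power2_norm_eq_inner[symmetric] power2_eq_square mult_ac)
    then show ?thesis using False by (simp add: mult_le_cancel_left)
  qed
qed

lemma borel_measurable_spec_norm: "spec_norm \<in> borel_measurable borel"
proof (rule borel_measurable_continuous_onI)
  have tri: "spec_norm A \<le> spec_norm B + norm (A - B)" for A B :: "real^'a::finite^'b::finite"
  proof (rule spec_norm_boundI)
    fix a :: "real^'b" and b :: "real^'a"
    have "norm (A *v b) \<le> norm (B *v b) + norm ((A - B) *v b)"
      using norm_triangle_ineq[of "B *v b" "(A - B) *v b"] by (simp add: matrix_vector_mult_diff_rdistrib)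
    also have "\<dots> \<le> (spec_norm B + norm (A - B)) * norm b"
      using spec_norm_le[of B b] norm_matrix_vector_le[of "A - B" b] by (simp add: distrib_right)
    finally have "norm a * norm (A *v b) \<le> norm a * ((spec_norm B + norm (A - B)) * norm b)"
      by (intro mult_left_mono) auto
    with Cauchy_Schwarz_ineq2[of a "A *v b"]
    show "\<bar>a \<bullet> (A *v b)\<bar> \<le> (spec_norm B + norm (A - B)) * norm a * norm b" by (simp add: mult_ac)
  qed
  show "continuous_on UNIV (spec_norm :: real^'a::finite^'b::finite \<Rightarrow> real)"
    unfolding continuous_on_iff
  proof (intro ballI allI impI)
    fix A :: "real^'a^'b" and e :: real assume "e > 0"
    moreover have "dist (spec_norm B) (spec_norm A) \<le> dist B A" for B
      using tri[of A B] tri[of B A] by (simp add: dist_norm norm_minus_commute dist_real_def abs_le_iff)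
    ultimately show "\<exists>d>0. \<forall>B\<in>UNIV. dist B A < d \<longrightarrow> dist (spec_norm B) (spec_norm A) < e"
      by (meson le_less_trans)
  qed
qed

section \<open>Scores of a mixture\<close>

lemma borel_measurable_vecI:
  fixes f :: "'a \<Rightarrow> 'b::euclidean_space^'n::finite"
  assumes "\<And>k. (\<lambda>x. f x $ k) \<in> borel_measurable M"
  shows "f \<in> borel_measurable M"
  unfolding borel_measurable_euclidean_space[of f]
  using assms by (auto simp: Basis_vec_def inner_axis)

text \<open>The joint density is \<open>F\<close>, and \<open>\<rho>t\<close> its marginal.  In this locale \<open>V\<close> and \<open>K\<close> are the gradient and the Hessian of
\<open>ln F\<close> in the diagonal directions; each splits into a contribution of the transition density and one of
the initial density.\<close>

locale smooth_mixture =
  fixes pt :: "real^'d::finite \<Rightarrow> real^'d \<Rightarrow> real" and \<rho>0 \<rho>t :: "real^'d \<Rightarrow> real"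
  assumes pt_pos: "\<And>x y. 0 < pt x y" and pt_Ck: "Ck_on 2 UNIV (\<lambda>(x, y). pt x y)"
    and \<rho>0_pos: "\<And>y. 0 < \<rho>0 y" and \<rho>0_diff: "twice_differentiable \<rho>0"
    and \<rho>t_pos: "\<And>x. 0 < \<rho>t x" and \<rho>t_Ck: "Ck_on 2 UNIV \<rho>t"
    and joint_integrable: "integrable (lborel \<Otimes>\<^sub>M lborel) (\<lambda>(x, y). pt x y * \<rho>0 y)"
    and slice_integrable: "\<And>x. integrable lborel (\<lambda>y. pt x y * \<rho>0 y)"
    and mixture: "\<And>x. \<rho>t x = (\<integral>y. pt x y * \<rho>0 y \<partial>lborel)"
begin

definition F :: "real^'d \<Rightarrow> real^'d \<Rightarrow> real" where
  "F x y = pt x y * \<rho>0 y"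

definition S0 :: "real^'d \<Rightarrow> real^'d" where
  "S0 y = grad (\<lambda>z. ln (\<rho>0 z)) y"

definition H0 :: "real^'d \<Rightarrow> real^'d^'d" where
  "H0 y = hess (\<lambda>z. ln (\<rho>0 z)) y"

definition V :: "real^'d \<Rightarrow> real^'d \<Rightarrow> real^'d" where
  "V x y = R_score pt x y + S0 y"

definition K :: "real^'d \<Rightarrow> real^'d \<Rightarrow> real^'d^'d" where
  "K x y = R2_score pt x y + H0 y"

lemma F_pos: "0 < F x y"
  by (simp add: F_def pt_pos \<rho>0_pos)

lemma F_nonneg: "0 \<le> F x y"
  using F_pos less_imp_le by blast

lemma Ck_on_ln_pt: "Ck_on (Suc (Suc 0)) UNIV (\<lambda>(x, y). ln (pt x y))"
  using Ck_on_ln[of UNIV "\<lambda>(x, y). pt x y" 2] pt_Ck pt_pos by (auto simp: case_prod_unfold numeral_2_eq_2)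

lemma R_score_line_derivative:
  "((\<lambda>s. ln (pt (x + s *\<^sub>R axis i 1) (y + s *\<^sub>R axis i 1))) has_real_derivative R_score pt x y $ i) (at 0)"
  "((\<lambda>s. R_score pt (x + s *\<^sub>R axis i 1) (y + s *\<^sub>R axis i 1) $ k) has_real_derivative R2_score pt x y $ i $ k) (at 0)"
  using Ck_on_pderiv_xy(2)[OF Ck_on_ln_pt] Ck_on_pderiv_xy(2)[OF Ck_on_pderiv_xy(1)[OF Ck_on_ln_pt]]
  by (simp_all add: R_score_def R2_score_def)

lemma ln_\<rho>0_differentiable: "(\<lambda>z. ln (\<rho>0 z)) differentiable (at y)"
proof -
  obtain D where "(\<rho>0 has_derivative D) (at y)"
    using \<rho>0_diff unfolding twice_differentiable_def differentiable_def by blast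
  then have "((\<lambda>z. ln (\<rho>0 z)) has_derivative (\<lambda>v. D v / \<rho>0 y)) (at y)"
    using \<rho>0_pos[of y] by (auto intro!: derivative_eq_intros simp: divide_inverse)
  then show ?thesis unfolding differentiable_def by blast
qed

text \<open>A quotient of functions that are differentiable by assumption, which gives access to the derivatives of \<open>S0\<close>.\<close>

lemma S0_eq: "S0 y $ k = grad \<rho>0 y $ k / \<rho>0 y"
proof -
  have "\<rho>0 differentiable (at y)" using \<rho>0_diff unfolding twice_differentiable_def by blast
  from pderiv_x_differentiable[OF this, of k]
  have "((\<lambda>s. ln (\<rho>0 (y + s *\<^sub>R axis k 1))) has_real_derivative pderiv_x k \<rho>0 y / \<rho>0 y) (at 0)"
    using \<rho>0_pos[of y] by (auto intro!: derivative_eq_intros)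
  then show ?thesis by (simp add: S0_def grad_def pderiv_x_eqI)
qed

lemma S0_line_derivative:
  "((\<lambda>s. ln (\<rho>0 (y + s *\<^sub>R axis i 1))) has_real_derivative S0 y $ i) (at 0)"
  "((\<lambda>s. S0 (y + s *\<^sub>R axis i 1) $ k) has_real_derivative H0 y $ i $ k) (at 0)"
proof -
  show "((\<lambda>s. ln (\<rho>0 (y + s *\<^sub>R axis i 1))) has_real_derivative S0 y $ i) (at 0)"
    using pderiv_x_differentiable[OF ln_\<rho>0_differentiable] by (simp add: S0_def grad_def)
  obtain D where D: "(\<rho>0 has_derivative D) (at y)"
    using \<rho>0_diff unfolding twice_differentiable_def differentiable_def by blast
  obtain E where E: "(grad \<rho>0 has_derivative E) (at y)"
    using \<rho>0_diff unfolding twice_differentiable_def differentiable_def by blast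
  have "((\<lambda>z. grad \<rho>0 z $ k) has_derivative (\<lambda>v. E v $ k)) (at y)"
    by (rule bounded_linear.has_derivative[OF bounded_linear_vec_nth E])
  from has_derivative_divide'[OF this D] \<rho>0_pos[of y]
  have "(\<lambda>z. S0 z $ k) differentiable (at y)"
    unfolding S0_eq differentiable_def by auto
  from pderiv_x_differentiable[OF this, of i]
  show "((\<lambda>s. S0 (y + s *\<^sub>R axis i 1) $ k) has_real_derivative H0 y $ i $ k) (at 0)"
    by (simp add: H0_def hess_def S0_def grad_def)
qed

lemma V_line_derivative:
  "((\<lambda>s. V (x + s *\<^sub>R axis i 1) (y + s *\<^sub>R axis i 1) $ k) has_real_derivative K x y $ i $ k) (at 0)"
  unfolding V_def K_def by (simp, intro DERIV_add R_score_line_derivative S0_line_derivative)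

lemma F_line_derivative:
  "((\<lambda>s. F (x + s *\<^sub>R axis i 1) (y + s *\<^sub>R axis i 1)) has_real_derivative F x y * V x y $ i) (at 0)"
proof -
  have F: "F x y = exp (ln (pt x y) + ln (\<rho>0 y))" for x y
    by (simp add: F_def exp_add pt_pos \<rho>0_pos)
  have "((\<lambda>s. ln (pt (x + s *\<^sub>R axis i 1) (y + s *\<^sub>R axis i 1)) + ln (\<rho>0 (y + s *\<^sub>R axis i 1)))
      has_real_derivative V x y $ i) (at 0)"
    unfolding V_def vector_add_component by (intro DERIV_add R_score_line_derivative S0_line_derivative)
  from DERIV_fun_exp[OF this] show ?thesis by (simp add: F)
qed

text \<open>The logarithmic derivative of \<open>F\<close> produces the product \<open>V\<^sub>i V\<^sub>k\<close>.\<close>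

lemma FV_line_derivative:
  "((\<lambda>s. F (x + s *\<^sub>R axis i 1) (y + s *\<^sub>R axis i 1) * V (x + s *\<^sub>R axis i 1) (y + s *\<^sub>R axis i 1) $ k)
     has_real_derivative F x y * (V x y $ i * V x y $ k + K x y $ i $ k)) (at 0)"
  using DERIV_mult[OF F_line_derivative[of x i y] V_line_derivative[of x i y k]] by (simp add: algebra_simps)

lemma \<rho>0_measurable [measurable]: "\<rho>0 \<in> borel_measurable borel"
proof (rule borel_measurable_continuous_onI)
  show "continuous_on UNIV \<rho>0"
    using \<rho>0_diff unfolding twice_differentiable_def
    by (auto intro!: differentiable_imp_continuous_on simp: differentiable_on_def)
qed

text \<open>Limits of difference quotients; the second derivatives of \<open>\<rho>0\<close> exist everywhere but may be discontinuous.\<close>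

lemma S0_measurable [measurable]: "(\<lambda>y. S0 y $ k) \<in> borel_measurable borel"
  by (rule borel_measurable_line_derivative[OF _ S0_line_derivative(1)]) measurable

lemma H0_measurable [measurable]: "(\<lambda>y. H0 y $ i $ k) \<in> borel_measurable borel"
  by (rule borel_measurable_line_derivative[OF _ S0_line_derivative(2)]) measurable

lemma pt_measurable [measurable]: "(\<lambda>(x, y). pt x y) \<in> borel_measurable (borel \<Otimes>\<^sub>M borel)"
  using Ck_on_continuous[OF pt_Ck] by (simp add: borel_prod borel_measurable_continuous_onI)

lemma F_measurable [measurable]: "(\<lambda>(x, y). F x y) \<in> borel_measurable (borel \<Otimes>\<^sub>M borel)"
  unfolding F_def by measurable

lemma R_measurable [measurable]:
  "(\<lambda>(x, y). R_score pt x y $ k) \<in> borel_measurable (borel \<Otimes>\<^sub>M borel)"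
  "(\<lambda>(x, y). R2_score pt x y $ i $ k) \<in> borel_measurable (borel \<Otimes>\<^sub>M borel)"
  using Ck_on_continuous[OF Ck_on_pderiv_xy(1)[OF Ck_on_ln_pt]]
    Ck_on_continuous[OF Ck_on_pderiv_xy(1)[OF Ck_on_pderiv_xy(1)[OF Ck_on_ln_pt]]]
  by (simp_all add: borel_prod borel_measurable_continuous_onI R_score_def R2_score_def)

lemma vector_valued_measurable [measurable]:
  "S0 \<in> borel_measurable borel" "H0 \<in> borel_measurable borel"
  "(\<lambda>(x, y). R_score pt x y) \<in> borel_measurable (borel \<Otimes>\<^sub>M borel)"
  "(\<lambda>(x, y). R2_score pt x y) \<in> borel_measurable (borel \<Otimes>\<^sub>M borel)"
proof -
  show "S0 \<in> borel_measurable borel" by (rule borel_measurable_vecI) measurable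
  show "H0 \<in> borel_measurable borel" by (intro borel_measurable_vecI) measurable
  show "(\<lambda>(x, y). R_score pt x y) \<in> borel_measurable (borel \<Otimes>\<^sub>M borel)"
    using R_measurable(1) by (intro borel_measurable_vecI) (simp add: case_prod_unfold)
  show "(\<lambda>(x, y). R2_score pt x y) \<in> borel_measurable (borel \<Otimes>\<^sub>M borel)"
    using R_measurable(2) by (intro borel_measurable_vecI) (simp add: case_prod_unfold)
qed

lemma V_measurable [measurable]: "(\<lambda>(x, y). V x y) \<in> borel_measurable (borel \<Otimes>\<^sub>M borel)"
  unfolding V_def by measurable

lemma K_measurable [measurable]: "(\<lambda>(x, y). K x y) \<in> borel_measurable (borel \<Otimes>\<^sub>M borel)"
  unfolding K_def by measurable

lemma V_component_measurable [measurable]: "(\<lambda>(x, y). V x y $ k) \<in> borel_measurable (borel \<Otimes>\<^sub>M borel)"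
  unfolding V_def vector_add_component by measurable

lemma K_component_measurable [measurable]: "(\<lambda>(x, y). K x y $ i $ k) \<in> borel_measurable (borel \<Otimes>\<^sub>M borel)"
  unfolding K_def vector_add_component by measurable

declare borel_measurable_spec_norm [measurable]

text \<open>The bound \<open>r \<le> 1 + r\<^sup>p\<close> and the finite mass of \<open>F\<close> reduce the first moment to the \<open>p\<close>-th one.\<close>

lemma integrable_of_moment:
  assumes p: "p \<ge> 1" and g[measurable]: "(\<lambda>(x, y). g x y) \<in> borel_measurable (borel \<Otimes>\<^sub>M borel)"
    and g0: "\<And>x y. 0 \<le> g x y"
    and fin: "(\<integral>\<^sup>+(x, y). ennreal (F x y * g x y powr p) \<partial>(lborel \<Otimes>\<^sub>M lborel)) < \<infinity>"
  shows "integrable (lborel \<Otimes>\<^sub>M lborel) (\<lambda>(x, y). F x y * g x y)"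
proof (rule Bochner_Integration.integrable_bound)
  have "integrable (lborel \<Otimes>\<^sub>M lborel) (\<lambda>(x, y). F x y * g x y powr p)"
  proof (rule integrableI_bounded)
    show "(\<lambda>(x, y). F x y * g x y powr p) \<in> borel_measurable (lborel \<Otimes>\<^sub>M lborel)" by measurable
    show "(\<integral>\<^sup>+z. ennreal (norm (case z of (x, y) \<Rightarrow> F x y * g x y powr p)) \<partial>(lborel \<Otimes>\<^sub>M lborel)) < \<infinity>"
      using fin by (simp add: case_prod_unfold F_nonneg)
  qed
  then show "integrable (lborel \<Otimes>\<^sub>M lborel) (\<lambda>z. (case z of (x, y) \<Rightarrow> F x y) + (case z of (x, y) \<Rightarrow> F x y * g x y powr p))"
    using joint_integrable by (intro Bochner_Integration.integrable_add) (auto simp: F_def)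
  show "AE z in lborel \<Otimes>\<^sub>M lborel. norm (case z of (x, y) \<Rightarrow> F x y * g x y)
      \<le> norm ((case z of (x, y) \<Rightarrow> F x y) + (case z of (x, y) \<Rightarrow> F x y * g x y powr p))"
  proof (rule AE_I2)
    fix z :: "(real^'d) \<times> (real^'d)"
    obtain x y where z: "z = (x, y)" by (cases z)
    have "F x y * g x y \<le> F x y * (1 + g x y powr p)"
      by (intro mult_left_mono powr_le_one_plus p g0 F_nonneg)
    then show "norm (case z of (x, y) \<Rightarrow> F x y * g x y)
      \<le> norm ((case z of (x, y) \<Rightarrow> F x y) + (case z of (x, y) \<Rightarrow> F x y * g x y powr p))"
      by (simp add: z F_nonneg g0 distrib_left)
  qed
qed measurable

text \<open>Jensen's inequality for the conditional law of \<open>y\<close> given \<open>x\<close>, which has the density \<open>F x y / \<rho>t x\<close>, followed by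
an integration over \<open>x\<close>.\<close>

lemma averaged_powr:
  assumes p: "p \<ge> 1" and g[measurable]: "(\<lambda>(x, y). g x y) \<in> borel_measurable (borel \<Otimes>\<^sub>M borel)"
    and g0: "\<And>x y. 0 \<le> g x y"
    and Fg: "integrable (lborel \<Otimes>\<^sub>M lborel) (\<lambda>(x, y). F x y * g x y)"
    and l0: "\<And>x. 0 \<le> l x"
    and l: "AE x in lborel. l x \<le> (\<integral>y. F x y * g x y \<partial>lborel) / \<rho>t x"
  shows "(\<integral>\<^sup>+x. ennreal (l x powr p * \<rho>t x) \<partial>lborel)
    \<le> (\<integral>\<^sup>+(x, y). ennreal (F x y * g x y powr p) \<partial>(lborel \<Otimes>\<^sub>M lborel))"
proof -
  have "(\<integral>\<^sup>+x. ennreal (l x powr p * \<rho>t x) \<partial>lborel) \<le> (\<integral>\<^sup>+x. \<integral>\<^sup>+y. ennreal (F x y * g x y powr p) \<partial>lborel \<partial>lborel)"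
  proof (rule nn_integral_mono_AE)
    have "AE x in lborel. integrable lborel (\<lambda>y. F x y * g x y)"
      using lborel_pair.AE_integrable_fst'[OF Fg] by simp
    with l show "AE x in lborel. ennreal (l x powr p * \<rho>t x) \<le> (\<integral>\<^sup>+y. ennreal (F x y * g x y powr p) \<partial>lborel)"
    proof eventually_elim
      case (elim x)
      have [measurable]: "g x \<in> borel_measurable lborel" by measurable
      have c: "(\<integral>y. F x y \<partial>lborel) = \<rho>t x" by (simp add: F_def mixture)
      have "ennreal (l x powr p * \<rho>t x) \<le> ennreal (((\<integral>y. F x y * g x y \<partial>lborel) / \<rho>t x) powr p * \<rho>t x)"
        using elim(1) l0 p \<rho>t_pos[of x] by (intro ennreal_leI mult_right_mono powr_mono2) auto
      also have "\<dots> \<le> (\<integral>\<^sup>+y. ennreal (F x y * g x y powr p) \<partial>lborel)"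
        using Jensen_powr_density[OF p, of lborel "F x" "g x"] elim(2) slice_integrable[of x] g0 \<rho>t_pos[of x]
        by (simp add: c F_nonneg F_def[symmetric])
      finally show ?case .
    qed
  qed
  also have "\<dots> = (\<integral>\<^sup>+(x, y). ennreal (F x y * g x y powr p) \<partial>(lborel \<Otimes>\<^sub>M lborel))"
    by (subst lborel.nn_integral_fst[symmetric]) auto
  finally show ?thesis .
qed

end

context smooth_mixture
begin

lemma abs_F_mult: "\<bar>F x y * t\<bar> = F x y * \<bar>t\<bar>"
  by (simp add: abs_mult F_nonneg)

lemma \<rho>t_line_derivative:
  "((\<lambda>s. \<rho>t (x + s *\<^sub>R axis i 1)) has_real_derivative pderiv_x i \<rho>t x) (at 0)"
  "((\<lambda>s. pderiv_x k \<rho>t (x + s *\<^sub>R axis i 1)) has_real_derivative pderiv_x i (pderiv_x k \<rho>t) x) (at 0)"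
  "continuous_on UNIV (pderiv_x i \<rho>t)" "continuous_on UNIV (pderiv_x i (pderiv_x k \<rho>t))"
proof -
  have C: "Ck_on (Suc (Suc 0)) UNIV \<rho>t" using \<rho>t_Ck by (simp only: numeral_2_eq_2)
  note C1 = Ck_on_pderiv_x[OF C] and C2 = Ck_on_pderiv_x[OF Ck_on_pderiv_x(1)[OF C]]
  show "((\<lambda>s. \<rho>t (x + s *\<^sub>R axis i 1)) has_real_derivative pderiv_x i \<rho>t x) (at 0)" by (rule C1(2))
  show "((\<lambda>s. pderiv_x k \<rho>t (x + s *\<^sub>R axis i 1)) has_real_derivative pderiv_x i (pderiv_x k \<rho>t) x) (at 0)" by (rule C2(2))
  show "continuous_on UNIV (pderiv_x i \<rho>t)" by (rule Ck_on_continuous[OF C1(1)])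
  show "continuous_on UNIV (pderiv_x i (pderiv_x k \<rho>t))" by (rule Ck_on_continuous[OF C2(1)])
qed

lemma grad_ln_\<rho>t: "grad (\<lambda>z. ln (\<rho>t z)) x $ k = pderiv_x k \<rho>t x / \<rho>t x"
proof -
  have "((\<lambda>s. ln (\<rho>t (x + s *\<^sub>R axis k 1))) has_real_derivative pderiv_x k \<rho>t x / \<rho>t x) (at 0)"
    using \<rho>t_pos[of x] by (auto intro!: derivative_eq_intros \<rho>t_line_derivative)
  then show ?thesis by (simp add: grad_def pderiv_x_eqI)
qed

lemma hess_ln_\<rho>t: "hess (\<lambda>z. ln (\<rho>t z)) x $ i $ k
  = pderiv_x i (pderiv_x k \<rho>t) x / \<rho>t x - pderiv_x i \<rho>t x / \<rho>t x * (pderiv_x k \<rho>t x / \<rho>t x)"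
proof -
  have g: "pderiv_x k (\<lambda>z. ln (\<rho>t z)) = (\<lambda>x. pderiv_x k \<rho>t x / \<rho>t x)"
    using grad_ln_\<rho>t by (simp add: grad_def fun_eq_iff)
  have "((\<lambda>s. pderiv_x k \<rho>t (x + s *\<^sub>R axis i 1) / \<rho>t (x + s *\<^sub>R axis i 1)) has_real_derivative
      pderiv_x i (pderiv_x k \<rho>t) x / \<rho>t x - pderiv_x i \<rho>t x / \<rho>t x * (pderiv_x k \<rho>t x / \<rho>t x)) (at 0)"
    using \<rho>t_pos[of x] by (auto intro!: derivative_eq_intros \<rho>t_line_derivative simp: field_simps)
  then show ?thesis by (simp add: hess_def g pderiv_x_eqI)
qed

lemma AE_pderiv_\<rho>t:
  assumes FV: "integrable (lborel \<Otimes>\<^sub>M lborel) (\<lambda>(x, y). F x y * norm (V x y))"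
  shows "AE x in lborel. \<forall>k. pderiv_x k \<rho>t x = (\<integral>y. F x y * V x y $ k \<partial>lborel)"
    and "integrable (lborel \<Otimes>\<^sub>M lborel) (\<lambda>(x, y). F x y * V x y $ k)"
proof -
  show int: "integrable (lborel \<Otimes>\<^sub>M lborel) (\<lambda>(x, y). F x y * V x y $ k)" for k
  proof (rule Bochner_Integration.integrable_bound[OF FV])
    show "AE z in lborel \<Otimes>\<^sub>M lborel. norm (case z of (x, y) \<Rightarrow> F x y * V x y $ k) \<le> norm (case z of (x, y) \<Rightarrow> F x y * norm (V x y))"
      by (rule AE_I2) (auto simp: abs_F_mult intro!: mult_left_mono component_le_norm_cart F_nonneg)
  qed measurable
  have "AE x in lborel. pderiv_x k \<rho>t x = (\<integral>y. F x y * V x y $ k \<partial>lborel)" for k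
  proof (rule diagonal_derivative_of_marginal[OF _ int F_line_derivative _ \<rho>t_line_derivative(1,3)])
    show "integrable (lborel \<Otimes>\<^sub>M lborel) (\<lambda>(x, y). F x y)" using joint_integrable by (simp add: F_def)
    show "AE x in lborel. \<rho>t x = (\<integral>y. F x y \<partial>lborel)" by (simp add: F_def mixture)
  qed
  then show "AE x in lborel. \<forall>k. pderiv_x k \<rho>t x = (\<integral>y. F x y * V x y $ k \<partial>lborel)"
    by (simp add: AE_all_countable)
qed

lemma abs_VK_le:
  "\<bar>V x y $ i * V x y $ k + K x y $ i $ k\<bar> \<le> (norm (V x y))\<^sup>2 + spec_norm (K x y)"
proof -
  have "\<bar>V x y $ i * V x y $ k\<bar> \<le> (norm (V x y))\<^sup>2"
    unfolding abs_mult power2_eq_square by (intro mult_mono component_le_norm_cart) auto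
  moreover have "\<bar>K x y $ i $ k\<bar> \<le> spec_norm (K x y)"
  proof -
    have "K x y $ i $ k = (K x y *v axis k 1) $ i"
      by (simp add: matrix_vector_mul_component inner_axis)
    also have "\<bar>\<dots>\<bar> \<le> norm (K x y *v axis k 1)" by (rule component_le_norm_cart)
    also have "\<dots> \<le> spec_norm (K x y) * norm (axis k 1 :: real^'d)" by (rule spec_norm_le)
    finally show ?thesis by simp
  qed
  ultimately show ?thesis
    by (intro order_trans[OF abs_triangle_ineq] add_mono)
qed

lemma AE_pderiv2_\<rho>t:
  assumes FV: "integrable (lborel \<Otimes>\<^sub>M lborel) (\<lambda>(x, y). F x y * norm (V x y))"
    and FV2: "integrable (lborel \<Otimes>\<^sub>M lborel) (\<lambda>(x, y). F x y * (norm (V x y))\<^sup>2)"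
    and FK: "integrable (lborel \<Otimes>\<^sub>M lborel) (\<lambda>(x, y). F x y * spec_norm (K x y))"
  shows "AE x in lborel. \<forall>i k. pderiv_x i (pderiv_x k \<rho>t) x = (\<integral>y. F x y * (V x y $ i * V x y $ k + K x y $ i $ k) \<partial>lborel)"
proof -
  have int: "integrable (lborel \<Otimes>\<^sub>M lborel) (\<lambda>(x, y). F x y * (V x y $ i * V x y $ k + K x y $ i $ k))" for i k
  proof (rule Bochner_Integration.integrable_bound[OF Bochner_Integration.integrable_add[OF FV2 FK]])
    show "AE z in lborel \<Otimes>\<^sub>M lborel. norm (case z of (x, y) \<Rightarrow> F x y * (V x y $ i * V x y $ k + K x y $ i $ k))
      \<le> norm ((case z of (x, y) \<Rightarrow> F x y * (norm (V x y))\<^sup>2) + (case z of (x, y) \<Rightarrow> F x y * spec_norm (K x y)))"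
    proof (rule AE_I2)
      fix z :: "(real^'d) \<times> (real^'d)"
      obtain x y where z: "z = (x, y)" by (cases z)
      have "\<bar>F x y * (V x y $ i * V x y $ k + K x y $ i $ k)\<bar> \<le> F x y * (norm (V x y))\<^sup>2 + F x y * spec_norm (K x y)"
        unfolding abs_F_mult distrib_left[of "F x y" "(norm (V x y))\<^sup>2", symmetric]
        by (rule mult_left_mono[OF abs_VK_le F_nonneg])
      from order_trans[OF this abs_ge_self] show "norm (case z of (x, y) \<Rightarrow> F x y * (V x y $ i * V x y $ k + K x y $ i $ k))
      \<le> norm ((case z of (x, y) \<Rightarrow> F x y * (norm (V x y))\<^sup>2) + (case z of (x, y) \<Rightarrow> F x y * spec_norm (K x y)))"
        by (simp only: z prod.case real_norm_def)
    qed
  qed measurable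
  have "AE x in lborel. pderiv_x i (pderiv_x k \<rho>t) x = (\<integral>y. F x y * (V x y $ i * V x y $ k + K x y $ i $ k) \<partial>lborel)" for i k
  proof (rule diagonal_derivative_of_marginal[OF AE_pderiv_\<rho>t(2)[OF FV] int FV_line_derivative _ \<rho>t_line_derivative(2,4)])
    show "AE x in lborel. pderiv_x k \<rho>t x = (\<integral>y. F x y * V x y $ k \<partial>lborel)"
      using AE_pderiv_\<rho>t(1)[OF FV] by eventually_elim simp
  qed
  then show ?thesis by (simp add: AE_all_countable)
qed

lemma integral_F_inner:
  assumes "integrable lborel (\<lambda>y. F x y * norm (V x y))"
  shows "integrable lborel (\<lambda>y. F x y * (a \<bullet> V x y))"
    and "(\<integral>y. F x y * (a \<bullet> V x y) \<partial>lborel) = (\<Sum>k\<in>UNIV. a $ k * (\<integral>y. F x y * V x y $ k \<partial>lborel))"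
    and "\<bar>\<integral>y. F x y * (a \<bullet> V x y) \<partial>lborel\<bar> \<le> norm a * (\<integral>y. F x y * norm (V x y) \<partial>lborel)"
proof -
  have bound: "\<bar>F x y * (a \<bullet> V x y)\<bar> \<le> norm a * (F x y * norm (V x y))" for y a
    using mult_left_mono[OF Cauchy_Schwarz_ineq2[of a "V x y"] F_nonneg[of x y]]
    by (simp add: abs_mult F_nonneg mult_ac)
  show int: "integrable lborel (\<lambda>y. F x y * (a \<bullet> V x y))" for a
    by (rule Bochner_Integration.integrable_bound[OF integrable_mult_right[OF assms, of "norm a"]])
      (measurable, simp only: real_norm_def, rule AE_I2, rule order_trans[OF bound abs_ge_self])
  have int': "integrable lborel (\<lambda>y. F x y * V x y $ k)" for k
    using int[of "axis k 1"] by (simp add: inner_axis')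
  show "(\<integral>y. F x y * (a \<bullet> V x y) \<partial>lborel) = (\<Sum>k\<in>UNIV. a $ k * (\<integral>y. F x y * V x y $ k \<partial>lborel))"
  proof -
    have "F x y * (a \<bullet> V x y) = (\<Sum>k\<in>UNIV. a $ k * (F x y * V x y $ k))" for y
      by (simp add: inner_vec_def sum_distrib_left mult.left_commute)
    then show ?thesis using int' by (simp add: Bochner_Integration.integral_sum)
  qed
  have "\<bar>\<integral>y. F x y * (a \<bullet> V x y) \<partial>lborel\<bar> \<le> (\<integral>y. \<bar>F x y * (a \<bullet> V x y)\<bar> \<partial>lborel)"
    by (rule integral_abs_bound)
  also have "\<dots> \<le> (\<integral>y. norm a * (F x y * norm (V x y)) \<partial>lborel)"
    by (intro integral_mono integrable_abs int integrable_mult_right assms bound)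
  finally show "\<bar>\<integral>y. F x y * (a \<bullet> V x y) \<partial>lborel\<bar> \<le> norm a * (\<integral>y. F x y * norm (V x y) \<partial>lborel)" by simp
qed

lemma integral_F: "(\<integral>y. F x y \<partial>lborel) = \<rho>t x" "integrable lborel (F x)"
  using mixture[of x] slice_integrable[of x] by (simp_all add: F_def[abs_def])

text \<open>The norm of a vector of integrals is estimated by testing the vector against itself.\<close>

lemma AE_norm_grad:
  assumes FV: "integrable (lborel \<Otimes>\<^sub>M lborel) (\<lambda>(x, y). F x y * norm (V x y))"
  shows "AE x in lborel. norm (grad (\<lambda>z. ln (\<rho>t z)) x) \<le> (\<integral>y. F x y * norm (V x y) \<partial>lborel) / \<rho>t x"
proof -
  have "AE x in lborel. integrable lborel (\<lambda>y. F x y * norm (V x y))"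
    using lborel_pair.AE_integrable_fst'[OF FV] by simp
  with AE_pderiv_\<rho>t(1)[OF FV] show ?thesis
  proof eventually_elim
    case (elim x)
    let ?g = "grad (\<lambda>z. ln (\<rho>t z)) x"
    have "norm ?g * norm ?g = (\<Sum>k\<in>UNIV. ?g $ k * (pderiv_x k \<rho>t x / \<rho>t x))"
      by (simp add: power2_eq_square[symmetric] power2_norm_eq_inner inner_vec_def grad_ln_\<rho>t)
    also have "\<dots> = (\<integral>y. F x y * (?g \<bullet> V x y) \<partial>lborel) / \<rho>t x"
      by (simp add: integral_F_inner(2)[OF elim(2)] elim(1) sum_divide_distrib)
    also have "\<dots> \<le> norm ?g * (\<integral>y. F x y * norm (V x y) \<partial>lborel) / \<rho>t x"
      using integral_F_inner(3)[OF elim(2), of ?g] \<rho>t_pos[of x] by (intro divide_right_mono) auto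
    finally have "norm ?g * norm ?g \<le> norm ?g * ((\<integral>y. F x y * norm (V x y) \<partial>lborel) / \<rho>t x)" by simp
    moreover have "0 \<le> (\<integral>y. F x y * norm (V x y) \<partial>lborel) / \<rho>t x"
      using \<rho>t_pos[of x] by (intro divide_nonneg_pos) (auto simp: F_nonneg)
    ultimately show ?case
    proof (cases "norm ?g = 0")
      case False
      then have "0 < norm ?g" by simp
      from mult_left_le_imp_le[OF \<open>norm ?g * norm ?g \<le> _\<close> this] show ?thesis .
    qed simp
  qed
qed

text \<open>The matrix is tested against two vectors \<open>a\<close> and \<open>b\<close>.  The averages of \<open>V\<^sub>i V\<^sub>k\<close> and of \<open>K\<^sub>i\<^sub>k\<close> give
\<open>|V|\<^sup>2 + |K|\<close>; the product of the averages of \<open>V\<^sub>i\<close> and \<open>V\<^sub>k\<close> gives a second \<open>|V|\<^sup>2\<close>, since the square of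
an average is at most the average of the square.\<close>

lemma AE_spec_norm_hess:
  assumes FV: "integrable (lborel \<Otimes>\<^sub>M lborel) (\<lambda>(x, y). F x y * norm (V x y))"
    and FV2: "integrable (lborel \<Otimes>\<^sub>M lborel) (\<lambda>(x, y). F x y * (norm (V x y))\<^sup>2)"
    and FK: "integrable (lborel \<Otimes>\<^sub>M lborel) (\<lambda>(x, y). F x y * spec_norm (K x y))"
  shows "AE x in lborel. spec_norm (hess (\<lambda>z. ln (\<rho>t z)) x)
    \<le> (\<integral>y. F x y * (2 * (norm (V x y))\<^sup>2 + spec_norm (K x y)) \<partial>lborel) / \<rho>t x"
proof -
  have "AE x in lborel. integrable lborel (\<lambda>y. F x y * norm (V x y))"
      "AE x in lborel. integrable lborel (\<lambda>y. F x y * (norm (V x y))\<^sup>2)"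
      "AE x in lborel. integrable lborel (\<lambda>y. F x y * spec_norm (K x y))"
    using lborel_pair.AE_integrable_fst'[OF FV] lborel_pair.AE_integrable_fst'[OF FV2]
      lborel_pair.AE_integrable_fst'[OF FK] by simp_all
  with AE_pderiv_\<rho>t(1)[OF FV] AE_pderiv2_\<rho>t[OF FV FV2 FK] show ?thesis
  proof eventually_elim
    case (elim x)
    let ?c = "\<rho>t x" and ?v = "\<integral>y. F x y * norm (V x y) \<partial>lborel"
    let ?v2 = "\<integral>y. F x y * (norm (V x y))\<^sup>2 \<partial>lborel" and ?k = "\<integral>y. F x y * spec_norm (K x y) \<partial>lborel"
    have c: "?c > 0" by (rule \<rho>t_pos)
    have [measurable]: "V x \<in> borel_measurable borel" "K x \<in> borel_measurable borel" by measurable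
    have v0: "0 \<le> ?v" by (auto simp: F_nonneg)
    have v2: "(?v / ?c)\<^sup>2 \<le> ?v2 / ?c"
    proof -
      have "ennreal ((?v / ?c) powr 2 * ?c) \<le> (\<integral>\<^sup>+y. ennreal (F x y * norm (V x y) powr 2) \<partial>lborel)"
        using Jensen_powr_density[of 2 lborel "F x" "\<lambda>y. norm (V x y)"] elim(3) c by (simp add: integral_F F_nonneg)
      also have "\<dots> = ennreal ?v2"
        using elim(4) by (subst nn_integral_eq_integral[symmetric]) (auto simp: F_nonneg)
      finally have "(?v / ?c) powr 2 * ?c \<le> ?v2"
        by (subst (asm) ennreal_le_iff) (auto simp: F_nonneg)
      then show ?thesis using c v0 by (simp add: field_simps)
    qed
    have "\<bar>a \<bullet> (hess (\<lambda>z. ln (\<rho>t z)) x *v b)\<bar> \<le> (\<integral>y. F x y * (2 * (norm (V x y))\<^sup>2 + spec_norm (K x y)) \<partial>lborel) / ?c * norm a * norm b" for a b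
    proof -
      let ?g = "\<lambda>y. (a \<bullet> V x y) * (b \<bullet> V x y) + a \<bullet> (K x y *v b)"
      have gb: "\<bar>F x y * ?g y\<bar> \<le> (F x y * (norm (V x y))\<^sup>2 + F x y * spec_norm (K x y)) * (norm a * norm b)" for y
      proof -
        have "\<bar>(a \<bullet> V x y) * (b \<bullet> V x y)\<bar> \<le> (norm a * norm (V x y)) * (norm b * norm (V x y))"
          unfolding abs_mult by (intro mult_mono Cauchy_Schwarz_ineq2) auto
        moreover have "\<bar>a \<bullet> (K x y *v b)\<bar> \<le> norm a * (spec_norm (K x y) * norm b)"
          by (rule order_trans[OF Cauchy_Schwarz_ineq2]) (intro mult_left_mono spec_norm_le, simp)
        ultimately have "\<bar>?g y\<bar> \<le> ((norm (V x y))\<^sup>2 + spec_norm (K x y)) * (norm a * norm b)"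
          using abs_triangle_ineq[of "(a \<bullet> V x y) * (b \<bullet> V x y)" "a \<bullet> (K x y *v b)"]
          by (simp add: power2_eq_square algebra_simps)
        from mult_left_mono[OF this F_nonneg[of x y]] show ?thesis
          by (simp only: abs_F_mult distrib_left[of "F x y" "(norm (V x y))\<^sup>2"] mult.assoc[symmetric])
      qed
      have intB: "integrable lborel (\<lambda>y. (F x y * (norm (V x y))\<^sup>2 + F x y * spec_norm (K x y)) * (norm a * norm b))"
        using elim(4,5) by auto
      have comp: "?g y = (\<Sum>i\<in>UNIV. \<Sum>k\<in>UNIV. a $ i * (b $ k * (V x y $ i * V x y $ k + K x y $ i $ k)))" for y
      proof -
        have "(a \<bullet> V x y) * (b \<bullet> V x y) = (\<Sum>i\<in>UNIV. \<Sum>k\<in>UNIV. a $ i * (b $ k * (V x y $ i * V x y $ k)))"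
          by (simp add: inner_vec_def sum_product mult_ac)
        moreover have "a \<bullet> (K x y *v b) = (\<Sum>i\<in>UNIV. \<Sum>k\<in>UNIV. a $ i * (b $ k * K x y $ i $ k))"
          by (simp add: inner_vec_def matrix_vector_mult_def sum_distrib_left mult_ac)
        ultimately show ?thesis by (simp add: sum.distrib distrib_left)
      qed
      have intc: "integrable lborel (\<lambda>y. F x y * (V x y $ i * V x y $ k + K x y $ i $ k))" for i k
      proof (rule Bochner_Integration.integrable_bound)
        show "integrable lborel (\<lambda>y. F x y * (norm (V x y))\<^sup>2 + F x y * spec_norm (K x y))" using elim(4,5) by auto
        have "\<bar>F x y * (V x y $ i * V x y $ k + K x y $ i $ k)\<bar> \<le> F x y * (norm (V x y))\<^sup>2 + F x y * spec_norm (K x y)" for y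
          unfolding abs_F_mult distrib_left[of "F x y" "(norm (V x y))\<^sup>2", symmetric]
          by (rule mult_left_mono[OF abs_VK_le F_nonneg])
        then show "AE y in lborel. norm (F x y * (V x y $ i * V x y $ k + K x y $ i $ k))
            \<le> norm (F x y * (norm (V x y))\<^sup>2 + F x y * spec_norm (K x y))"
          by (intro AE_I2) (simp only: real_norm_def, rule order_trans[OF _ abs_ge_self])
      qed measurable
      have Fg: "F x y * ?g y = (\<Sum>i\<in>UNIV. \<Sum>k\<in>UNIV. a $ i * (b $ k * (F x y * (V x y $ i * V x y $ k + K x y $ i $ k))))" for y
        unfolding comp by (simp only: sum_distrib_left mult.left_commute[of "F x y"])
      have intg: "integrable lborel (\<lambda>y. F x y * ?g y)"
        unfolding Fg using intc by simp
      have "a \<bullet> (hess (\<lambda>z. ln (\<rho>t z)) x *v b) = (\<Sum>i\<in>UNIV. \<Sum>k\<in>UNIV. a $ i * (b $ k * hess (\<lambda>z. ln (\<rho>t z)) x $ i $ k))"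
        by (simp add: inner_vec_def matrix_vector_mult_def sum_distrib_left mult_ac)
      also have "\<dots> = (\<Sum>i\<in>UNIV. \<Sum>k\<in>UNIV. a $ i * (b $ k * (\<integral>y. F x y * (V x y $ i * V x y $ k + K x y $ i $ k) \<partial>lborel))) / ?c
          - (\<Sum>i\<in>UNIV. a $ i * pderiv_x i \<rho>t x) / ?c * ((\<Sum>k\<in>UNIV. b $ k * pderiv_x k \<rho>t x) / ?c)"
        by (simp add: hess_ln_\<rho>t elim(2)[rule_format] right_diff_distrib sum_subtractf sum_divide_distrib sum_product mult_ac)
      also have "(\<Sum>i\<in>UNIV. \<Sum>k\<in>UNIV. a $ i * (b $ k * (\<integral>y. F x y * (V x y $ i * V x y $ k + K x y $ i $ k) \<partial>lborel)))
          = (\<integral>y. F x y * ?g y \<partial>lborel)"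
        unfolding Fg using intc by simp
      also have "(\<Sum>i\<in>UNIV. a $ i * pderiv_x i \<rho>t x) = (\<integral>y. F x y * (a \<bullet> V x y) \<partial>lborel)"
        by (simp add: integral_F_inner(2)[OF elim(3)] elim(1))
      also have "(\<Sum>i\<in>UNIV. b $ i * pderiv_x i \<rho>t x) = (\<integral>y. F x y * (b \<bullet> V x y) \<partial>lborel)"
        by (simp add: integral_F_inner(2)[OF elim(3)] elim(1))
      finally have eq: "a \<bullet> (hess (\<lambda>z. ln (\<rho>t z)) x *v b) = (\<integral>y. F x y * ?g y \<partial>lborel) / ?c
        - (\<integral>y. F x y * (a \<bullet> V x y) \<partial>lborel) / ?c * ((\<integral>y. F x y * (b \<bullet> V x y) \<partial>lborel) / ?c)" .
      have 1: "\<bar>(\<integral>y. F x y * ?g y \<partial>lborel) / ?c\<bar> \<le> (?v2 + ?k) / ?c * (norm a * norm b)"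
      proof -
        have "\<bar>\<integral>y. F x y * ?g y \<partial>lborel\<bar> \<le> (\<integral>y. \<bar>F x y * ?g y\<bar> \<partial>lborel)" by (rule integral_abs_bound)
        also have "\<dots> \<le> (\<integral>y. (F x y * (norm (V x y))\<^sup>2 + F x y * spec_norm (K x y)) * (norm a * norm b) \<partial>lborel)"
          by (intro integral_mono integrable_abs intg intB gb)
        also have "\<dots> = (?v2 + ?k) * (norm a * norm b)" using elim(4,5) by simp
        finally show ?thesis using c by (simp add: abs_divide divide_right_mono)
      qed
      have 2: "\<bar>(\<integral>y. F x y * (a \<bullet> V x y) \<partial>lborel) / ?c * ((\<integral>y. F x y * (b \<bullet> V x y) \<partial>lborel) / ?c)\<bar> \<le> ?v2 / ?c * (norm a * norm b)"
      proof -
        have "\<bar>(\<integral>y. F x y * (a \<bullet> V x y) \<partial>lborel) / ?c * ((\<integral>y. F x y * (b \<bullet> V x y) \<partial>lborel) / ?c)\<bar>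
          \<le> (norm a * ?v / ?c) * (norm b * ?v / ?c)"
          unfolding abs_mult using c integral_F_inner(3)[OF elim(3)] v0
          by (intro mult_mono) (auto simp: abs_divide intro!: divide_right_mono)
        also have "\<dots> = (?v / ?c)\<^sup>2 * (norm a * norm b)" by (simp add: power2_eq_square)
        also have "\<dots> \<le> ?v2 / ?c * (norm a * norm b)" by (intro mult_right_mono v2) auto
        finally show ?thesis .
      qed
      have "(\<integral>y. F x y * (2 * (norm (V x y))\<^sup>2 + spec_norm (K x y)) \<partial>lborel) = 2 * ?v2 + ?k"
      proof -
        have "(\<lambda>y. F x y * (2 * (norm (V x y))\<^sup>2 + spec_norm (K x y))) = (\<lambda>y. 2 * (F x y * (norm (V x y))\<^sup>2) + F x y * spec_norm (K x y))"
          by (simp add: algebra_simps)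
        then show ?thesis using elim(4,5) by simp
      qed
      then have rhs: "(\<integral>y. F x y * (2 * (norm (V x y))\<^sup>2 + spec_norm (K x y)) \<partial>lborel) / ?c * norm a * norm b
          = (?v2 + ?k) / ?c * (norm a * norm b) + ?v2 / ?c * (norm a * norm b)"
        by (simp add: add_divide_distrib algebra_simps)
      show ?thesis unfolding rhs eq using 1 2
        by (intro order_trans[OF abs_triangle_ineq4] add_mono)
    qed
    then show ?case by (rule spec_norm_boundI)
  qed
qed

end

lemma powr_max: "0 \<le> a \<Longrightarrow> 0 \<le> b \<Longrightarrow> 0 \<le> p \<Longrightarrow> (max a b) powr p \<le> a powr p + b powr p" for a b p :: real
  by (simp add: max_def)

lemma powr_add_le:
  fixes a b p :: real
  assumes "0 \<le> a" "0 \<le> b" "0 \<le> p"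
  shows "(a + b) powr p \<le> 2 powr p * (a powr p + b powr p)"
proof -
  have "(a + b) powr p \<le> (2 * max a b) powr p" using assms by (intro powr_mono2) auto
  also have "\<dots> = 2 powr p * (max a b) powr p" using assms by (simp add: powr_mult)
  also have "\<dots> \<le> 2 powr p * (a powr p + b powr p)" using assms by (intro mult_left_mono powr_max) auto
  finally show ?thesis .
qed

lemma power2_powr: "0 \<le> r \<Longrightarrow> (r\<^sup>2) powr p = r powr (2 * p)" for r p :: real
  by (metis powr_numeral powr_powr)

text \<open>The sum is the convex combination with weights \<open>1/6, 1/6, 1/3, 1/3\<close> of \<open>6 a\<close>, \<open>6 b\<close>, \<open>12 c\<close> and \<open>12 d\<close>, hence at most
their maximum.  These weights are what keeps the constant at \<open>12 powr p\<close>.\<close>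

lemma powr_sum4_le:
  fixes a b c d p :: real
  assumes n: "0 \<le> a" "0 \<le> b" "0 \<le> c" "0 \<le> d" "0 \<le> p"
  shows "(a + b + 4 * c + 4 * d) powr p \<le> 12 powr p * (a powr p + b powr p + c powr p + d powr p)"
proof -
  let ?m = "max (max (6 * a) (6 * b)) (max (12 * c) (12 * d))"
  have "6 * a \<le> ?m" "6 * b \<le> ?m" "12 * c \<le> ?m" "12 * d \<le> ?m" by auto
  then have "a + b + 4 * c + 4 * d \<le> ?m" by linarith
  then have "(a + b + 4 * c + 4 * d) powr p \<le> ?m powr p" using n by (intro powr_mono2) auto
  also have "\<dots> \<le> (max (6 * a) (6 * b)) powr p + (max (12 * c) (12 * d)) powr p"
    using n by (intro powr_max) auto
  also have "\<dots> \<le> ((6 * a) powr p + (6 * b) powr p) + ((12 * c) powr p + (12 * d) powr p)"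
    using n by (intro add_mono powr_max) auto
  also have "\<dots> \<le> ((12 * a) powr p + (12 * b) powr p) + ((12 * c) powr p + (12 * d) powr p)"
    using n by (intro add_mono powr_mono2) auto
  also have "\<dots> = 12 powr p * (a powr p + b powr p + c powr p + d powr p)"
    using n by (simp add: powr_mult algebra_simps)
  finally show ?thesis .
qed

lemma ennreal_cmult_less_infinity: "X \<noteq> \<infinity> \<Longrightarrow> ennreal c * X < \<infinity>"
  by (simp add: ennreal_mult_less_top less_top)

context smooth_mixture
begin

lemma integrable_F_bound:
  assumes Fg: "integrable (lborel \<Otimes>\<^sub>M lborel) (\<lambda>(x, y). F x y * g x y)"
    and h[measurable]: "(\<lambda>(x, y). h x y) \<in> borel_measurable (borel \<Otimes>\<^sub>M borel)"
    and le: "\<And>x y. 0 \<le> h x y" "\<And>x y. h x y \<le> 1 + g x y"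
  shows "integrable (lborel \<Otimes>\<^sub>M lborel) (\<lambda>(x, y). F x y * h x y)"
proof (rule Bochner_Integration.integrable_bound)
  show "integrable (lborel \<Otimes>\<^sub>M lborel) (\<lambda>z. (case z of (x, y) \<Rightarrow> F x y) + (case z of (x, y) \<Rightarrow> F x y * g x y))"
    using joint_integrable Fg by (intro Bochner_Integration.integrable_add) (auto simp: F_def)
  show "AE z in lborel \<Otimes>\<^sub>M lborel. norm (case z of (x, y) \<Rightarrow> F x y * h x y)
      \<le> norm ((case z of (x, y) \<Rightarrow> F x y) + (case z of (x, y) \<Rightarrow> F x y * g x y))"
  proof (rule AE_I2)
    fix z :: "(real^'d) \<times> (real^'d)"
    obtain x y where z: "z = (x, y)" by (cases z)
    have "\<bar>F x y * h x y\<bar> \<le> F x y * (1 + g x y)"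
      unfolding abs_F_mult using le(1)[of x y] le(2)[of x y] by (intro mult_left_mono F_nonneg) auto
    also have "\<dots> = F x y + F x y * g x y" by (simp add: distrib_left)
    finally show "norm (case z of (x, y) \<Rightarrow> F x y * h x y)
      \<le> norm ((case z of (x, y) \<Rightarrow> F x y) + (case z of (x, y) \<Rightarrow> F x y * g x y))"
      unfolding z prod.case real_norm_def by (rule order_trans[OF _ abs_ge_self])
  qed
qed measurable

proposition score_moment_bound:
  assumes p: "p \<ge> 1"
  shows "(\<integral>\<^sup>+x. ennreal (norm (grad (\<lambda>z. ln (\<rho>t z)) x) powr p * \<rho>t x) \<partial>lborel) \<le> ennreal (12 powr p) *
    ((\<integral>\<^sup>+(x, y). ennreal (F x y * norm (S0 y) powr p) \<partial>(lborel \<Otimes>\<^sub>M lborel))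
     + (\<integral>\<^sup>+(x, y). ennreal (F x y * norm (R_score pt x y) powr p) \<partial>(lborel \<Otimes>\<^sub>M lborel)))"
    (is "?L \<le> _ * (?A + ?B)")
proof (cases "?A + ?B = \<infinity>")
  case True
  then show ?thesis by (simp only: True) (simp add: ennreal_mult_top)
next
  case False
  let ?I = "\<integral>\<^sup>+(x, y). ennreal (F x y * norm (V x y) powr p) \<partial>(lborel \<Otimes>\<^sub>M lborel)"
  have "?I \<le> (\<integral>\<^sup>+z. ennreal (12 powr p) * ((case z of (x, y) \<Rightarrow> ennreal (F x y * norm (S0 y) powr p))
      + (case z of (x, y) \<Rightarrow> ennreal (F x y * norm (R_score pt x y) powr p))) \<partial>(lborel \<Otimes>\<^sub>M lborel))"
  proof (rule nn_integral_mono)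
    fix z :: "(real^'d) \<times> (real^'d)"
    obtain x y where z: "z = (x, y)" by (cases z)
    have "norm (V x y) powr p \<le> (norm (S0 y) + norm (R_score pt x y)) powr p"
      using p norm_triangle_ineq[of "R_score pt x y" "S0 y"] by (intro powr_mono2) (auto simp: V_def)
    also have "\<dots> \<le> 2 powr p * (norm (S0 y) powr p + norm (R_score pt x y) powr p)"
      using p by (intro powr_add_le) auto
    also have "\<dots> \<le> 12 powr p * (norm (S0 y) powr p + norm (R_score pt x y) powr p)"
      using p by (intro mult_right_mono powr_mono2) auto
    finally have "F x y * norm (V x y) powr p \<le> 12 powr p * (F x y * norm (S0 y) powr p + F x y * norm (R_score pt x y) powr p)"
      using mult_left_mono[OF _ F_nonneg[of x y]] by (fastforce simp: algebra_simps)
    from ennreal_leI[OF this]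
    show "(case z of (x, y) \<Rightarrow> ennreal (F x y * norm (V x y) powr p)) \<le> ennreal (12 powr p) * ((case z of (x, y) \<Rightarrow> ennreal (F x y * norm (S0 y) powr p))
      + (case z of (x, y) \<Rightarrow> ennreal (F x y * norm (R_score pt x y) powr p)))"
      by (simp add: z ennreal_mult ennreal_plus F_nonneg)
  qed
  also have "\<dots> = ennreal (12 powr p) * (?A + ?B)"
    by (subst nn_integral_cmult, measurable, subst nn_integral_add) measurable
  finally have I: "?I \<le> ennreal (12 powr p) * (?A + ?B)" .
  also have "\<dots> < \<infinity>" by (rule ennreal_cmult_less_infinity[OF False])
  finally have "integrable (lborel \<Otimes>\<^sub>M lborel) (\<lambda>(x, y). F x y * norm (V x y))"
    by (intro integrable_of_moment[OF p]) auto
  from averaged_powr[OF p _ _ this _ AE_norm_grad[OF this]] have "?L \<le> ?I" by simp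
  then show ?thesis using I by (rule order_trans)
qed

proposition Hessian_moment_bound:
  assumes p: "p \<ge> 1"
  shows "(\<integral>\<^sup>+x. ennreal (spec_norm (hess (\<lambda>z. ln (\<rho>t z)) x) powr p * \<rho>t x) \<partial>lborel) \<le> ennreal (12 powr p) *
    ((\<integral>\<^sup>+(x, y). ennreal (F x y * spec_norm (H0 y) powr p) \<partial>(lborel \<Otimes>\<^sub>M lborel))
     + (\<integral>\<^sup>+(x, y). ennreal (F x y * spec_norm (R2_score pt x y) powr p) \<partial>(lborel \<Otimes>\<^sub>M lborel))
     + (\<integral>\<^sup>+(x, y). ennreal (F x y * norm (S0 y) powr (2 * p)) \<partial>(lborel \<Otimes>\<^sub>M lborel))
     + (\<integral>\<^sup>+(x, y). ennreal (F x y * norm (R_score pt x y) powr (2 * p)) \<partial>(lborel \<Otimes>\<^sub>M lborel)))"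
    (is "?L \<le> _ * (?A + ?B + ?C + ?D)")
proof (cases "?A + ?B + ?C + ?D = \<infinity>")
  case True
  then show ?thesis by (simp only: True) (simp add: ennreal_mult_top)
next
  case False
  \<comment> \<open>an upper bound for \<open>2 |V|\<^sup>2 + |K|\<close> in which the four contributions are separated\<close>
  define g where "g x y = spec_norm (H0 y) + spec_norm (R2_score pt x y) + 4 * (norm (S0 y))\<^sup>2 + 4 * (norm (R_score pt x y))\<^sup>2" for x y
  have g0: "0 \<le> g x y" for x y unfolding g_def by (intro add_nonneg_nonneg spec_norm_nonneg) auto
  have gm[measurable]: "(\<lambda>(x, y). g x y) \<in> borel_measurable (borel \<Otimes>\<^sub>M borel)" unfolding g_def by measurable
  let ?I = "\<integral>\<^sup>+(x, y). ennreal (F x y * g x y powr p) \<partial>(lborel \<Otimes>\<^sub>M lborel)"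
  have "?I \<le> (\<integral>\<^sup>+z. ennreal (12 powr p) * ((case z of (x, y) \<Rightarrow> ennreal (F x y * spec_norm (H0 y) powr p))
      + (case z of (x, y) \<Rightarrow> ennreal (F x y * spec_norm (R2_score pt x y) powr p))
      + (case z of (x, y) \<Rightarrow> ennreal (F x y * norm (S0 y) powr (2 * p)))
      + (case z of (x, y) \<Rightarrow> ennreal (F x y * norm (R_score pt x y) powr (2 * p)))) \<partial>(lborel \<Otimes>\<^sub>M lborel))"
  proof (rule nn_integral_mono)
    fix z :: "(real^'d) \<times> (real^'d)"
    obtain x y where z: "z = (x, y)" by (cases z)
    have "g x y powr p \<le> 12 powr p * (spec_norm (H0 y) powr p + spec_norm (R2_score pt x y) powr p
        + ((norm (S0 y))\<^sup>2) powr p + ((norm (R_score pt x y))\<^sup>2) powr p)"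
      unfolding g_def using p by (intro powr_sum4_le spec_norm_nonneg) auto
    also have "\<dots> = 12 powr p * (spec_norm (H0 y) powr p + spec_norm (R2_score pt x y) powr p
        + norm (S0 y) powr (2 * p) + norm (R_score pt x y) powr (2 * p))"
      by (simp add: power2_powr)
    finally have "F x y * g x y powr p \<le> F x y * (12 powr p * (spec_norm (H0 y) powr p + spec_norm (R2_score pt x y) powr p
        + norm (S0 y) powr (2 * p) + norm (R_score pt x y) powr (2 * p)))"
      by (intro mult_left_mono F_nonneg)
    also have "\<dots> = 12 powr p * (F x y * spec_norm (H0 y) powr p + F x y * spec_norm (R2_score pt x y) powr p
        + F x y * norm (S0 y) powr (2 * p) + F x y * norm (R_score pt x y) powr (2 * p))"
      by (simp add: algebra_simps)
    finally have "F x y * g x y powr p \<le> \<dots>" .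
    from ennreal_leI[OF this]
    show "(case z of (x, y) \<Rightarrow> ennreal (F x y * g x y powr p)) \<le> ennreal (12 powr p) * ((case z of (x, y) \<Rightarrow> ennreal (F x y * spec_norm (H0 y) powr p))
      + (case z of (x, y) \<Rightarrow> ennreal (F x y * spec_norm (R2_score pt x y) powr p))
      + (case z of (x, y) \<Rightarrow> ennreal (F x y * norm (S0 y) powr (2 * p)))
      + (case z of (x, y) \<Rightarrow> ennreal (F x y * norm (R_score pt x y) powr (2 * p))))"
      by (simp add: z ennreal_mult ennreal_plus F_nonneg)
  qed
  also have "\<dots> = ennreal (12 powr p) * (?A + ?B + ?C + ?D)"
    by (subst nn_integral_cmult, measurable, subst nn_integral_add, measurable, subst nn_integral_add, measurable,
        subst nn_integral_add) measurable
  finally have I: "?I \<le> ennreal (12 powr p) * (?A + ?B + ?C + ?D)" .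
  also have "\<dots> < \<infinity>" by (rule ennreal_cmult_less_infinity[OF False])
  finally have Fg: "integrable (lborel \<Otimes>\<^sub>M lborel) (\<lambda>(x, y). F x y * g x y)"
    by (intro integrable_of_moment[OF p gm g0])
  have Vg: "2 * (norm (V x y))\<^sup>2 \<le> 4 * (norm (S0 y))\<^sup>2 + 4 * (norm (R_score pt x y))\<^sup>2" for x y
  proof -
    have "(norm (V x y))\<^sup>2 \<le> (norm (R_score pt x y) + norm (S0 y))\<^sup>2"
      unfolding V_def by (intro power_mono norm_triangle_ineq) auto
    also have "\<dots> \<le> 2 * (norm (S0 y))\<^sup>2 + 2 * (norm (R_score pt x y))\<^sup>2"
      using sum_squares_bound[of "norm (R_score pt x y)" "norm (S0 y)"] by (simp add: power2_sum)
    finally show ?thesis by simp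
  qed
  have Kg: "spec_norm (K x y) \<le> spec_norm (H0 y) + spec_norm (R2_score pt x y)" for x y
    unfolding K_def spec_norm_def
    using onorm_triangle[OF matrix_vector_mul_bounded_linear matrix_vector_mul_bounded_linear, of "R2_score pt x y" "H0 y"]
    by (simp add: matrix_vector_mult_add_rdistrib[abs_def])
  have VKg: "2 * (norm (V x y))\<^sup>2 + spec_norm (K x y) \<le> g x y" for x y
    unfolding g_def using Vg[of x y] Kg[of x y] by linarith
  have sq: "norm (V x y) \<le> 1 + (norm (V x y))\<^sup>2" for x y
  proof -
    have "2 * norm (V x y) \<le> (norm (V x y))\<^sup>2 + 1" using sum_squares_bound[of "norm (V x y)" 1] by simp
    with norm_ge_zero[of "V x y"] show ?thesis by linarith
  qed
  have V2: "(norm (V x y))\<^sup>2 \<le> g x y" for x y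
    using VKg[of x y] spec_norm_nonneg[of "K x y"] zero_le_power2[of "norm (V x y)"] by linarith
  have FV: "integrable (lborel \<Otimes>\<^sub>M lborel) (\<lambda>(x, y). F x y * norm (V x y))"
  proof (rule integrable_F_bound[OF Fg])
    show "norm (V x y) \<le> 1 + g x y" for x y using sq[of x y] V2[of x y] by linarith
    show "0 \<le> norm (V x y)" for x y by simp
  qed measurable
  have FV2: "integrable (lborel \<Otimes>\<^sub>M lborel) (\<lambda>(x, y). F x y * (norm (V x y))\<^sup>2)"
  proof (rule integrable_F_bound[OF Fg])
    show "(norm (V x y))\<^sup>2 \<le> 1 + g x y" for x y using V2[of x y] by linarith
    show "0 \<le> (norm (V x y))\<^sup>2" for x y by simp
  qed measurable
  have FK: "integrable (lborel \<Otimes>\<^sub>M lborel) (\<lambda>(x, y). F x y * spec_norm (K x y))"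
  proof (rule integrable_F_bound[OF Fg])
    show "spec_norm (K x y) \<le> 1 + g x y" for x y
      using VKg[of x y] zero_le_power2[of "norm (V x y)"] by linarith
    show "0 \<le> spec_norm (K x y)" for x y by (rule spec_norm_nonneg)
  qed measurable
  have FVK: "integrable (lborel \<Otimes>\<^sub>M lborel) (\<lambda>(x, y). F x y * (2 * (norm (V x y))\<^sup>2 + spec_norm (K x y)))"
  proof (rule integrable_F_bound[OF Fg])
    show "2 * (norm (V x y))\<^sup>2 + spec_norm (K x y) \<le> 1 + g x y" for x y using VKg[of x y] by linarith
    show "0 \<le> 2 * (norm (V x y))\<^sup>2 + spec_norm (K x y)" for x y by (intro add_nonneg_nonneg spec_norm_nonneg) auto
  qed measurable
  have "AE x in lborel. integrable lborel (\<lambda>y. F x y * g x y)"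
      "AE x in lborel. integrable lborel (\<lambda>y. F x y * (2 * (norm (V x y))\<^sup>2 + spec_norm (K x y)))"
    using lborel_pair.AE_integrable_fst'[OF Fg] lborel_pair.AE_integrable_fst'[OF FVK] by simp_all
  with AE_spec_norm_hess[OF FV FV2 FK]
  have "AE x in lborel. spec_norm (hess (\<lambda>z. ln (\<rho>t z)) x) \<le> (\<integral>y. F x y * g x y \<partial>lborel) / \<rho>t x"
  proof eventually_elim
    case (elim x)
    have "(\<integral>y. F x y * (2 * (norm (V x y))\<^sup>2 + spec_norm (K x y)) \<partial>lborel) \<le> (\<integral>y. F x y * g x y \<partial>lborel)"
      by (intro integral_mono elim mult_left_mono VKg F_nonneg)
    then have "(\<integral>y. F x y * (2 * (norm (V x y))\<^sup>2 + spec_norm (K x y)) \<partial>lborel) / \<rho>t x \<le> (\<integral>y. F x y * g x y \<partial>lborel) / \<rho>t x"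
      using \<rho>t_pos[of x] by (intro divide_right_mono) auto
    with elim(1) show ?case by (rule order_trans)
  qed
  from averaged_powr[OF p gm g0 Fg spec_norm_nonneg this] have "?L \<le> ?I" .
  then show ?thesis using I by (rule order_trans)
qed

end

section \<open>The law of Gaussian increments\<close>

lemma measure_eqI_box:
  fixes M N :: "'a::euclidean_space measure"
  assumes sets: "sets M = sets borel" "sets N = sets borel"
    and fin: "\<And>l u. emeasure M (box l u) \<noteq> \<infinity>"
    and eq: "\<And>l u. emeasure M (box l u) = emeasure N (box l u)"
  shows "M = N"
proof (rule measure_eqI_generator_eq)
  let ?E = "range (\<lambda>(a, b). box a b::'a set)"
  show "Int_stable ?E"
    by (auto simp: Int_stable_def box_Int_box)
  show "?E \<subseteq> Pow UNIV" "sets M = sigma_sets UNIV ?E" "sets N = sigma_sets UNIV ?E"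
    by (simp_all add: borel_eq_box sets)
  let ?A = "\<lambda>n::nat. box (- (real n *\<^sub>R One)) (real n *\<^sub>R One) :: 'a set"
  show "range ?A \<subseteq> ?E" "(\<Union>i. ?A i) = UNIV"
    unfolding UN_box_eq_UNIV by auto
  show "emeasure M (?A i) \<noteq> \<infinity>" for i by (rule fin)
  show "emeasure M X = emeasure N X" if "X \<in> ?E" for X using that eq by auto
qed

lemma prod_Basis_vec:
  fixes g :: "real^'m::finite \<Rightarrow> 'c::comm_monoid_mult"
  shows "(\<Prod>b\<in>Basis. g b) = (\<Prod>i\<in>UNIV. g (axis i 1))"
proof -
  have B: "Basis = range (\<lambda>i::'m. axis i (1::real))" by (auto simp: Basis_vec_def)
  have inj: "inj (\<lambda>i::'m. axis i (1::real))" by (auto simp: inj_on_def axis_eq_axis)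
  show ?thesis unfolding B prod.reindex[OF inj] comp_def ..
qed

lemma box_vec_eq: "x \<in> box l u \<longleftrightarrow> (\<forall>i. x $ i \<in> {l $ i<..<u $ i})" for x :: "real^'m::finite"
  by (auto simp: mem_box Basis_vec_def inner_axis)

text \<open>Both laws give the same mass to boxes, which is a product of one-dimensional normal probabilities.
The normalising factor \<open>c\<close> is characterised by the total mass only, the form in which the pushforward
under a linear map needs it.\<close>

lemma (in prob_space) distr_normal_vector:
  fixes D :: "'a \<Rightarrow> real^'m::finite"
  assumes v: "v > 0" and D[measurable]: "D \<in> borel_measurable M"
    and indep: "indep_vars (\<lambda>_. borel) (\<lambda>i \<omega>. D \<omega> $ i) UNIV"
    and normal: "\<And>i. distributed M lborel (\<lambda>\<omega>. D \<omega> $ i) (normal_density 0 (sqrt v))"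
  obtains c where "c * (\<integral>\<^sup>+w. ennreal (exp (- (1 / (2 * v)) * (norm (w::real^'m))\<^sup>2)) \<partial>lborel) = 1"
    and "distr M borel D = density lborel (\<lambda>w. c * ennreal (exp (- (1 / (2 * v)) * (norm w)\<^sup>2)))"
proof -
  let ?g = "\<lambda>w::real^'m. ennreal (exp (- (1 / (2 * v)) * (norm w)\<^sup>2))"
  define c0 where "c0 = 1 / sqrt (2 * pi * v)"
  have c0: "c0 > 0" using v by (simp add: c0_def)
  define c where "c = ennreal (c0 ^ DIM(real^'m))"
  have dens: "(\<Prod>b\<in>Basis. ennreal (normal_density 0 (sqrt v) (w \<bullet> b))) = c * ?g w" for w :: "real^'m"
  proof -
    have nd: "normal_density 0 (sqrt v) r = c0 * exp (- (1 / (2 * v)) * r\<^sup>2)" for r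
      using v by (simp add: normal_density_def c0_def)
    have "(\<Prod>b\<in>Basis. normal_density 0 (sqrt v) (w \<bullet> b)) = c0 ^ DIM(real^'m) * (\<Prod>b\<in>Basis. exp (- (1 / (2 * v)) * (w \<bullet> b)\<^sup>2))"
      unfolding nd prod.distrib prod_constant ..
    also have "(\<Prod>b\<in>Basis. exp (- (1 / (2 * v)) * (w \<bullet> b)\<^sup>2)) = exp (- (1 / (2 * v)) * (norm w)\<^sup>2)"
      unfolding exp_sum[OF finite_Basis, symmetric] sum_distrib_left[symmetric] power2_norm_eq_inner
        euclidean_inner[of w w] by (simp add: power2_eq_square)
    finally show ?thesis
      using v c0 by (simp add: prod_ennreal c_def ennreal_mult'[symmetric])
  qed
  have [measurable]: "?g \<in> borel_measurable borel" by measurable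
  have eq: "distr M borel D = density lborel (\<lambda>w. c * ?g w)"
  proof (rule measure_eqI_box)
    fix l u :: "real^'m"
    interpret D: prob_space "distr M borel D" by (rule prob_space_distr) measurable
    show "emeasure (distr M borel D) (box l u) \<noteq> \<infinity>" by simp
    have "emeasure (distr M borel D) (box l u) = emeasure M (\<Inter>i\<in>UNIV. (\<lambda>\<omega>. D \<omega> $ i) -` {l $ i<..<u $ i} \<inter> space M)"
      by (subst emeasure_distr) (auto intro!: arg_cong[where f="emeasure M"] simp: box_vec_eq)
    also have "\<dots> = ennreal (\<Prod>i\<in>UNIV. prob ((\<lambda>\<omega>. D \<omega> $ i) -` {l $ i<..<u $ i} \<inter> space M))"
      unfolding emeasure_eq_measure by (subst indep_varsD_finite[OF indep]) auto
    also have "\<dots> = (\<Prod>i\<in>UNIV. emeasure M ((\<lambda>\<omega>. D \<omega> $ i) -` {l $ i<..<u $ i} \<inter> space M))"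
      by (simp add: prod_ennreal[symmetric] emeasure_eq_measure)
    also have "\<dots> = (\<Prod>i\<in>UNIV. \<integral>\<^sup>+r. ennreal (normal_density 0 (sqrt v) r) * indicator {l $ i<..<u $ i} r \<partial>lborel)"
      by (intro prod.cong refl distributed_emeasure[OF normal]) simp
    also have "\<dots> = (\<Prod>b\<in>(Basis::(real^'m) set). \<integral>\<^sup>+r. ennreal (normal_density 0 (sqrt v) r) * indicator {l \<bullet> b<..<u \<bullet> b} r \<partial>lborel)"
      by (simp add: prod_Basis_vec inner_axis)
    also have "\<dots> = (\<integral>\<^sup>+w. (\<Prod>b\<in>Basis. ennreal (normal_density 0 (sqrt v) (w \<bullet> b)) * indicator {l \<bullet> b<..<u \<bullet> b} (w \<bullet> b)) \<partial>lborel)"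
      by (rule nn_integral_lborel_prod[symmetric]) auto
    also have "\<dots> = (\<integral>\<^sup>+w. (c * ?g w) * indicator (box l u) w \<partial>lborel)"
    proof (intro nn_integral_cong)
      fix w :: "real^'m"
      have "(\<Prod>b\<in>Basis. indicator {l \<bullet> b<..<u \<bullet> b} (w \<bullet> b) :: ennreal) = indicator (box l u) w"
        by (auto simp: indicator_def mem_box prod_eq_1_iff intro!: prod_zero)
      then show "(\<Prod>b\<in>Basis. ennreal (normal_density 0 (sqrt v) (w \<bullet> b)) * indicator {l \<bullet> b<..<u \<bullet> b} (w \<bullet> b))
          = (c * ?g w) * indicator (box l u) w"
        by (simp only: prod.distrib dens)
    qed
    also have "\<dots> = emeasure (density lborel (\<lambda>w. c * ?g w)) (box l u)"
      by (subst emeasure_density) auto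
    finally show "emeasure (distr M borel D) (box l u) = emeasure (density lborel (\<lambda>w. c * ?g w)) (box l u)" .
  qed auto
  have "c * (\<integral>\<^sup>+w. ?g w \<partial>lborel) = emeasure (distr M borel D) UNIV"
    unfolding eq by (subst emeasure_density) (auto simp: nn_integral_cmult)
  also have "\<dots> = 1"
    by (subst emeasure_distr) (auto simp: emeasure_space_1)
  finally show thesis using eq that by blast
qed

lemma continuous_AE_eq:
  fixes f g :: "'a::euclidean_space \<Rightarrow> real"
  assumes f: "continuous_on UNIV f" and g: "continuous_on UNIV g" and eq: "AE x in lborel. f x = g x"
  shows "f x = g x"
proof -
  have "open {x. f x \<noteq> g x}" using f g by (intro open_Collect_neq)
  moreover have "negligible {x. f x \<noteq> g x}"
    using AE_completion[OF eq] unfolding eventually_ae_filter_negligible by (auto intro: negligible_subset)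
  ultimately show ?thesis using open_not_negligible by blast
qed

lemma (in elliptic_step) nn_integral_step:
  assumes [measurable]: "\<phi> \<in> borel_measurable borel"
    and c: "c * (\<integral>\<^sup>+w. ennreal (exp (- (1 / (2 * \<delta>)) * (norm (w::real^'m))\<^sup>2)) \<partial>lborel) = 1"
    and N: "N = density lborel (\<lambda>w. c * ennreal (exp (- (1 / (2 * \<delta>)) * (norm w)\<^sup>2)))"
  shows "(\<integral>\<^sup>+w. \<phi> (y + \<delta> *\<^sub>R \<beta> y + S y *v w) \<partial>N) = (\<integral>\<^sup>+x. \<phi> x * ennreal (kernel x y) \<partial>lborel)"
proof -
  have [measurable]: "(\<lambda>w. S y *v w) \<in> borel_measurable borel"
    by (intro borel_measurable_continuous_onI linear_continuous_on matrix_vector_mul_bounded_linear)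
  have "(\<integral>\<^sup>+w. \<phi> (step_mean y + S y *v w) \<partial>N)
    = (\<integral>\<^sup>+w. \<phi> (step_mean y + S y *v w) * (c * ennreal (exp (- (1 / (2 * \<delta>)) * (norm w)\<^sup>2))) \<partial>lborel)"
    unfolding N by (subst nn_integral_density) (auto simp: mult.commute)
  then show ?thesis using Gaussian_pushforward[OF assms(1) c, of y] by (simp add: step_mean_def)
qed

section \<open>The law of the chain\<close>

text \<open>A chain of \<open>k + 1\<close> steps with independent Gaussian noises that are also independent of the initial
value.  The last step has index \<open>k\<close>; each step may have its own length.\<close>

locale gaussian_chain = prob_space M for M :: "'w measure" +
  fixes X0 :: "'w \<Rightarrow> real^'d::finite" and \<rho>0 :: "real^'d \<Rightarrow> real" and k :: nat
    and D :: "nat \<Rightarrow> 'w \<Rightarrow> real^'m::finite" and \<delta> :: "nat \<Rightarrow> real" and \<kappa> :: real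
    and \<beta> :: "nat \<Rightarrow> real^'d \<Rightarrow> real^'d" and S :: "nat \<Rightarrow> real^'d \<Rightarrow> real^'m^'d"
  assumes steps: "\<And>j. elliptic_step (\<delta> j) \<kappa> (\<beta> j) (S j)"
    and X0: "distributed M lborel X0 (\<lambda>x. ennreal (\<rho>0 x))"
    and D_measurable [measurable]: "\<And>j. D j \<in> borel_measurable M"
    and indep_X0: "distr M (borel \<Otimes>\<^sub>M Pi\<^sub>M {..<Suc k} (\<lambda>_. borel)) (\<lambda>\<omega>. (X0 \<omega>, \<lambda>j\<in>{..<Suc k}. D j \<omega>))
      = distr M borel X0 \<Otimes>\<^sub>M distr M (Pi\<^sub>M {..<Suc k} (\<lambda>_. borel)) (\<lambda>\<omega>. \<lambda>j\<in>{..<Suc k}. D j \<omega>)"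
    and indep_D: "indep_vars (\<lambda>_. borel) D {..<Suc k}"
    and noise: "\<And>j. j < Suc k \<Longrightarrow> \<exists>c. c * (\<integral>\<^sup>+w. ennreal (exp (- (1 / (2 * \<delta> j)) * (norm (w::real^'m))\<^sup>2)) \<partial>lborel) = 1 \<and>
      distr M borel (D j) = density lborel (\<lambda>w. c * ennreal (exp (- (1 / (2 * \<delta> j)) * (norm w)\<^sup>2)))"
begin

definition step :: "nat \<Rightarrow> real^'d \<Rightarrow> real^'m \<Rightarrow> real^'d" where
  "step j u w = u + \<delta> j *\<^sub>R \<beta> j u + S j u *v w"

primrec flow :: "nat \<Rightarrow> real^'d \<Rightarrow> (nat \<Rightarrow> real^'m) \<Rightarrow> real^'d" where
  "flow 0 y v = y"
| "flow (Suc j) y v = step j (flow j y v) (v j)"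

abbreviation kern :: "nat \<Rightarrow> real^'d \<Rightarrow> real^'d \<Rightarrow> real" where
  "kern j \<equiv> elliptic_step.kernel (\<delta> j) (\<beta> j) (S j)"

text \<open>The transition density over the steps \<open>0, \<dots>, j\<close>, that is, over \<open>j + 1\<close> steps.\<close>

primrec dens :: "nat \<Rightarrow> real^'d \<Rightarrow> real^'d \<Rightarrow> real" where
  "dens 0 = kern 0"
| "dens (Suc j) = chain (kern (Suc j)) (dens j)"

definition L :: "nat \<Rightarrow> (real^'m) measure" where
  "L j = distr M borel (D j)"

abbreviation noises :: "'w \<Rightarrow> nat \<Rightarrow> real^'m" where
  "noises \<omega> \<equiv> \<lambda>j\<in>{..<Suc k}. D j \<omega>"

lemma smooth_kernel_kern: "smooth_kernel (kern j)"
  by (rule elliptic_step.smooth_kernel_kernel[OF steps])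

lemma kern_smooth_density: "smooth_density (kern j)"
  using smooth_kernel_kern[of j] by (simp add: smooth_kernel_def)

lemma dens_smooth_density: "smooth_density (dens j)"
  by (induction j) (auto intro: kern_smooth_density smooth_density_chain smooth_kernel_kern)

lemma kern_measurable [measurable]: "(\<lambda>(x, u). kern j x u) \<in> borel_measurable (borel \<Otimes>\<^sub>M borel)"
  by (rule smooth_densityD(5)[OF kern_smooth_density])

lemma dens_measurable [measurable]: "(\<lambda>(x, u). dens j x u) \<in> borel_measurable (borel \<Otimes>\<^sub>M borel)"
  by (rule smooth_densityD(5)[OF dens_smooth_density])

lemma prob_space_L: "prob_space (L j)"
  unfolding L_def by (rule prob_space_distr) simp

lemma sets_L [measurable_cong, simp]: "sets (L j) = sets borel"
  by (simp add: L_def)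

sublocale noise_product: product_sigma_finite L
  by (rule product_sigma_finite.intro) (rule prob_space_imp_sigma_finite[OF prob_space_L])

lemma step_measurable [measurable]: "(\<lambda>(u, w). step j u w) \<in> borel_measurable (borel \<Otimes>\<^sub>M borel)"
proof -
  interpret elliptic_step "\<delta> j" \<kappa> "\<beta> j" "S j" by (rule steps)
  have [measurable]: "\<beta> j \<in> borel_measurable borel"
    using Ck_on_continuous[OF \<beta>] by (rule borel_measurable_continuous_onI)
  have [measurable]: "(\<lambda>u. S j u $ i $ l) \<in> borel_measurable borel" for i l
    using Ck_on_continuous[OF Ck_on_vec_nth[OF Ck_on_vec_nth[OF S]]] by (rule borel_measurable_continuous_onI)
  have [measurable]: "(\<lambda>w::real^'m. w $ l) \<in> borel_measurable borel" for l
    by (intro borel_measurable_continuous_onI continuous_intros)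
  have [measurable]: "(\<lambda>z::(real^'d) \<times> (real^'m). S j (fst z) $ i $ l) \<in> borel_measurable (borel \<Otimes>\<^sub>M borel)" for i l
    by (rule measurable_compose[OF measurable_fst]) measurable
  have [measurable]: "(\<lambda>z::(real^'d) \<times> (real^'m). snd z $ l) \<in> borel_measurable (borel \<Otimes>\<^sub>M borel)" for l
    by (rule measurable_compose[OF measurable_snd]) measurable
  have [measurable]: "(\<lambda>z. S j (fst z) *v snd z) \<in> borel_measurable (borel \<Otimes>\<^sub>M borel)"
    by (rule borel_measurable_vecI) (simp add: matrix_vector_mult_def)
  then show ?thesis unfolding step_def case_prod_unfold by measurable
qed

lemma flow_measurable:
  "j \<le> m \<Longrightarrow> (\<lambda>z. flow j (fst z) (snd z)) \<in> borel_measurable (borel \<Otimes>\<^sub>M Pi\<^sub>M {..<m} (\<lambda>_. borel))"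
proof (induction j)
  case (Suc j)
  have [measurable]: "(\<lambda>z. flow j (fst z) (snd z)) \<in> borel_measurable (borel \<Otimes>\<^sub>M Pi\<^sub>M {..<m} (\<lambda>_. borel))"
    using Suc by simp
  have [measurable]: "(\<lambda>z. snd z j) \<in> borel_measurable (borel \<Otimes>\<^sub>M Pi\<^sub>M {..<m} (\<lambda>_. borel))"
    using Suc.prems by (intro measurable_compose[OF measurable_snd measurable_component_singleton]) auto
  show ?case by simp
qed simp

lemma sets_PiM_L: "sets (Pi\<^sub>M I L) = sets (Pi\<^sub>M I (\<lambda>_. borel))"
  by (rule sets_PiM_cong) simp_all

lemma flow_measurable_L: "j \<le> m \<Longrightarrow> flow j y \<in> borel_measurable (Pi\<^sub>M {..<m} L)"
proof -
  assume "j \<le> m"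
  have "(\<lambda>v. flow j (fst (y, v)) (snd (y, v))) \<in> borel_measurable (Pi\<^sub>M {..<m} (\<lambda>_. borel))"
    by (rule measurable_compose[OF measurable_Pair1' flow_measurable[OF \<open>j \<le> m\<close>]]) simp
  then show ?thesis by (simp add: measurable_cong_sets[OF sets_PiM_L refl])
qed

lemma flow_update: "j \<le> m \<Longrightarrow> flow j y (v(m := w)) = flow j y v"
  by (induction j) auto

text \<open>The last noise is independent of the position before the step, so that integrating it out
applies the transition kernel.\<close>

lemma nn_integral_last_step:
  assumes j: "j < Suc k" and [measurable]: "\<phi> \<in> borel_measurable borel"
  shows "(\<integral>\<^sup>+v. \<phi> (flow (Suc j) y v) \<partial>Pi\<^sub>M {..<Suc j} L)
    = (\<integral>\<^sup>+v. (\<integral>\<^sup>+x. \<phi> x * ennreal (kern j x (flow j y v)) \<partial>lborel) \<partial>Pi\<^sub>M {..<j} L)"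
proof -
  have m: "(\<lambda>v. \<phi> (flow (Suc j) y v)) \<in> borel_measurable (Pi\<^sub>M {..<Suc j} L)"
    by (rule measurable_compose[OF flow_measurable_L assms(2)]) simp
  obtain c where c: "c * (\<integral>\<^sup>+w. ennreal (exp (- (1 / (2 * \<delta> j)) * (norm (w::real^'m))\<^sup>2)) \<partial>lborel) = 1"
      "L j = density lborel (\<lambda>w. c * ennreal (exp (- (1 / (2 * \<delta> j)) * (norm w)\<^sup>2)))"
    using noise[OF j] unfolding L_def by blast
  have "(\<integral>\<^sup>+v. \<phi> (flow (Suc j) y v) \<partial>Pi\<^sub>M {..<Suc j} L)
      = (\<integral>\<^sup>+v. (\<integral>\<^sup>+w. \<phi> (flow (Suc j) y (v(j := w))) \<partial>L j) \<partial>Pi\<^sub>M {..<j} L)"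
    using m unfolding lessThan_Suc by (intro noise_product.product_nn_integral_insert) auto
  also have "\<dots> = (\<integral>\<^sup>+v. (\<integral>\<^sup>+w. \<phi> (flow j y v + \<delta> j *\<^sub>R \<beta> j (flow j y v) + S j (flow j y v) *v w) \<partial>L j) \<partial>Pi\<^sub>M {..<j} L)"
    by (simp add: flow_update step_def)
  also have "\<dots> = (\<integral>\<^sup>+v. (\<integral>\<^sup>+x. \<phi> x * ennreal (kern j x (flow j y v)) \<partial>lborel) \<partial>Pi\<^sub>M {..<j} L)"
    by (intro nn_integral_cong elliptic_step.nn_integral_step[OF steps _ c]) measurable
  finally show ?thesis .
qed

lemma nn_integral_flow:
  assumes j: "j < Suc k" and \<phi>: "\<phi> \<in> borel_measurable borel"
  shows "(\<integral>\<^sup>+v. \<phi> (flow (Suc j) y v) \<partial>Pi\<^sub>M {..<Suc j} L) = (\<integral>\<^sup>+x. \<phi> x * ennreal (dens j x y) \<partial>lborel)"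
  using j \<phi>
proof (induction j arbitrary: \<phi>)
  case 0
  note [measurable] = 0(2)
  show ?case
    by (subst nn_integral_last_step[OF 0]) (simp add: PiM_empty nn_integral_count_space_finite)
next
  case (Suc j)
  note [measurable] = Suc.prems(2)
  let ?g = "kern (Suc j)"
  have "(\<integral>\<^sup>+v. \<phi> (flow (Suc (Suc j)) y v) \<partial>Pi\<^sub>M {..<Suc (Suc j)} L)
      = (\<integral>\<^sup>+v. (\<integral>\<^sup>+x. \<phi> x * ennreal (?g x (flow (Suc j) y v)) \<partial>lborel) \<partial>Pi\<^sub>M {..<Suc j} L)"
    by (rule nn_integral_last_step[OF Suc.prems])
  also have "\<dots> = (\<integral>\<^sup>+u. (\<integral>\<^sup>+x. \<phi> x * ennreal (?g x u) \<partial>lborel) * ennreal (dens j u y) \<partial>lborel)"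
    using Suc.prems by (intro Suc.IH) auto
  also have "\<dots> = (\<integral>\<^sup>+u. (\<integral>\<^sup>+x. \<phi> x * (ennreal (?g x u) * ennreal (dens j u y)) \<partial>lborel) \<partial>lborel)"
    by (intro nn_integral_cong, subst nn_integral_multc[symmetric]) (auto simp: mult.assoc)
  also have "\<dots> = (\<integral>\<^sup>+x. (\<integral>\<^sup>+u. \<phi> x * (ennreal (?g x u) * ennreal (dens j u y)) \<partial>lborel) \<partial>lborel)"
    by (rule lborel_pair.Fubini') measurable
  also have "\<dots> = (\<integral>\<^sup>+x. \<phi> x * ennreal (dens (Suc j) x y) \<partial>lborel)"
    by (intro nn_integral_cong, subst nn_integral_cmult)
      (auto simp: nn_integral_chain[OF smooth_kernel_kern dens_smooth_density])
  finally show ?case .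
qed

lemma X0_measurable [measurable]: "X0 \<in> borel_measurable M"
  using X0 by (simp add: distributed_def)

lemma \<rho>0_ennreal_measurable [measurable]: "(\<lambda>x. ennreal (\<rho>0 x)) \<in> borel_measurable borel"
  using X0 by (simp add: distributed_def)

lemma noises_measurable [measurable]: "noises \<in> measurable M (Pi\<^sub>M {..<Suc k} (\<lambda>_. borel))"
  by measurable

lemma distr_noises: "distr M (Pi\<^sub>M {..<Suc k} (\<lambda>_. borel)) noises = Pi\<^sub>M {..<Suc k} L"
  using indep_D by (subst (asm) indep_vars_iff_distr_eq_PiM) (auto simp: L_def[abs_def])

lemma nn_integral_X0_noises:
  assumes f[measurable]: "f \<in> borel_measurable (borel \<Otimes>\<^sub>M Pi\<^sub>M {..<Suc k} (\<lambda>_. borel))"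
  shows "(\<integral>\<^sup>+\<omega>. f (X0 \<omega>, noises \<omega>) \<partial>M) = (\<integral>\<^sup>+y. ennreal (\<rho>0 y) * (\<integral>\<^sup>+v. f (y, v) \<partial>Pi\<^sub>M {..<Suc k} L) \<partial>lborel)"
proof -
  interpret P: prob_space "Pi\<^sub>M {..<Suc k} L" by (rule prob_space_PiM) (rule prob_space_L)
  have X0d: "distr M borel X0 = density lborel (\<lambda>x. ennreal (\<rho>0 x))"
    using X0 by (simp add: distributed_def cong: distr_cong)
  have f'[measurable]: "f \<in> borel_measurable (borel \<Otimes>\<^sub>M Pi\<^sub>M {..<Suc k} L)"
    using f by (subst measurable_cong_sets[OF sets_pair_measure_cong[OF refl sets_PiM_L] refl])
  have "(\<integral>\<^sup>+\<omega>. f (X0 \<omega>, noises \<omega>) \<partial>M) = (\<integral>\<^sup>+z. f z \<partial>distr M (borel \<Otimes>\<^sub>M Pi\<^sub>M {..<Suc k} (\<lambda>_. borel)) (\<lambda>\<omega>. (X0 \<omega>, noises \<omega>)))"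
    by (subst nn_integral_distr) auto
  also have "distr M (borel \<Otimes>\<^sub>M Pi\<^sub>M {..<Suc k} (\<lambda>_. borel)) (\<lambda>\<omega>. (X0 \<omega>, noises \<omega>))
      = distr M borel X0 \<Otimes>\<^sub>M Pi\<^sub>M {..<Suc k} L"
    unfolding indep_X0 distr_noises ..
  also have "(\<integral>\<^sup>+z. f z \<partial>(distr M borel X0 \<Otimes>\<^sub>M Pi\<^sub>M {..<Suc k} L))
      = (\<integral>\<^sup>+y. (\<integral>\<^sup>+v. f (y, v) \<partial>Pi\<^sub>M {..<Suc k} L) \<partial>distr M borel X0)"
  proof (rule P.nn_integral_fst[symmetric])
    show "f \<in> borel_measurable (distr M borel X0 \<Otimes>\<^sub>M Pi\<^sub>M {..<Suc k} L)"
      using f by (subst measurable_cong_sets[OF sets_pair_measure_cong[OF sets_distr sets_PiM_L] refl])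
  qed
  also have "\<dots> = (\<integral>\<^sup>+y. ennreal (\<rho>0 y) * (\<integral>\<^sup>+v. f (y, v) \<partial>Pi\<^sub>M {..<Suc k} L) \<partial>lborel)"
    unfolding X0d by (subst nn_integral_density) auto
  finally show ?thesis .
qed

proposition nn_integral_joint:
  assumes \<phi>[measurable]: "\<phi> \<in> borel_measurable (borel \<Otimes>\<^sub>M borel)"
  shows "(\<integral>\<^sup>+\<omega>. \<phi> (flow (Suc k) (X0 \<omega>) (noises \<omega>), X0 \<omega>) \<partial>M)
    = (\<integral>\<^sup>+y. \<integral>\<^sup>+x. \<phi> (x, y) * (ennreal (dens k x y) * ennreal (\<rho>0 y)) \<partial>lborel \<partial>lborel)"
proof -
  note [measurable] = flow_measurable[of "Suc k" "Suc k", OF order_refl]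
  have "(\<integral>\<^sup>+\<omega>. \<phi> (flow (Suc k) (X0 \<omega>) (noises \<omega>), X0 \<omega>) \<partial>M)
      = (\<integral>\<^sup>+y. ennreal (\<rho>0 y) * (\<integral>\<^sup>+v. \<phi> (flow (Suc k) y v, y) \<partial>Pi\<^sub>M {..<Suc k} L) \<partial>lborel)"
    using nn_integral_X0_noises[of "\<lambda>z. \<phi> (flow (Suc k) (fst z) (snd z), fst z)"] by (simp del: flow.simps)
  also have "\<dots> = (\<integral>\<^sup>+y. ennreal (\<rho>0 y) * (\<integral>\<^sup>+x. \<phi> (x, y) * ennreal (dens k x y) \<partial>lborel) \<partial>lborel)"
    by (intro nn_integral_cong arg_cong2[where f="(*)"] refl nn_integral_flow) auto
  also have "\<dots> = (\<integral>\<^sup>+y. \<integral>\<^sup>+x. \<phi> (x, y) * (ennreal (dens k x y) * ennreal (\<rho>0 y)) \<partial>lborel \<partial>lborel)"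
    by (intro nn_integral_cong, subst nn_integral_cmult[symmetric]) (auto simp: mult_ac)
  finally show ?thesis .
qed

text \<open>Averaging the last kernel over the position before the last step gives the marginal density at \<open>x\<close> for
every \<open>x\<close>, not merely almost everywhere.  The left-hand side makes visible that it is smooth in \<open>x\<close>.\<close>

proposition nn_integral_kern:
  "(\<integral>\<^sup>+\<omega>. ennreal (kern k x (flow k (X0 \<omega>) (noises \<omega>))) \<partial>M) = (\<integral>\<^sup>+y. ennreal (dens k x y) * ennreal (\<rho>0 y) \<partial>lborel)"
proof -
  note [measurable] = flow_measurable[of k "Suc k", simplified]
  have drop: "(\<integral>\<^sup>+v. ennreal (kern k x (flow k y v)) \<partial>Pi\<^sub>M {..<Suc k} L) = (\<integral>\<^sup>+v. ennreal (kern k x (flow k y v)) \<partial>Pi\<^sub>M {..<k} L)" for y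
  proof -
    have m: "(\<lambda>v. ennreal (kern k x (flow k y v))) \<in> borel_measurable (Pi\<^sub>M {..<Suc k} L)"
      by (rule measurable_compose[OF flow_measurable_L]) (simp, measurable)
    interpret Lk: prob_space "L k" by (rule prob_space_L)
    have "(\<integral>\<^sup>+v. ennreal (kern k x (flow k y v)) \<partial>Pi\<^sub>M {..<Suc k} L)
       = (\<integral>\<^sup>+v. (\<integral>\<^sup>+w. ennreal (kern k x (flow k y (v(k := w)))) \<partial>L k) \<partial>Pi\<^sub>M {..<k} L)"
      using m unfolding lessThan_Suc by (intro noise_product.product_nn_integral_insert) auto
    then show ?thesis by (simp add: flow_update Lk.emeasure_space_1)
  qed
  have inner: "(\<integral>\<^sup>+v. ennreal (kern k x (flow k y v)) \<partial>Pi\<^sub>M {..<k} L) = ennreal (dens k x y)" for y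
  proof (cases k)
    case 0
    then show ?thesis by (simp add: PiM_empty nn_integral_count_space_finite)
  next
    case (Suc j)
    have "(\<integral>\<^sup>+v. ennreal (kern k x (flow k y v)) \<partial>Pi\<^sub>M {..<k} L) = (\<integral>\<^sup>+u. ennreal (kern k x u) * ennreal (dens j u y) \<partial>lborel)"
      unfolding Suc using nn_integral_flow[of j "\<lambda>u. ennreal (kern (Suc j) x u)"] Suc by (simp del: flow.simps)
    then show ?thesis by (simp add: Suc nn_integral_chain[OF smooth_kernel_kern dens_smooth_density])
  qed
  have "(\<integral>\<^sup>+\<omega>. ennreal (kern k x (flow k (X0 \<omega>) (noises \<omega>))) \<partial>M)
      = (\<integral>\<^sup>+y. ennreal (\<rho>0 y) * (\<integral>\<^sup>+v. ennreal (kern k x (flow k y v)) \<partial>Pi\<^sub>M {..<Suc k} L) \<partial>lborel)"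
    using nn_integral_X0_noises[of "\<lambda>z. ennreal (kern k x (flow k (fst z) (snd z)))"] by simp
  then show ?thesis by (simp only: drop inner mult.commute)
qed

end

text \<open>Independence of a variable and a whole path passes to a functional of the path.  It is stated with product
measures because the two variables take values in different types.\<close>

lemma (in prob_space) distr_pair_indep_set:
  assumes indep: "indep_set (sets (vimage_algebra (space M) X borel)) (sets (vimage_algebra (space M) P N))"
    and X[measurable]: "X \<in> borel_measurable M" and P: "P \<in> space M \<rightarrow> space N" and G: "G \<in> measurable N N'"
  shows "distr M (borel \<Otimes>\<^sub>M N') (\<lambda>\<omega>. (X \<omega>, G (P \<omega>))) = distr M borel X \<Otimes>\<^sub>M distr M N' (\<lambda>\<omega>. G (P \<omega>))"
proof -
  have V: "(\<lambda>\<omega>. G (P \<omega>)) \<in> measurable (vimage_algebra (space M) P N) N'"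
    by (rule measurable_compose[OF measurable_vimage_algebra1[OF P] G])
  have sub: "sets (vimage_algebra (space M) P N) \<subseteq> sets M" using indep_setD_ev2[OF indep] .
  have GP[measurable]: "(\<lambda>\<omega>. G (P \<omega>)) \<in> measurable M N'"
    using V sub by (auto simp: measurable_def)
  show ?thesis
  proof (rule pair_measure_eqI[symmetric])
    show "sigma_finite_measure (distr M borel X)" "sigma_finite_measure (distr M N' (\<lambda>\<omega>. G (P \<omega>)))"
      by (auto intro!: prob_space_imp_sigma_finite prob_space_distr)
    show "sets (distr M borel X \<Otimes>\<^sub>M distr M N' (\<lambda>\<omega>. G (P \<omega>))) = sets (distr M (borel \<Otimes>\<^sub>M N') (\<lambda>\<omega>. (X \<omega>, G (P \<omega>))))"
      by (simp cong: sets_pair_measure_cong)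
    fix A B assume A: "A \<in> sets (distr M borel X)" and B: "B \<in> sets (distr M N' (\<lambda>\<omega>. G (P \<omega>)))"
    then have [measurable]: "A \<in> sets borel" "B \<in> sets N'" by auto
    let ?a = "X -` A \<inter> space M" and ?b = "(\<lambda>\<omega>. G (P \<omega>)) -` B \<inter> space M"
    have a: "?a \<in> sets (vimage_algebra (space M) X borel)" by (rule in_vimage_algebra) simp
    have b: "?b \<in> sets (vimage_algebra (space M) P N)"
      using measurable_sets[OF V] by simp
    have "emeasure (distr M (borel \<Otimes>\<^sub>M N') (\<lambda>\<omega>. (X \<omega>, G (P \<omega>)))) (A \<times> B) = emeasure M (?a \<inter> ?b)"
      by (subst emeasure_distr) (auto intro!: arg_cong[where f="emeasure M"])
    also have "\<dots> = emeasure M ?a * emeasure M ?b"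
      using indep_setD[OF indep a b] by (simp add: emeasure_eq_measure ennreal_mult)
    finally show "emeasure (distr M borel X) A * emeasure (distr M N' (\<lambda>\<omega>. G (P \<omega>))) B
        = emeasure (distr M (borel \<Otimes>\<^sub>M N') (\<lambda>\<omega>. (X \<omega>, G (P \<omega>)))) (A \<times> B)"
      by (simp add: emeasure_distr)
  qed
qed

lemma twice_differentiable_continuous: "twice_differentiable \<rho> \<Longrightarrow> continuous_on UNIV \<rho>"
  unfolding twice_differentiable_def
  by (auto intro!: differentiable_imp_continuous_on simp: differentiable_on_def)

context gaussian_chain
begin

lemma flow_noises_measurable:
  "j \<le> Suc k \<Longrightarrow> (\<lambda>\<omega>. flow j (X0 \<omega>) (noises \<omega>)) \<in> borel_measurable M"
  using measurable_compose[OF measurable_Pair[OF X0_measurable noises_measurable] flow_measurable[of j "Suc k"]] by simp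

lemma dens_pos: "0 < dens k x y"
  by (rule smooth_densityD(1)[OF dens_smooth_density])

proposition joint_distributed:
  assumes pos: "\<And>y. 0 < \<rho>0 y" and Y[measurable]: "Y \<in> borel_measurable M"
    and flow: "AE \<omega> in M. Y \<omega> = flow (Suc k) (X0 \<omega>) (noises \<omega>)"
  shows "distributed M (lborel \<Otimes>\<^sub>M lborel) (\<lambda>\<omega>. (Y \<omega>, X0 \<omega>)) (\<lambda>(x, y). ennreal (dens k x y * \<rho>0 y))"
proof -
  have [measurable]: "\<rho>0 \<in> borel_measurable borel"
    using \<rho>0_ennreal_measurable pos measurable_compose[OF \<rho>0_ennreal_measurable borel_measurable_enn2real] by (simp add: less_imp_le)
  let ?f = "\<lambda>(x, y). ennreal (dens k x y * \<rho>0 y)"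
  have f[measurable]: "?f \<in> borel_measurable (lborel \<Otimes>\<^sub>M lborel)" by measurable
  have "distr M (lborel \<Otimes>\<^sub>M lborel) (\<lambda>\<omega>. (Y \<omega>, X0 \<omega>)) = density (lborel \<Otimes>\<^sub>M lborel) ?f"
  proof (rule measure_eqI)
    fix A assume "A \<in> sets (distr M (lborel \<Otimes>\<^sub>M lborel) (\<lambda>\<omega>. (Y \<omega>, X0 \<omega>)))"
    then have A[measurable]: "A \<in> sets (lborel \<Otimes>\<^sub>M lborel)" by simp
    then have A'[measurable]: "A \<in> sets (borel \<Otimes>\<^sub>M borel)" by (simp cong: sets_pair_measure_cong)
    have "emeasure (distr M (lborel \<Otimes>\<^sub>M lborel) (\<lambda>\<omega>. (Y \<omega>, X0 \<omega>))) A = (\<integral>\<^sup>+\<omega>. indicator A (Y \<omega>, X0 \<omega>) \<partial>M)"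
      by (subst nn_integral_indicator[symmetric], simp, subst nn_integral_distr) auto
    also have "\<dots> = (\<integral>\<^sup>+\<omega>. indicator A (flow (Suc k) (X0 \<omega>) (noises \<omega>), X0 \<omega>) \<partial>M)"
      using flow by (intro nn_integral_cong_AE) (auto elim!: eventually_mono simp del: flow.simps)
    also have "\<dots> = (\<integral>\<^sup>+y. \<integral>\<^sup>+x. indicator A (x, y) * (ennreal (dens k x y) * ennreal (\<rho>0 y)) \<partial>lborel \<partial>lborel)"
      by (rule nn_integral_joint) measurable
    also have "\<dots> = (\<integral>\<^sup>+y. \<integral>\<^sup>+x. ?f (x, y) * indicator A (x, y) \<partial>lborel \<partial>lborel)"
      by (intro nn_integral_cong) (simp add: ennreal_mult less_imp_le[OF dens_pos] less_imp_le[OF pos] mult.commute)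
    also have "\<dots> = (\<integral>\<^sup>+z. ?f z * indicator A z \<partial>(lborel \<Otimes>\<^sub>M lborel))"
      by (rule lborel_pair.nn_integral_snd) measurable
    also have "\<dots> = emeasure (density (lborel \<Otimes>\<^sub>M lborel) ?f) A"
      by (rule emeasure_density[symmetric]) measurable
    finally show "emeasure (distr M (lborel \<Otimes>\<^sub>M lborel) (\<lambda>\<omega>. (Y \<omega>, X0 \<omega>))) A = emeasure (density (lborel \<Otimes>\<^sub>M lborel) ?f) A" .
  qed simp
  then show ?thesis unfolding distributed_def by auto
qed

text \<open>The density \<open>r x\<close> is the mean of \<open>kern k x\<close> under the law of the position before the last step; as the
derivatives of \<open>kern k\<close> in \<open>x\<close> are bounded uniformly in the starting point, \<open>r\<close> is of class \<open>C\<^sup>2\<close> whatever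
that law is.\<close>

proposition marginal_distributed:
  assumes pos: "\<And>y. 0 < \<rho>0 y" and Y[measurable]: "Y \<in> borel_measurable M"
    and flow: "AE \<omega> in M. Y \<omega> = flow (Suc k) (X0 \<omega>) (noises \<omega>)"
  obtains r where "Ck_on 2 UNIV r" "\<And>x. 0 \<le> r x" "distributed M lborel Y (\<lambda>x. ennreal (r x))"
    "\<And>x. (\<integral>\<^sup>+y. ennreal (dens k x y * \<rho>0 y) \<partial>lborel) = ennreal (r x)"
proof -
  have [measurable]: "\<rho>0 \<in> borel_measurable borel"
    using \<rho>0_ennreal_measurable pos measurable_compose[OF \<rho>0_ennreal_measurable borel_measurable_enn2real] by (simp add: less_imp_le)
  define Z where "Z \<omega> = flow k (X0 \<omega>) (noises \<omega>)" for \<omega>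
  have Z[measurable]: "Z \<in> borel_measurable M" unfolding Z_def by (rule flow_noises_measurable) simp
  define \<mu> where "\<mu> = distr M borel Z"
  interpret \<mu>: prob_space \<mu> unfolding \<mu>_def by (rule prob_space_distr) simp
  have \<mu>: "finite_measure \<mu>" "sets \<mu> = sets borel" by (unfold_locales, simp add: \<mu>_def)
  define r where "r x = (\<integral>u. kern k x u \<partial>\<mu>)" for x
  have Ck: "Ck_on 2 UNIV r" unfolding r_def by (rule Ck_on_average(1)[OF smooth_kernel_kern \<mu>])
  have kpos: "0 \<le> kern k x u" for x u by (rule less_imp_le[OF smooth_densityD(1)[OF kern_smooth_density]])
  have r0: "0 \<le> r x" for x unfolding r_def by (simp add: kpos)
  have rint: "(\<integral>\<^sup>+y. ennreal (dens k x y * \<rho>0 y) \<partial>lborel) = ennreal (r x)" for x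
  proof -
    have "ennreal (r x) = (\<integral>\<^sup>+u. ennreal (kern k x u) \<partial>\<mu>)"
      unfolding r_def using Ck_on_average(2)[OF smooth_kernel_kern \<mu>]
      by (intro nn_integral_eq_integral[symmetric]) (auto simp: kpos)
    also have "\<dots> = (\<integral>\<^sup>+\<omega>. ennreal (kern k x (Z \<omega>)) \<partial>M)"
      unfolding \<mu>_def by (rule nn_integral_distr) measurable
    also have "\<dots> = (\<integral>\<^sup>+y. ennreal (dens k x y * \<rho>0 y) \<partial>lborel)"
      unfolding Z_def nn_integral_kern by (simp add: ennreal_mult less_imp_le[OF dens_pos] less_imp_le[OF pos])
    finally show ?thesis ..
  qed
  have [measurable]: "r \<in> borel_measurable borel"
    using Ck_on_continuous[OF Ck] by (rule borel_measurable_continuous_onI)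
  have "distr M lborel Y = density lborel (\<lambda>x. ennreal (r x))"
  proof (rule measure_eqI)
    fix A assume "A \<in> sets (distr M lborel Y)"
    then have A[measurable]: "A \<in> sets borel" by simp
    have "emeasure (distr M lborel Y) A = (\<integral>\<^sup>+\<omega>. indicator A (Y \<omega>) \<partial>M)"
      by (subst nn_integral_indicator[symmetric], simp, subst nn_integral_distr) auto
    also have "\<dots> = (\<integral>\<^sup>+\<omega>. indicator A (flow (Suc k) (X0 \<omega>) (noises \<omega>)) \<partial>M)"
      using flow by (intro nn_integral_cong_AE) (auto elim!: eventually_mono simp del: flow.simps)
    also have "\<dots> = (\<integral>\<^sup>+y. \<integral>\<^sup>+x. indicator A x * (ennreal (dens k x y) * ennreal (\<rho>0 y)) \<partial>lborel \<partial>lborel)"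
      using nn_integral_joint[of "\<lambda>z. indicator A (fst z)"] by (simp del: flow.simps)
    also have "\<dots> = (\<integral>\<^sup>+x. \<integral>\<^sup>+y. indicator A x * (ennreal (dens k x y) * ennreal (\<rho>0 y)) \<partial>lborel \<partial>lborel)"
      by (rule lborel_pair.Fubini') measurable
    also have "\<dots> = (\<integral>\<^sup>+x. ennreal (r x) * indicator A x \<partial>lborel)"
      unfolding rint[symmetric]
      by (intro nn_integral_cong, subst nn_integral_cmult)
        (auto simp: ennreal_mult less_imp_le[OF dens_pos] less_imp_le[OF pos] mult.commute)
    also have "\<dots> = emeasure (density lborel (\<lambda>x. ennreal (r x))) A"
      by (rule emeasure_density[symmetric]) auto
    finally show "emeasure (distr M lborel Y) A = emeasure (density lborel (\<lambda>x. ennreal (r x))) A" .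
  qed simp
  then have "distributed M lborel Y (\<lambda>x. ennreal (r x))" unfolding distributed_def by simp
  with Ck r0 rint show thesis using that by blast
qed

text \<open>Densities that agree almost everywhere and are continuous agree everywhere.  Dividing by the
positive \<open>\<rho>0\<close> transfers this from the joint density to the transition density.\<close>

proposition smooth_mixture_densities:
  assumes pos: "\<And>y. 0 < \<rho>0 y" and diff: "twice_differentiable \<rho>0" and Y[measurable]: "Y \<in> borel_measurable M"
    and flow: "AE \<omega> in M. Y \<omega> = flow (Suc k) (X0 \<omega>) (noises \<omega>)"
    and dens: "is_density_of M Y \<rho>t" and trans: "is_cond_density_of M Y X0 \<rho>0 pt"
  shows "smooth_mixture pt \<rho>0 \<rho>t"
proof -
  have \<rho>0_cont: "continuous_on UNIV \<rho>0" by (rule twice_differentiable_continuous[OF diff])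
  then have [measurable]: "\<rho>0 \<in> borel_measurable borel" by (rule borel_measurable_continuous_onI)
  note jd = joint_distributed[OF pos Y flow]
  obtain r where r: "Ck_on 2 UNIV r" "\<And>x. 0 \<le> r x" "distributed M lborel Y (\<lambda>x. ennreal (r x))"
    "\<And>x. (\<integral>\<^sup>+y. ennreal (dens k x y * \<rho>0 y) \<partial>lborel) = ennreal (r x)"
    using marginal_distributed[OF pos Y flow] by metis
  have \<rho>t: "\<rho>t x = r x" for x
  proof (rule continuous_AE_eq[where f=\<rho>t and g=r])
    have "AE x in lborel. ennreal (\<rho>t x) = ennreal (r x)"
      using dens r(3) by (intro distributed_unique) (auto simp: is_density_of_def)
    then show "AE x in lborel. \<rho>t x = r x"
      using dens r(2) by (auto elim!: eventually_mono simp: is_density_of_def)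
  qed (use dens r(1) Ck_on_continuous in \<open>auto simp: is_density_of_def\<close>)
  have pt: "pt x y = dens k x y" for x y
  proof -
    have dc: "continuous_on UNIV (\<lambda>(x, y). dens k x y)" and pc: "continuous_on UNIV (\<lambda>(x, y). pt x y)"
      using smooth_densityD(2)[OF dens_smooth_density] trans by (auto simp: is_cond_density_of_def)
    have rc: "continuous_on UNIV (\<lambda>z::(real^'d) \<times> (real^'d). \<rho>0 (snd z))"
      by (rule continuous_on_compose2[OF \<rho>0_cont]) (auto intro: continuous_intros)
    have "(\<lambda>z. pt (fst z) (snd z) * \<rho>0 (snd z)) (x, y) = (\<lambda>z. dens k (fst z) (snd z) * \<rho>0 (snd z)) (x, y)"
    proof (rule continuous_AE_eq[where f="\<lambda>z. pt (fst z) (snd z) * \<rho>0 (snd z)" and g="\<lambda>z. dens k (fst z) (snd z) * \<rho>0 (snd z)"])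
      show "continuous_on UNIV (\<lambda>z. pt (fst z) (snd z) * \<rho>0 (snd z))"
        "continuous_on UNIV (\<lambda>z. dens k (fst z) (snd z) * \<rho>0 (snd z))"
        using pc dc rc by (auto simp: case_prod_unfold intro: continuous_on_mult)
      have "AE z in lborel \<Otimes>\<^sub>M lborel. (case z of (x, y) \<Rightarrow> ennreal (pt x y * \<rho>0 y)) = (case z of (x, y) \<Rightarrow> ennreal (dens k x y * \<rho>0 y))"
        using trans jd by (intro distributed_unique) (auto simp: is_cond_density_of_def)
      then have "AE z in lborel \<Otimes>\<^sub>M lborel. pt (fst z) (snd z) * \<rho>0 (snd z) = dens k (fst z) (snd z) * \<rho>0 (snd z)"
      proof eventually_elim
        case (elim z)
        have "0 \<le> pt (fst z) (snd z) * \<rho>0 (snd z)" "0 \<le> dens k (fst z) (snd z) * \<rho>0 (snd z)"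
          using trans less_imp_le[OF pos] less_imp_le[OF dens_pos] by (auto simp: is_cond_density_of_def)
        then show ?case using elim by (simp add: case_prod_unfold)
      qed
      then show "AE z in lborel. pt (fst z) (snd z) * \<rho>0 (snd z) = dens k (fst z) (snd z) * \<rho>0 (snd z)"
        by (simp only: lborel_prod)
    qed
    then show ?thesis using pos[of y] by simp
  qed
  have nn: "0 \<le> dens k x y * \<rho>0 y" for x y using dens_pos pos by (simp add: less_imp_le)
  have slice: "integrable lborel (\<lambda>y. dens k x y * \<rho>0 y)" for x
  proof (rule integrableI_bounded)
    show "(\<lambda>y. dens k x y * \<rho>0 y) \<in> borel_measurable lborel" by measurable
    show "(\<integral>\<^sup>+y. ennreal (norm (dens k x y * \<rho>0 y)) \<partial>lborel) < \<infinity>" using r(4)[of x] nn by simp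
  qed
  have mix: "r x = (\<integral>y. dens k x y * \<rho>0 y \<partial>lborel)" for x
  proof -
    have "ennreal (r x) = ennreal (\<integral>y. dens k x y * \<rho>0 y \<partial>lborel)"
      unfolding r(4)[symmetric] by (rule nn_integral_eq_integral[OF slice]) (simp add: nn)
    then show ?thesis by (subst (asm) ennreal_inj) (auto simp: r(2) nn intro!: Bochner_Integration.integral_nonneg)
  qed
  show ?thesis
  proof
    show "0 < pt x y" for x y unfolding pt by (rule dens_pos)
    show "Ck_on 2 UNIV (\<lambda>(x, y). pt x y)" unfolding pt using dens_smooth_density[of k] by (simp add: smooth_density_def)
    show "0 < \<rho>0 y" for y by (rule pos)
    show "twice_differentiable \<rho>0" by (rule diff)
    show "0 < \<rho>t x" for x unfolding \<rho>t mix by (intro integral_lborel_pos slice mult_pos_pos dens_pos pos)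
    show "Ck_on 2 UNIV \<rho>t" using r(1) \<rho>t by (simp add: fun_eq_iff[symmetric] ext[of \<rho>t r])
    show "integrable lborel (\<lambda>y. pt x y * \<rho>0 y)" for x unfolding pt by (rule slice)
    show "\<rho>t x = (\<integral>y. pt x y * \<rho>0 y \<partial>lborel)" for x unfolding pt \<rho>t by (rule mix)
    show "integrable (lborel \<Otimes>\<^sub>M lborel) (\<lambda>(x, y). pt x y * \<rho>0 y)"
    proof (rule integrableI_bounded)
      show "(\<lambda>(x, y). pt x y * \<rho>0 y) \<in> borel_measurable (lborel \<Otimes>\<^sub>M lborel)" unfolding pt by measurable
      have "(\<integral>\<^sup>+z. ennreal (norm (case z of (x, y) \<Rightarrow> pt x y * \<rho>0 y)) \<partial>(lborel \<Otimes>\<^sub>M lborel))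
          = (\<integral>\<^sup>+z. (case z of (x, y) \<Rightarrow> ennreal (dens k x y * \<rho>0 y)) * 1 \<partial>(lborel \<Otimes>\<^sub>M lborel))"
        unfolding pt by (intro nn_integral_cong) (auto simp: nn)
      also have "\<dots> = (\<integral>\<^sup>+\<omega>. 1 \<partial>M)" by (rule distributed_nn_integral[OF jd]) simp
      finally show "(\<integral>\<^sup>+z. ennreal (norm (case z of (x, y) \<Rightarrow> pt x y * \<rho>0 y)) \<partial>(lborel \<Otimes>\<^sub>M lborel)) < \<infinity>"
        by (simp add: emeasure_space_1)
    qed
  qed
qed

end

section \<open>Application to the Euler scheme\<close>

lemma elliptic_step_of_conditions:
  assumes "\<kappa> > 0" "0 < \<delta>" "0 \<le> r"
    and drift: "drift_conditions L C q b" and diffusion: "diffusion_conditions L C q \<kappa> \<sigma>"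
  shows "elliptic_step \<delta> \<kappa> (b r) (\<sigma> r)"
proof
  have r: "r \<in> {0..}" using assms by simp
  have "Ck_on 3 UNIV (\<lambda>x. b r x)" "Ck_on 3 UNIV (\<lambda>x. \<sigma> r x)"
    using Ck_on_slice[OF r, of 3 "\<lambda>(t, x). b t x"] Ck_on_slice[OF r, of 3 "\<lambda>(t, x). \<sigma> t x"] drift diffusion
    by (simp_all add: drift_conditions_def diffusion_conditions_def)
  from this[THEN Ck_on_mono, of 2] show "Ck_on 2 UNIV (b r)" "Ck_on 2 UNIV (\<sigma> r)" by simp_all
  show "pos_semidef (\<sigma> r y ** transpose (\<sigma> r y) - mat \<kappa>)" for y
    using diffusion \<open>0 \<le> r\<close> by (simp add: diffusion_conditions_def diff_matrix_def)
qed (use assms in auto)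

lemma increment_law:
  fixes W :: "real \<Rightarrow> 'w \<Rightarrow> real^'m::finite"
  assumes bm: "std_brownian_motion M W" and st: "0 \<le> s" "s < t"
  shows "\<exists>c. c * (\<integral>\<^sup>+w. ennreal (exp (- (1 / (2 * (t - s))) * (norm (w::real^'m))\<^sup>2)) \<partial>lborel) = 1 \<and>
    distr M borel (\<lambda>\<omega>. W t \<omega> - W s \<omega>) = density lborel (\<lambda>w. c * ennreal (exp (- (1 / (2 * (t - s))) * (norm w)\<^sup>2)))"
proof -
  interpret prob_space M using bm by (simp add: std_brownian_motion_def)
  have [measurable]: "W t \<in> borel_measurable M" "W s \<in> borel_measurable M"
    using bm st by (auto simp: std_brownian_motion_def)
  show ?thesis
  proof (rule distr_normal_vector[of "t - s" "\<lambda>\<omega>. W t \<omega> - W s \<omega>"])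
    show "indep_vars (\<lambda>_. borel) (\<lambda>i \<omega>. (W t \<omega> - W s \<omega>) $ i) UNIV"
      "distributed M lborel (\<lambda>\<omega>. (W t \<omega> - W s \<omega>) $ i) (\<lambda>x. ennreal (normal_density 0 (sqrt (t - s)) x))" for i
      using bm st by (auto simp: std_brownian_motion_def)
  qed (use st in auto)
qed

text \<open>On its grid the scheme is a chain as above, driven by the increments of the Brownian motion; the last step is
shortened so that it ends at \<open>t\<close>.\<close>

lemma euler_smooth_mixture:
  fixes M :: "'w measure"
    and W :: "real \<Rightarrow> 'w \<Rightarrow> real^'m::finite"
    and b :: "real \<Rightarrow> real^'d::finite \<Rightarrow> real^'d"
    and \<sigma> :: "real \<Rightarrow> real^'d \<Rightarrow> real^'m^'d"
    and X :: "real \<Rightarrow> 'w \<Rightarrow> real^'d"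
    and \<rho>0 \<rho>t :: "real^'d \<Rightarrow> real"
    and pt :: "real^'d \<Rightarrow> real^'d \<Rightarrow> real"
    and L C q \<kappa> h t :: real
  assumes params: "L > 0" "C > 0" "q \<ge> 0" "\<kappa> > 0"
    and drift: "drift_conditions L C q b"
    and diffusion: "diffusion_conditions L C q \<kappa> \<sigma>"
    and bm: "std_brownian_motion M W"
    and h: "h > 0"
    and scheme: "euler_scheme M W b \<sigma> h X"
    and init: "distributed M lborel (X 0) (\<lambda>x. ennreal (\<rho>0 x))"
      "\<And>x. \<rho>0 x > 0" "twice_differentiable \<rho>0"
    and t: "t > 0"
    and dens: "is_density_of M (X t) \<rho>t"
    and trans: "is_cond_density_of M (X t) (X 0) \<rho>0 pt"
  shows "smooth_mixture pt \<rho>0 \<rho>t"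
proof -
  interpret prob_space M using bm by (simp add: std_brownian_motion_def)
  \<comment> \<open>\<open>k\<close> is the last grid index strictly before \<open>t\<close>, so that the last step has positive length\<close>
  define k where "k = nat (\<lceil>t / h\<rceil> - 1)"
  have ceil: "1 \<le> \<lceil>t / h\<rceil>" using t h by (simp add: one_le_ceiling)
  then have rk: "real k = real_of_int \<lceil>t / h\<rceil> - 1" by (simp add: k_def)
  have "real k < t / h" "t / h \<le> real k + 1" unfolding rk by linarith+
  then have kt: "real k * h < t" "t \<le> real (Suc k) * h" using h by (simp_all add: field_simps)
  define \<tau> where "\<tau> j = (if j \<le> k then real j * h else t)" for j :: nat
  define \<delta> where "\<delta> j = (if j < k then h else t - real k * h)" for j :: nat
  define D where "D j \<omega> = W (\<tau> (Suc j)) \<omega> - W (\<tau> j) \<omega>" for j \<omega>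
  have \<tau>0: "0 \<le> \<tau> j" for j using h t by (simp add: \<tau>_def)
  have \<tau>_diff: "\<tau> (Suc j) - \<tau> j = \<delta> j" if "j < Suc k" for j
    using that by (auto simp: \<tau>_def \<delta>_def algebra_simps)
  have \<delta>: "0 < \<delta> j" for j using h kt by (simp add: \<delta>_def)
  have "mono \<tau>"
  proof (rule mono_iff_le_Suc[THEN iffD2], intro allI)
    fix j show "\<tau> j \<le> \<tau> (Suc j)"
    proof (cases "j < Suc k")
      case True
      then show ?thesis using \<tau>_diff[OF True] \<delta>[of j] by linarith
    qed (simp add: \<tau>_def)
  qed
  have W_meas: "W s \<in> borel_measurable M" if "0 \<le> s" for s
    using bm that by (simp add: std_brownian_motion_def)
  have X_meas: "X s \<in> borel_measurable M" if "0 \<le> s" for s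
    using scheme that by (simp add: euler_scheme_def)
  have [measurable]: "W (\<tau> j) \<in> borel_measurable M" for j by (rule W_meas[OF \<tau>0])
  have steps: "elliptic_step (\<delta> j) \<kappa> (b (real j * h)) (\<sigma> (real j * h))" for j
      using params \<delta> h by (intro elliptic_step_of_conditions[OF _ _ _ drift diffusion]) auto
  have D_meas: "D j \<in> borel_measurable M" for j unfolding D_def by measurable
  have indep_D: "indep_vars (\<lambda>_. borel) D {..<Suc k}"
      using bm \<open>mono \<tau>\<close> \<tau>0[of 0] unfolding std_brownian_motion_def D_def[abs_def] by blast
  have noise: "\<exists>c. c * (\<integral>\<^sup>+w. ennreal (exp (- (1 / (2 * \<delta> j)) * (norm (w::real^'m))\<^sup>2)) \<partial>lborel) = 1 \<and>
      distr M borel (D j) = density lborel (\<lambda>w. c * ennreal (exp (- (1 / (2 * \<delta> j)) * (norm w)\<^sup>2)))" if "j < Suc k" for j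
    proof -
      have "\<tau> j < \<tau> (Suc j)" using \<tau>_diff[OF that] \<delta>[of j] by linarith
      from increment_law[OF bm \<tau>0 this] show ?thesis unfolding \<tau>_diff[OF that] D_def[abs_def] .
    qed
  have indep_X0: "distr M (borel \<Otimes>\<^sub>M Pi\<^sub>M {..<Suc k} (\<lambda>_. borel)) (\<lambda>\<omega>. (X 0 \<omega>, \<lambda>j\<in>{..<Suc k}. D j \<omega>))
        = distr M borel (X 0) \<Otimes>\<^sub>M distr M (Pi\<^sub>M {..<Suc k} (\<lambda>_. borel)) (\<lambda>\<omega>. \<lambda>j\<in>{..<Suc k}. D j \<omega>)"
  proof -
    let ?P = "\<lambda>\<omega>. \<lambda>s\<in>{0..}. W s \<omega>" and ?N = "Pi\<^sub>M {0..} (\<lambda>_. borel) :: (real \<Rightarrow> real^'m) measure"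
    let ?G = "\<lambda>f::real \<Rightarrow> real^'m. \<lambda>j\<in>{..<Suc k}. f (\<tau> (Suc j)) - f (\<tau> j)"
    have G: "?G \<in> measurable ?N (Pi\<^sub>M {..<Suc k} (\<lambda>_. borel))"
      using \<tau>0 by (intro measurable_restrict borel_measurable_diff measurable_component_singleton) auto
    have "distr M (borel \<Otimes>\<^sub>M Pi\<^sub>M {..<Suc k} (\<lambda>_. borel)) (\<lambda>\<omega>. (X 0 \<omega>, ?G (?P \<omega>)))
        = distr M borel (X 0) \<Otimes>\<^sub>M distr M (Pi\<^sub>M {..<Suc k} (\<lambda>_. borel)) (\<lambda>\<omega>. ?G (?P \<omega>))"
    proof (rule distr_pair_indep_set[OF _ X_meas _ G])
      show "indep_set (sets (vimage_algebra (space M) (X 0) borel)) (sets (vimage_algebra (space M) ?P ?N))"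
        using scheme unfolding euler_scheme_def by (elim conjE)
      show "?P \<in> space M \<rightarrow> space ?N" by (simp add: space_PiM)
    qed simp
    moreover have "?G (?P \<omega>) = (\<lambda>j\<in>{..<Suc k}. D j \<omega>)" for \<omega>
      using \<tau>0 by (auto simp: D_def fun_eq_iff)
    ultimately show ?thesis by simp
  qed
  interpret gaussian_chain M "X 0" \<rho>0 k D \<delta> \<kappa> "\<lambda>j. b (real j * h)" "\<lambda>j. \<sigma> (real j * h)"
    by (rule gaussian_chain.intro[OF prob_space_axioms gaussian_chain_axioms.intro[OF steps init(1) D_meas indep_X0 indep_D noise]])
  have "AE \<omega> in M. \<forall>k::nat. \<forall>t\<in>{real k * h .. real (Suc k) * h}.
      X t \<omega> = X (real k * h) \<omega> + integral {real k * h .. t} (\<lambda>s. b (real k * h) (X (real k * h) \<omega>))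
        + elem_ito_integral W (\<lambda>\<omega>. \<sigma> (real k * h) (X (real k * h) \<omega>)) (real k * h) t \<omega>"
    using scheme unfolding euler_scheme_def by (elim conjE)
  then have "AE \<omega> in M. X t \<omega> = flow (Suc k) (X 0 \<omega>) (noises \<omega>)"
  proof eventually_elim
    case (elim \<omega>)
    have "j \<le> Suc k \<Longrightarrow> X (\<tau> j) \<omega> = flow j (X 0 \<omega>) (noises \<omega>)" for j
    proof (induction j)
      case 0
      then show ?case by (simp add: \<tau>_def)
    next
      case (Suc j)
      then have j: "j < Suc k" by simp
      then have \<tau>j: "\<tau> j = real j * h" by (simp add: \<tau>_def)
      have \<tau>Sj: "\<tau> (Suc j) = real j * h + \<delta> j" using \<tau>_diff[OF j] \<tau>j by simp
      have "\<delta> j \<le> h" using kt h by (auto simp: \<delta>_def algebra_simps)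
      then have "\<tau> (Suc j) \<in> {real j * h .. real (Suc j) * h}"
        using \<delta>[of j] by (simp add: \<tau>Sj algebra_simps)
      from elim[rule_format, OF this] Suc.IH j \<delta>[of j] show ?case
        by (simp add: \<tau>j[symmetric] step_def elem_ito_integral_def D_def)
          (simp add: \<tau>Sj \<tau>j)
    qed
    from this[of "Suc k"] show ?case by (simp add: \<tau>_def del: flow.simps)
  qed
  from smooth_mixture_densities[OF init(2,3) X_meas this dens trans] t
  show ?thesis by simp
qed

theorem theorem4p2:
  fixes M :: "'w measure"
    and W :: "real \<Rightarrow> 'w \<Rightarrow> real^'m::finite"
    and b :: "real \<Rightarrow> real^'d::finite \<Rightarrow> real^'d"
    and \<sigma> :: "real \<Rightarrow> real^'d \<Rightarrow> real^'m^'d"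
    and X :: "real \<Rightarrow> 'w \<Rightarrow> real^'d"
    and \<rho>0 \<rho>t :: "real^'d \<Rightarrow> real"
    and pt :: "real^'d \<Rightarrow> real^'d \<Rightarrow> real"
    and L C q \<kappa> h t p :: real
  assumes params: "L > 0" "C > 0" "q \<ge> 0" "\<kappa> > 0"
    and drift: "drift_conditions L C q b"
    and diffusion: "diffusion_conditions L C q \<kappa> \<sigma>"
    and bm: "std_brownian_motion M W"
    and h: "h > 0"
    and scheme: "euler_scheme M W b \<sigma> h X"
    and init: "distributed M lborel (X 0) (\<lambda>x. ennreal (\<rho>0 x))"
      "\<And>x. \<rho>0 x > 0" "twice_differentiable \<rho>0"
    and t: "t > 0"
    and dens: "is_density_of M (X t) \<rho>t"
    and trans: "is_cond_density_of M (X t) (X 0) \<rho>0 pt"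
    and p: "p \<ge> 1"
  shows
    "(\<integral>\<^sup>+x. ennreal (norm (grad (\<lambda>z. ln (\<rho>t z)) x) powr p * \<rho>t x) \<partial>lborel)
       \<le> ennreal (score_const p) *
          ((\<integral>\<^sup>+y. ennreal (norm (grad (\<lambda>z. ln (\<rho>0 z)) y) powr p * \<rho>0 y) \<partial>lborel)
           + (\<integral>\<^sup>+\<omega>. ennreal (norm (R_score pt (X t \<omega>) (X 0 \<omega>)) powr p) \<partial>M))
     \<and>
     (\<integral>\<^sup>+x. ennreal (spec_norm (hess (\<lambda>z. ln (\<rho>t z)) x) powr p * \<rho>t x) \<partial>lborel)
       \<le> ennreal (score_const p) *
          ((\<integral>\<^sup>+y. ennreal (spec_norm (hess (\<lambda>z. ln (\<rho>0 z)) y) powr p * \<rho>0 y) \<partial>lborel)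
           + (\<integral>\<^sup>+\<omega>. ennreal (spec_norm (R2_score pt (X t \<omega>) (X 0 \<omega>)) powr p) \<partial>M)
           + (\<integral>\<^sup>+y. ennreal (norm (grad (\<lambda>z. ln (\<rho>0 z)) y) powr (2 * p) * \<rho>0 y) \<partial>lborel)
           + (\<integral>\<^sup>+\<omega>. ennreal (norm (R_score pt (X t \<omega>) (X 0 \<omega>)) powr (2 * p)) \<partial>M))"
proof -
  interpret prob_space M using bm by (simp add: std_brownian_motion_def)
  interpret smooth_mixture pt \<rho>0 \<rho>t
    by (rule euler_smooth_mixture[OF params drift diffusion bm h scheme init t dens trans])
  \<comment> \<open>the integrals over pairs are expectations under the joint law of \<open>(X\<^sub>t, X\<^sub>0)\<close>\<close>
  have joint: "(\<integral>\<^sup>+(x, y). ennreal (F x y * f x y) \<partial>(lborel \<Otimes>\<^sub>M lborel)) = (\<integral>\<^sup>+\<omega>. ennreal (f (X t \<omega>) (X 0 \<omega>)) \<partial>M)"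
    if f: "(\<lambda>(x, y). f x y) \<in> borel_measurable (borel \<Otimes>\<^sub>M borel)" "\<And>x y. 0 \<le> f x y" for f
  proof -
    note f(1)[measurable]
    have "(\<integral>\<^sup>+(x, y). ennreal (F x y * f x y) \<partial>(lborel \<Otimes>\<^sub>M lborel))
      = (\<integral>\<^sup>+z. (case z of (x, y) \<Rightarrow> ennreal (pt x y * \<rho>0 y)) * ennreal (case z of (x, y) \<Rightarrow> f x y) \<partial>(lborel \<Otimes>\<^sub>M lborel))"
      by (intro nn_integral_cong) (auto simp: ennreal_mult f(2) F_nonneg F_def[symmetric])
    also have "\<dots> = (\<integral>\<^sup>+\<omega>. ennreal (f (X t \<omega>) (X 0 \<omega>)) \<partial>M)"
      using trans by (subst distributed_nn_integral) (auto simp: is_cond_density_of_def)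
    finally show ?thesis .
  qed
  have initial: "(\<integral>\<^sup>+(x, y). ennreal (F x y * f y) \<partial>(lborel \<Otimes>\<^sub>M lborel)) = (\<integral>\<^sup>+y. ennreal (f y * \<rho>0 y) \<partial>lborel)"
    if f[measurable]: "f \<in> borel_measurable borel" and f0: "\<And>y. 0 \<le> f y" for f
  proof -
    have "(\<integral>\<^sup>+(x, y). ennreal (F x y * f y) \<partial>(lborel \<Otimes>\<^sub>M lborel)) = (\<integral>\<^sup>+\<omega>. ennreal (f (X 0 \<omega>)) \<partial>M)"
      using f0 by (intro joint) auto
    also have "\<dots> = (\<integral>\<^sup>+y. ennreal (\<rho>0 y) * ennreal (f y) \<partial>lborel)"
      using init(1) by (subst distributed_nn_integral) auto
    also have "\<dots> = (\<integral>\<^sup>+y. ennreal (f y * \<rho>0 y) \<partial>lborel)"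
      using f0 by (intro nn_integral_cong) (simp add: ennreal_mult less_imp_le[OF \<rho>0_pos] mult.commute)
    finally show ?thesis .
  qed
  have S: "(\<integral>\<^sup>+(x, y). ennreal (F x y * norm (S0 y) powr r) \<partial>(lborel \<Otimes>\<^sub>M lborel))
      = (\<integral>\<^sup>+y. ennreal (norm (grad (\<lambda>z. ln (\<rho>0 z)) y) powr r * \<rho>0 y) \<partial>lborel)" for r
  proof -
    have "(\<lambda>y. norm (S0 y) powr r) \<in> borel_measurable borel" by measurable
    from initial[OF this] show ?thesis by (simp add: S0_def)
  qed
  have H: "(\<integral>\<^sup>+(x, y). ennreal (F x y * spec_norm (H0 y) powr r) \<partial>(lborel \<Otimes>\<^sub>M lborel))
      = (\<integral>\<^sup>+y. ennreal (spec_norm (hess (\<lambda>z. ln (\<rho>0 z)) y) powr r * \<rho>0 y) \<partial>lborel)" for r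
  proof -
    have "(\<lambda>y. spec_norm (H0 y) powr r) \<in> borel_measurable borel" by measurable
    from initial[OF this] show ?thesis by (simp add: H0_def)
  qed
  have R: "(\<integral>\<^sup>+(x, y). ennreal (F x y * norm (R_score pt x y) powr r) \<partial>(lborel \<Otimes>\<^sub>M lborel))
      = (\<integral>\<^sup>+\<omega>. ennreal (norm (R_score pt (X t \<omega>) (X 0 \<omega>)) powr r) \<partial>M)" for r
    by (rule joint) auto
  have R2: "(\<integral>\<^sup>+(x, y). ennreal (F x y * spec_norm (R2_score pt x y) powr r) \<partial>(lborel \<Otimes>\<^sub>M lborel))
      = (\<integral>\<^sup>+\<omega>. ennreal (spec_norm (R2_score pt (X t \<omega>) (X 0 \<omega>)) powr r) \<partial>M)" for r
    by (rule joint) auto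
  show ?thesis
    using score_moment_bound[OF p] Hessian_moment_bound[OF p]
    unfolding S H R R2 score_const_def by blast
qed

end
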